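(* Let $D$ be a twisted link diagram and let $\tilde D$ be a double covering diagram of $D$. Then the twisted link quandle $\tilde Q(D)$ of $D$ is (isomorphic to) the (upper) virtual link quandle $Q(\tilde D)$ of $\tilde D$.
   Context: **Diagrams.** A twisted link diagram is an oriented link diagram in $\mathbb R^2$ in which each double point is either a real crossing (with over/under information) or a virtual crossing (encircled, without over/under information), and which may carry finitely many bars; a bar is a small edge meeting an arc of the diagram transversely, away from double points. A virtual link diagram is one without bars. **Double covering diagram.** Let $r:\mathbb R^2\to\mathbb R^2$, $(x,y)\mapsto(-x,y)$, let $c$ be the operation switching over/under information at every real crossing, and let $s=c\circ r$ on twisted link diagrams. Let $h(x,y)=y$. A twisted link diagram $D$ is in general position with respect to $h$ if (1) the critical points of $h|_D$ are maximal or minimal points, (2) $h$ is injective on the set consisting of the critical points of $h|_D$, the real crossings, the virtual crossings and the intersections of $D$ with bars, and (3) the image under $h$ of each bar is a point. Given $D$, move it by an isotopy of $\mathbb R^2$ into $\{x>0\}$ and into general position. Let $l_1,\dots,l_n$ be the horizontal lines containing the bars, with thin horizontal neighbourhoods $N(l_i)$ in which $s(D)\cup D$ has no critical points of $h$, crossings or bars other than the two mirror-symmetric bars on $l_i$. In each $N(l_i)$ delete the two bars and replace the two barred arcs, located at horizontal positions $\pm p_i$, by two arcs monotone in $h$, one joining the bottom endpoint at $p_i$ to the top endpoint at $-p_i$ and the other joining the bottom endpoint at $-p_i$ to the top endpoint at $p_i$; all other arcs in $N(l_i)$ are kept and all crossings arising in $N(l_i)$ are virtual. The resulting virtual link diagram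 $\tilde D$ is called a double covering diagram of $D$. **Quandles.** A quandle has operation $*$ and dual operation $\overline{*}$, with $(b*a)\,\overline{*}\,a=b=(b\,\overline{*}\,a)*a$; $b*a$ plays the role of $a^{-1}ba$ and $b\,\overline{*}\,a$ of $aba^{-1}$. A semi-arc of a diagram is one of the pieces obtained by cutting the diagram at all real crossings and all bars (virtual crossings are ignored). To each semi-arc $a$ assign symbols $x_a$ and $y_a$. At a real crossing $c$, let the over strand arrive along semi-arc $a$ and leave along $a'$, and the under strand arrive along $b$ and leave along $b'$. If $c$ is positive (the over direction followed by the under direction is a positive basis of $\mathbb R^2$), the upper relations are $x_{a'}=x_a,\ x_{b'}=x_b*x_a$ and the lower relations are $y_{a'}=y_a*y_b,\ y_{b'}=y_b$. If $c$ is negative, the upper relations are $x_{a'}=x_a,\ x_{b'}=x_b\,\overline{*}\,x_a$ and the lower relations are $y_{a'}=y_a\,\overline{*}\,y_b,\ y_{b'}=y_b$. At a bar where semi-arc $a$ arrives and $a'$ leaves, the bar relations are $x_{a'}=y_a,\ y_{a'}=x_a$. The twisted link quandle $\tilde Q(D)$ is the quandle presented by generators $x_a,y_a$ for all semi-arcs $a$ and all upper, lower and bar relations. For a virtual link diagram $D$, the (upper) virtual link quandle $Q(D)$ is the quandle presented by generators $x_a$ and the upper relations at all real crossings. *)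

theory Defs
  imports "HOL-Analysis.Analysis"
begin

section \<open>Quandles and their presentations\<close>

text \<open>\<open>qop Q b a\<close> is $b * a$ and \<open>qdual Q b a\<close> is $b \mathbin{\overline{*}} a$.\<close>

record 'a quandle_struct =
  qcarrier :: "'a set"
  qop :: "'a \<Rightarrow> 'a \<Rightarrow> 'a"
  qdual :: "'a \<Rightarrow> 'a \<Rightarrow> 'a"

definition quandle :: "'a quandle_struct \<Rightarrow> bool" where
  "quandle Q \<longleftrightarrow>
     (\<forall>a\<in>qcarrier Q. \<forall>b\<in>qcarrier Q. qop Q b a \<in> qcarrier Q \<and> qdual Q b a \<in> qcarrier Q) \<and>
     (\<forall>a\<in>qcarrier Q. qop Q a a = a) \<and>
     (\<forall>a\<in>qcarrier Q. \<forall>b\<in>qcarrier Q.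
        qdual Q (qop Q b a) a = b \<and> qop Q (qdual Q b a) a = b) \<and>
     (\<forall>a\<in>qcarrier Q. \<forall>b\<in>qcarrier Q. \<forall>c\<in>qcarrier Q.
        qop Q (qop Q c b) a = qop Q (qop Q c a) (qop Q b a))"

definition quandle_isomorphic :: "'a quandle_struct \<Rightarrow> 'b quandle_struct \<Rightarrow> bool" where
  "quandle_isomorphic Q Q' \<longleftrightarrow>
     (\<exists>f. bij_betw f (qcarrier Q) (qcarrier Q') \<and>
        (\<forall>a\<in>qcarrier Q. \<forall>b\<in>qcarrier Q.
           f (qop Q b a) = qop Q' (f b) (f a) \<and> f (qdual Q b a) = qdual Q' (f b) (f a)))"

datatype 'g qterm =
    Gen 'g
  | Op "'g qterm" "'g qterm" (infixl "\<triangleright>" 70)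
  | Dual "'g qterm" "'g qterm" (infixl "\<triangleright>\<^sup>-" 70)

definition qterms :: "'g set \<Rightarrow> 'g qterm set" where
  "qterms G = {t. set_qterm t \<subseteq> G}"

text \<open>The least congruence on the terms over \<open>G\<close> that contains the relations \<open>R\<close> and whose
  quotient satisfies the quandle axioms.\<close>

inductive qcong :: "'g set \<Rightarrow> ('g qterm \<times> 'g qterm) set \<Rightarrow> 'g qterm \<Rightarrow> 'g qterm \<Rightarrow> bool"
  for G :: "'g set" and R :: "('g qterm \<times> 'g qterm) set" where
  qcong_refl: "t \<in> qterms G \<Longrightarrow> qcong G R t t"
| qcong_sym: "qcong G R s t \<Longrightarrow> qcong G R t s"
| qcong_trans: "qcong G R s t \<Longrightarrow> qcong G R t u \<Longrightarrow> qcong G R s u"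
| qcong_Op: "qcong G R s s' \<Longrightarrow> qcong G R t t' \<Longrightarrow> qcong G R (s \<triangleright> t) (s' \<triangleright> t')"
| qcong_Dual: "qcong G R s s' \<Longrightarrow> qcong G R t t' \<Longrightarrow> qcong G R (s \<triangleright>\<^sup>- t) (s' \<triangleright>\<^sup>- t')"
| qcong_rel: "(s, t) \<in> R \<Longrightarrow> s \<in> qterms G \<Longrightarrow> t \<in> qterms G \<Longrightarrow> qcong G R s t"
| qcong_idem: "a \<in> qterms G \<Longrightarrow> qcong G R (a \<triangleright> a) a"
| qcong_inv1: "a \<in> qterms G \<Longrightarrow> b \<in> qterms G \<Longrightarrow> qcong G R ((b \<triangleright> a) \<triangleright>\<^sup>- a) b"
| qcong_inv2: "a \<in> qterms G \<Longrightarrow> b \<in> qterms G \<Longrightarrow> qcong G R ((b \<triangleright>\<^sup>- a) \<triangleright> a) b"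
| qcong_dist: "a \<in> qterms G \<Longrightarrow> b \<in> qterms G \<Longrightarrow> c \<in> qterms G \<Longrightarrow>
    qcong G R ((c \<triangleright> b) \<triangleright> a) ((c \<triangleright> a) \<triangleright> (b \<triangleright> a))"

definition qcong_rel_on :: "'g set \<Rightarrow> ('g qterm \<times> 'g qterm) set \<Rightarrow> ('g qterm \<times> 'g qterm) set" where
  "qcong_rel_on G R = {(s, t). qcong G R s t}"

definition presented_quandle ::
  "'g set \<Rightarrow> ('g qterm \<times> 'g qterm) set \<Rightarrow> 'g qterm set quandle_struct" where
  "presented_quandle G R =
     \<lparr>qcarrier = qterms G // qcong_rel_on G R,
      qop = (\<lambda>B A. qcong_rel_on G R `` {s \<triangleright> t | s t. s \<in> B \<and> t \<in> A}),
      qdual = (\<lambda>B A. qcong_rel_on G R `` {s \<triangleright>\<^sup>- t | s t. s \<in> B \<and> t \<in> A})\<rparr>"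

lemma qterms_simps [simp]:
  "Gen g \<in> qterms G \<longleftrightarrow> g \<in> G"
  "s \<triangleright> t \<in> qterms G \<longleftrightarrow> s \<in> qterms G \<and> t \<in> qterms G"
  "s \<triangleright>\<^sup>- t \<in> qterms G \<longleftrightarrow> s \<in> qterms G \<and> t \<in> qterms G"
  by (auto simp: qterms_def)

lemma qcong_in_qterms: "qcong G R s t \<Longrightarrow> s \<in> qterms G \<and> t \<in> qterms G"
  by (induction rule: qcong.induct) auto

lemma equiv_qcong: "equiv (qterms G) (qcong_rel_on G R)"
  unfolding qcong_rel_on_def
  by (rule equivI)
     (auto simp: refl_on_def sym_def trans_def dest: qcong_in_qterms intro: qcong.intros)

lemma qop_class:
  assumes "s \<in> qterms G" "t \<in> qterms G"
  shows "qop (presented_quandle G R) (qcong_rel_on G R `` {s}) (qcong_rel_on G R `` {t})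
           = qcong_rel_on G R `` {s \<triangleright> t}"
    and "qdual (presented_quandle G R) (qcong_rel_on G R `` {s}) (qcong_rel_on G R `` {t})
           = qcong_rel_on G R `` {s \<triangleright>\<^sup>- t}"
  using assms
  by (auto simp: presented_quandle_def qcong_rel_on_def Image_def
           intro: qcong.intros) (blast intro: qcong.intros)+

lemma quandle_presented_quandle: "quandle (presented_quandle G R)"
proof -
  let ?E = "qcong_rel_on G R"
  have carrier: "qcarrier (presented_quandle G R) = (\<lambda>t. ?E `` {t}) ` qterms G"
    by (auto simp: presented_quandle_def quotient_def)
  have eq: "?E `` {s} = ?E `` {t}" if "qcong G R s t" for s t
    by (rule equiv_class_eq[OF equiv_qcong]) (simp add: qcong_rel_on_def that)
  show ?thesis
    unfolding quandle_def carrier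
    by (simp add: qop_class eq qcong_idem qcong_inv1 qcong_inv2 qcong_dist)
qed


section \<open>Twisted link diagrams\<close>

type_synonym plane = "real \<times> real"

text \<open>A point of the source of a diagram, a disjoint union of circles: number of the component
  and point of the unit circle.  Components are oriented counterclockwise.\<close>

type_synonym param = "nat \<times> complex"

text \<open>\<open>crossings\<close> contains the pair (over parameter, under parameter) of every real crossing; all
  other double points are virtual crossings.  A bar is given by its point set.\<close>

record diagram =
  ncomp :: nat
  curve :: "param \<Rightarrow> plane"
  crossings :: "(param \<times> param) set"
  bars :: "plane set set"

definition params :: "diagram \<Rightarrow> param set" where
  "params D = {..<ncomp D} \<times> sphere 0 1"

definition advance :: "param \<Rightarrow> real \<Rightarrow> param" where
  "advance w t = (fst w, snd w * cis t)"

definition velocity :: "diagram \<Rightarrow> param \<Rightarrow> plane" where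
  "velocity D w = vector_derivative (\<lambda>t. curve D (advance w t)) (at 0)"

definition height :: "plane \<Rightarrow> real" where
  "height p = snd p"

definition det2 :: "plane \<Rightarrow> plane \<Rightarrow> real" where
  "det2 u v = fst u * snd v - snd u * fst v"

definition double_pairs :: "diagram \<Rightarrow> (param \<times> param) set" where
  "double_pairs D = {(u, v). u \<in> params D \<and> v \<in> params D \<and> u \<noteq> v \<and> curve D u = curve D v}"

definition generic_immersion :: "diagram \<Rightarrow> bool" where
  "generic_immersion D \<longleftrightarrow>
     (\<forall>i<ncomp D. (\<lambda>t. curve D (i, cis t)) C1_differentiable_on UNIV) \<and>
     (\<forall>w\<in>params D. velocity D w \<noteq> 0) \<and>
     finite (double_pairs D) \<and>
     (\<forall>(u, v)\<in>double_pairs D. det2 (velocity D u) (velocity D v) \<noteq> 0) \<and>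
     (\<forall>u v w. (u, v) \<in> double_pairs D \<longrightarrow> (v, w) \<in> double_pairs D \<longrightarrow> w = u)"

text \<open>A bar is an embedded edge that meets the diagram in exactly one point, which is not a double
  point, transversely and in its interior.\<close>

definition is_bar :: "diagram \<Rightarrow> plane set \<Rightarrow> bool" where
  "is_bar D b \<longleftrightarrow>
     (\<exists>\<beta> w s. \<beta> C1_differentiable_on {0..1} \<and> inj_on \<beta> {0..1} \<and> \<beta> ` {0..1} = b \<and>
        (\<forall>t\<in>{0..1}. vector_derivative \<beta> (at t) \<noteq> 0) \<and>
        {v \<in> params D. curve D v \<in> b} = {w} \<and>
        0 < s \<and> s < 1 \<and> curve D w = \<beta> s \<and>
        det2 (velocity D w) (vector_derivative \<beta> (at s)) \<noteq> 0)"

definition twisted_link_diagram :: "diagram \<Rightarrow> bool" where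
  "twisted_link_diagram D \<longleftrightarrow>
     generic_immersion D \<and>
     crossings D \<subseteq> double_pairs D \<and> antisym (crossings D) \<and>
     finite (bars D) \<and> disjoint (bars D) \<and> (\<forall>b\<in>bars D. is_bar D b)"

definition virtual_link_diagram :: "diagram \<Rightarrow> bool" where
  "virtual_link_diagram D \<longleftrightarrow> twisted_link_diagram D \<and> bars D = {}"


section \<open>Link quandles\<close>

definition bar_params :: "diagram \<Rightarrow> param set" where
  "bar_params D = {w \<in> params D. curve D w \<in> \<Union> (bars D)}"

type_synonym semi_arc = "param set"

definition semi_arcs :: "diagram \<Rightarrow> semi_arc set" where
  "semi_arcs D = components (params D - (Field (crossings D) \<union> bar_params D))"

definition arrives :: "diagram \<Rightarrow> param \<Rightarrow> semi_arc \<Rightarrow> bool" where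
  "arrives D w a \<longleftrightarrow> a \<in> semi_arcs D \<and> (\<forall>\<^sub>F t in at_left 0. advance w t \<in> a)"

definition leaves :: "diagram \<Rightarrow> param \<Rightarrow> semi_arc \<Rightarrow> bool" where
  "leaves D w a \<longleftrightarrow> a \<in> semi_arcs D \<and> (\<forall>\<^sub>F t in at_right 0. advance w t \<in> a)"

text \<open>At a real crossing the over strand arrives along \<open>a\<close> and leaves along \<open>a'\<close>, the under strand
  arrives along \<open>b\<close> and leaves along \<open>b'\<close>.\<close>

definition crossing_at ::
  "diagram \<Rightarrow> param \<Rightarrow> param \<Rightarrow> semi_arc \<Rightarrow> semi_arc \<Rightarrow> semi_arc \<Rightarrow> semi_arc \<Rightarrow> bool" where
  "crossing_at D u v a a' b b' \<longleftrightarrow>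
     (u, v) \<in> crossings D \<and> arrives D u a \<and> leaves D u a' \<and> arrives D v b \<and> leaves D v b'"

definition positive :: "diagram \<Rightarrow> param \<Rightarrow> param \<Rightarrow> bool" where
  "positive D u v \<longleftrightarrow> det2 (velocity D u) (velocity D v) > 0"

definition negative :: "diagram \<Rightarrow> param \<Rightarrow> param \<Rightarrow> bool" where
  "negative D u v \<longleftrightarrow> det2 (velocity D u) (velocity D v) < 0"

definition upper_relations ::
  "(semi_arc \<Rightarrow> 'g qterm) \<Rightarrow> diagram \<Rightarrow> ('g qterm \<times> 'g qterm) set" where
  "upper_relations x D =
     {(x a', x a) | a a'. \<exists>u v b b'. crossing_at D u v a a' b b'} \<union>
     {(x b', x b \<triangleright> x a) | a b b'. \<exists>u v a'. crossing_at D u v a a' b b' \<and> positive D u v} \<union>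
     {(x b', x b \<triangleright>\<^sup>- x a) | a b b'. \<exists>u v a'. crossing_at D u v a a' b b' \<and> negative D u v}"

definition lower_relations ::
  "(semi_arc \<Rightarrow> 'g qterm) \<Rightarrow> diagram \<Rightarrow> ('g qterm \<times> 'g qterm) set" where
  "lower_relations y D =
     {(y a', y a \<triangleright> y b) | a a' b. \<exists>u v b'. crossing_at D u v a a' b b' \<and> positive D u v} \<union>
     {(y a', y a \<triangleright>\<^sup>- y b) | a a' b. \<exists>u v b'. crossing_at D u v a a' b b' \<and> negative D u v} \<union>
     {(y b', y b) | b b'. \<exists>u v a a'. crossing_at D u v a a' b b'}"

definition bar_relations ::
  "(semi_arc \<Rightarrow> 'g qterm) \<Rightarrow> (semi_arc \<Rightarrow> 'g qterm) \<Rightarrow> diagram \<Rightarrow> ('g qterm \<times> 'g qterm) set" where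
  "bar_relations x y D =
     {(x a', y a) | a a'. \<exists>w\<in>bar_params D. arrives D w a \<and> leaves D w a'} \<union>
     {(y a', x a) | a a'. \<exists>w\<in>bar_params D. arrives D w a \<and> leaves D w a'}"

datatype twisted_generator = X semi_arc | Y semi_arc

definition twisted_link_quandle :: "diagram \<Rightarrow> twisted_generator qterm set quandle_struct" where
  "twisted_link_quandle D =
     presented_quandle (X ` semi_arcs D \<union> Y ` semi_arcs D)
       (upper_relations (\<lambda>a. Gen (X a)) D \<union> lower_relations (\<lambda>a. Gen (Y a)) D \<union>
        bar_relations (\<lambda>a. Gen (X a)) (\<lambda>a. Gen (Y a)) D)"

definition virtual_link_quandle :: "diagram \<Rightarrow> semi_arc qterm set quandle_struct" where
  "virtual_link_quandle D = presented_quandle (semi_arcs D) (upper_relations Gen D)"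


section \<open>Isotopy and general position\<close>

definition ambient_isotopy :: "(real \<Rightarrow> plane \<Rightarrow> plane) \<Rightarrow> bool" where
  "ambient_isotopy F \<longleftrightarrow>
     F 0 = id \<and>
     (\<forall>t\<in>{0..1}. bij (F t)) \<and>
     continuous_on ({0..1} \<times> UNIV) (\<lambda>(t, p). F t p) \<and>
     (\<exists>F' :: real \<times> plane \<Rightarrow> plane \<Rightarrow>\<^sub>L plane.
        continuous_on ({0..1} \<times> UNIV) F' \<and>
        (\<forall>t\<in>{0..1}. \<forall>p. (F t has_derivative blinfun_apply (F' (t, p))) (at p) \<and>
                         bij (blinfun_apply (F' (t, p)))))"

definition image_diagram :: "(plane \<Rightarrow> plane) \<Rightarrow> diagram \<Rightarrow> diagram" where
  "image_diagram f D = D\<lparr>curve := f \<circ> curve D, bars := (\<lambda>b. f ` b) ` bars D\<rparr>"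

definition critical_params :: "diagram \<Rightarrow> param set" where
  "critical_params D = {w \<in> params D. height (velocity D w) = 0}"

definition general_position :: "diagram \<Rightarrow> bool" where
  "general_position D \<longleftrightarrow>
     (\<forall>w\<in>critical_params D.
        (\<forall>\<^sub>F v in at w within params D. height (curve D v) \<le> height (curve D w)) \<or>
        (\<forall>\<^sub>F v in at w within params D. height (curve D v) \<ge> height (curve D w))) \<and>
     inj_on height (curve D ` (critical_params D \<union> Field (double_pairs D) \<union> bar_params D)) \<and>
     (\<forall>b\<in>bars D. \<exists>c. height ` b = {c})"

definition in_right_half_plane :: "diagram \<Rightarrow> bool" where
  "in_right_half_plane D \<longleftrightarrow> curve D ` params D \<union> \<Union> (bars D) \<subseteq> {p. fst p > 0}"


section \<open>Double covering diagrams\<close>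

definition mirror :: "plane \<Rightarrow> plane" where
  "mirror p = (- fst p, snd p)"

definition switch_crossings :: "diagram \<Rightarrow> diagram" where
  "switch_crossings D = D\<lparr>crossings := converse (crossings D)\<rparr>"

definition s_diagram :: "diagram \<Rightarrow> diagram" where
  "s_diagram D = switch_crossings (image_diagram mirror D)"

text \<open>The lift of a diagram to the unit tangent bundle of the plane is injective, because double
  points are transverse.  Its image records the diagram as an oriented subset of the plane, with
  the two branches at a double point kept apart and independently of the parametrization.\<close>

definition lift :: "diagram \<Rightarrow> param \<Rightarrow> plane \<times> plane" where
  "lift D w = (curve D w, sgn (velocity D w))"

definition lifted_crossings :: "diagram \<Rightarrow> ((plane \<times> plane) \<times> (plane \<times> plane)) set" where
  "lifted_crossings D = (\<lambda>(u, v). (lift D u, lift D v)) ` crossings D"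

text \<open>\<open>{lo..hi}\<close> is the range of heights of the strip $N(l)$ around the horizontal line \<open>l\<close> through
  the bar of \<open>D\<close> at \<open>w\<close>.\<close>

definition over_strip :: "diagram \<Rightarrow> real \<Rightarrow> real \<Rightarrow> param set" where
  "over_strip D lo hi = {v \<in> params D. height (curve D v) \<in> {lo..hi}}"

definition thin_strip :: "diagram \<Rightarrow> param \<Rightarrow> real \<Rightarrow> real \<Rightarrow> bool" where
  "thin_strip D w lo hi \<longleftrightarrow>
     lo < height (curve D w) \<and> height (curve D w) < hi \<and>
     (\<forall>E\<in>{D, s_diagram D}.
        over_strip E lo hi \<inter> (critical_params E \<union> Field (double_pairs E)) = {} \<and>
        (\<forall>b\<in>bars E. height ` b \<inter> {lo..hi} \<noteq> {} \<longrightarrow> curve E w \<in> b))"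

definition barred_arc :: "diagram \<Rightarrow> param \<Rightarrow> real \<Rightarrow> real \<Rightarrow> param set" where
  "barred_arc D w lo hi = connected_component_set (over_strip D lo hi) w"

text \<open>An arc of \<open>D\<close>, monotone in the height, from the point \<open>P\<close> up to the point \<open>Q\<close>.  The path \<open>g\<close>
  runs upwards and need not follow the orientation of \<open>D\<close>.\<close>

definition monotone_arc :: "diagram \<Rightarrow> (real \<Rightarrow> param) \<Rightarrow> plane \<Rightarrow> plane \<Rightarrow> bool" where
  "monotone_arc D g P Q \<longleftrightarrow>
     path g \<and> path_image g \<subseteq> params D \<and>
     strict_mono_on {0..1} (\<lambda>t. height (curve D (g t))) \<and>
     curve D (pathstart g) = P \<and> curve D (pathfinish g) = Q"

text \<open>\<open>g\<close> and \<open>g'\<close> are the arcs of \<open>Dt\<close> that replace the barred arc of \<open>D\<close> at \<open>w\<close>, with bottom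
  endpoint \<open>b\<close> and top endpoint \<open>t\<close>, and its mirror image.\<close>

definition replaces_barred_arcs ::
  "diagram \<Rightarrow> diagram \<Rightarrow> param \<Rightarrow> real \<Rightarrow> real \<Rightarrow> (real \<Rightarrow> param) \<Rightarrow> (real \<Rightarrow> param) \<Rightarrow> bool" where
  "replaces_barred_arcs D Dt w lo hi g g' \<longleftrightarrow>
     (\<exists>b\<in>barred_arc D w lo hi. \<exists>t\<in>barred_arc D w lo hi.
        height (curve D b) = lo \<and> height (curve D t) = hi \<and>
        monotone_arc Dt g (curve D b) (mirror (curve D t)) \<and>
        monotone_arc Dt g' (mirror (curve D b)) (curve D t) \<and>
        path_image g \<inter> path_image g' = {})"

text \<open>\<open>Dt\<close> consists of $s(D) \cup D$ without the barred arcs, and of the new arcs.  The new arcs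
  inherit their orientation, since the curves of \<open>Dt\<close> are oriented and continuously
  differentiable.  The real crossings of \<open>Dt\<close> are those of $s(D) \cup D$, so that all crossings
  on the new arcs are virtual.\<close>

definition doubling :: "diagram \<Rightarrow> diagram \<Rightarrow> bool" where
  "doubling D Dt \<longleftrightarrow>
     (\<exists>lo hi g g'.
        (\<forall>w\<in>bar_params D. thin_strip D w (lo w) (hi w)) \<and>
        disjoint_family_on (\<lambda>w. {lo w..hi w}) (bar_params D) \<and>
        (\<forall>w\<in>bar_params D. replaces_barred_arcs D Dt w (lo w) (hi w) (g w) (g' w)) \<and>
        (let kept = params D - (\<Union>w\<in>bar_params D. barred_arc D w (lo w) (hi w));
             new = (\<Union>w\<in>bar_params D. path_image (g w) \<union> path_image (g' w))
         in lift Dt ` (params Dt - new) = lift D ` kept \<union> lift (s_diagram D) ` kept) \<and>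
        lifted_crossings Dt = lifted_crossings D \<union> lifted_crossings (s_diagram D))"

definition double_covering_diagram :: "diagram \<Rightarrow> diagram \<Rightarrow> bool" where
  "double_covering_diagram D Dt \<longleftrightarrow>
     virtual_link_diagram Dt \<and>
     (\<exists>F. ambient_isotopy F \<and>
        (let D' = image_diagram (F 1) D
         in in_right_half_plane D' \<and> general_position D' \<and> doubling D' Dt))"

end

theory Submission
  imports Defs
begin

text \<open>The lift to the unit tangent bundle identifies the part of a double covering diagram outside
  the new arcs with two copies of \<open>D\<close> without its barred arcs: \<open>D\<close> itself and its mirror image
  \<open>s(D)\<close>.  Sending $x_a$ and $y_a$ to the semi-arc of the covering that contains the copy of \<open>a\<close> in
  \<open>D\<close> and in \<open>s(D)\<close>, respectively, is onto.  It identifies two generators exactly if the bar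
  relations do, since a new arc joins the two copies of the semi-arcs at a bar crosswise.  The
  upper relations at the crossings on the copy \<open>D\<close> are the upper relations of \<open>D\<close>; on the copy
  \<open>s(D)\<close>, where over and under are exchanged and the sign is preserved, they are the lower
  relations of \<open>D\<close>.\<close>

section \<open>Isomorphisms of presented quandles\<close>

text \<open>\<open>doubling\<close> equates images of lifts and sets of lifted crossings; it
  provides no map between the parameter circles, and the components of \<open>Dt\<close> may be
  numbered and parametrized quite differently from those of \<open>D\<close>. Hence points are
  matched through the inverse of \<open>lift\<close>, which is continuous by compactness, and the
  bookkeeping of cyclically ordered arcs is replaced by one principle: a locally constant function
  on a connected set is constant. It is applied in two opposite directions. On a semi-arc of
  \<open>D\<close> it makes the corresponding semi-arc of \<open>Dt\<close> well defined, although
  the interior of a barred arc has no copy there. On a semi-arc of \<open>Dt\<close> it carries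
  classes of generators across the new arcs. Since several generators may go to one semi-arc, the
  isomorphism is phrased with a section of a surjection of generators. The isotopy needs no
  invariance theorem: semi-arcs are sets of parameters and stay the same, only the signs of
  crossings depend on positions, and the derivative at the end of an isotopy has positive
  determinant.\<close>

lemma qterms_map: "t \<in> qterms G \<Longrightarrow> f ` G \<subseteq> H \<Longrightarrow> map_qterm f t \<in> qterms H"
  by (auto simp: qterms_def qterm.set_map)

lemma qcong_map:
  assumes "qcong G R s t" "f ` G \<subseteq> H"
    and "\<And>s t. (s, t) \<in> R \<Longrightarrow> s \<in> qterms G \<Longrightarrow> t \<in> qterms G \<Longrightarrow> qcong H S (map_qterm f s) (map_qterm f t)"
  shows "qcong H S (map_qterm f s) (map_qterm f t)"
  using assms(1)
proof induction
  case (qcong_sym s t)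
  then show ?case by (blast intro: qcong.qcong_sym)
next
  case (qcong_trans s t u)
  then show ?case by (blast intro: qcong.qcong_trans)
qed (simp_all add: qcong_refl qcong_Op qcong_Dual assms(3) qcong_idem qcong_inv1 qcong_inv2
    qcong_dist qterms_map[OF _ assms(2)])

lemma qcong_map_self:
  assumes "t \<in> qterms G" "\<And>g. g \<in> G \<Longrightarrow> qcong G R (Gen (f g)) (Gen g)"
  shows "qcong G R (map_qterm f t) t"
  using assms(1) by (induction t) (simp_all add: qcong_Op qcong_Dual assms(2))

text \<open>\<phi> may identify generators, so only a section \<sigma> is available. The hypothesis
  \<open>ker\<close> makes \<sigma> after \<phi> the identity up to congruence; this takes the place
  of eliminating redundant generators one by one.\<close>

lemma presented_quandle_isomorphic:
  assumes \<phi>: "\<phi> ` G \<subseteq> H" and \<sigma>: "\<sigma> ` H \<subseteq> G" and inv: "\<And>h. h \<in> H \<Longrightarrow> \<phi> (\<sigma> h) = h"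
    and ker: "\<And>g. g \<in> G \<Longrightarrow> qcong G R (Gen (\<sigma> (\<phi> g))) (Gen g)"
    and R: "\<And>s t. (s, t) \<in> R \<Longrightarrow> s \<in> qterms G \<Longrightarrow> t \<in> qterms G \<Longrightarrow>
        qcong H S (map_qterm \<phi> s) (map_qterm \<phi> t)"
    and S: "\<And>s t. (s, t) \<in> S \<Longrightarrow> s \<in> qterms H \<Longrightarrow> t \<in> qterms H \<Longrightarrow>
        qcong G R (map_qterm \<sigma> s) (map_qterm \<sigma> t)"
  shows "quandle_isomorphic (presented_quandle G R) (presented_quandle H S)"
proof -
  let ?E = "qcong_rel_on G R" and ?F = "qcong_rel_on H S"
  \<comment> \<open>Saturating the image of the whole class avoids choosing a
    representative.\<close>
  define f where "f A = ?F `` (map_qterm \<phi> ` A)" for A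
  have carrier: "qcarrier (presented_quandle G R) = (\<lambda>t. qcong_rel_on G R `` {t}) ` qterms G" for G :: "'z set" and R
    by (auto simp: presented_quandle_def quotient_def)
  have classG: "?E `` {s} = ?E `` {t} \<longleftrightarrow> qcong G R s t" if "s \<in> qterms G" "t \<in> qterms G" for s t
    using eq_equiv_class_iff[OF equiv_qcong that, of R] by (simp add: qcong_rel_on_def)
  have classH: "?F `` {s} = ?F `` {t} \<longleftrightarrow> qcong H S s t" if "s \<in> qterms H" "t \<in> qterms H" for s t
    using eq_equiv_class_iff[OF equiv_qcong that, of S] by (simp add: qcong_rel_on_def)
  have map\<phi>: "qcong H S (map_qterm \<phi> s) (map_qterm \<phi> t)" if "qcong G R s t" for s t
    by (rule qcong_map[OF that \<phi> R])
  have map\<sigma>: "qcong G R (map_qterm \<sigma> s) (map_qterm \<sigma> t)" if "qcong H S s t" for s t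
    by (rule qcong_map[OF that \<sigma> S])
  have f: "f (?E `` {t}) = ?F `` {map_qterm \<phi> t}" if "t \<in> qterms G" for t
  proof -
    have "t \<in> ?E `` {t}" "map_qterm \<phi> ` ?E `` {t} \<subseteq> ?F `` {map_qterm \<phi> t}"
      using that by (auto simp: qcong_rel_on_def intro: qcong_refl map\<phi>)
    moreover have "?F `` (?F `` {map_qterm \<phi> t}) \<subseteq> ?F `` {map_qterm \<phi> t}"
      by (auto simp: qcong_rel_on_def intro: qcong_trans)
    ultimately show ?thesis unfolding f_def by blast
  qed
  have retract: "qcong G R (map_qterm \<sigma> (map_qterm \<phi> t)) t" if "t \<in> qterms G" for t
    using qcong_map_self[OF that, of R "\<sigma> \<circ> \<phi>"] ker by (simp add: qterm.map_comp)
  have "bij_betw f (qcarrier (presented_quandle G R)) (qcarrier (presented_quandle H S))"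
    unfolding bij_betw_def
  proof
    show "inj_on f (qcarrier (presented_quandle G R))"
    proof (rule inj_onI)
      fix A B assume "A \<in> qcarrier (presented_quandle G R)" "B \<in> qcarrier (presented_quandle G R)"
        and eq: "f A = f B"
      then obtain s t where st: "s \<in> qterms G" "t \<in> qterms G" "A = ?E `` {s}" "B = ?E `` {t}"
        unfolding carrier by blast
      with eq have "qcong H S (map_qterm \<phi> s) (map_qterm \<phi> t)"
        using classH[OF st(1,2)[THEN qterms_map[OF _ \<phi>]]] f by simp
      from map\<sigma>[OF this] retract[OF st(1)] retract[OF st(2)] have "qcong G R s t"
        by (meson qcong_sym qcong_trans)
      then show "A = B" using classG st by simp
    qed
    have "?F `` {t} \<in> f ` qcarrier (presented_quandle G R)" if t: "t \<in> qterms H" for t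
    proof -
      have "map_qterm \<phi> (map_qterm \<sigma> t) = map_qterm id t"
        unfolding qterm.map_comp by (rule qterm.map_cong0) (use t inv in \<open>auto simp: qterms_def\<close>)
      then have "f (?E `` {map_qterm \<sigma> t}) = ?F `` {t}"
        using f[OF qterms_map[OF t \<sigma>]] by (simp add: qterm.map_id)
      then show ?thesis
        unfolding carrier using qterms_map[OF t \<sigma>] by (metis imageI)
    qed
    moreover have "f ` qcarrier (presented_quandle G R) \<subseteq> qcarrier (presented_quandle H S)"
      using qterms_map[OF _ \<phi>] by (simp add: carrier f image_subset_iff)
    ultimately show "f ` qcarrier (presented_quandle G R) = qcarrier (presented_quandle H S)"
      unfolding carrier by blast
  qed
  moreover have "f (qop (presented_quandle G R) B A) = qop (presented_quandle H S) (f B) (f A) \<and>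
      f (qdual (presented_quandle G R) B A) = qdual (presented_quandle H S) (f B) (f A)"
    if "A \<in> qcarrier (presented_quandle G R)" "B \<in> qcarrier (presented_quandle G R)" for A B
    using that qterms_map[OF _ \<phi>] unfolding carrier by (elim imageE) (simp add: qop_class f)
  ultimately show ?thesis
    unfolding quandle_isomorphic_def by blast
qed

section \<open>Locally constant functions\<close>

lemma continuous_on_nhdsD:
  assumes "continuous_on S f" "x \<in> S" "\<forall>\<^sub>F y in nhds (f x). P y"
  shows "\<forall>\<^sub>F y in nhds x. y \<in> S \<longrightarrow> P (f y)"
proof -
  obtain U where U: "open U" "f x \<in> U" "\<And>y. y \<in> U \<Longrightarrow> P y"
    using assms(3) by (auto simp: eventually_nhds)
  obtain V where "open V" "x \<in> V" "\<forall>y\<in>S. y \<in> V \<longrightarrow> f y \<in> U"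
    using assms(1,2) U(1,2) unfolding continuous_on_topological by meson
  then show ?thesis using U(3) by (auto simp: eventually_nhds)
qed

lemma isCont_tendsto_nhds: "isCont f x \<Longrightarrow> (f \<longlongrightarrow> f x) (nhds x)"
  by (simp add: isCont_def tendsto_at_iff_tendsto_nhds)

lemma connected_locally_constant:
  assumes "connected S" "\<And>x. x \<in> S \<Longrightarrow> \<forall>\<^sub>F y in nhds x. y \<in> S \<longrightarrow> f y = f x" "x \<in> S" "y \<in> S"
  shows "f x = f y"
proof (rule connected_local_const[OF assms(1,3,4)])
  show "\<forall>a\<in>S. \<forall>\<^sub>F b in at a within S. f a = f b"
    unfolding eventually_at_filter
  proof
    fix a assume "a \<in> S"
    from assms(2)[OF this] show "\<forall>\<^sub>F b in nhds a. b \<noteq> a \<longrightarrow> b \<in> S \<longrightarrow> f a = f b"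
      by eventually_elim simp
  qed
qed

text \<open>Closed pieces are needed because the arcs to be pasted abut in single points. Near a
  point only the pieces that contain it matter: the finitely many others are closed and miss a
  neighbourhood.\<close>

lemma connected_pasted_constant:
  fixes f :: "'j \<Rightarrow> 'a::topological_space \<Rightarrow> 'b"
  assumes S: "connected S" and J: "finite J" and cover: "S \<subseteq> (\<Union>j\<in>J. C j)"
    and closed: "\<And>j. j \<in> J \<Longrightarrow> closed (C j)"
    and const: "\<And>j x. j \<in> J \<Longrightarrow> x \<in> S \<inter> C j \<Longrightarrow> \<forall>\<^sub>F y in nhds x. y \<in> S \<inter> C j \<longrightarrow> f j y = f j x"
    and agree: "\<And>i j x. i \<in> J \<Longrightarrow> j \<in> J \<Longrightarrow> x \<in> S \<Longrightarrow> x \<in> C i \<Longrightarrow> x \<in> C j \<Longrightarrow> f i x = f j x"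
    and "i \<in> J" "j \<in> J" "x \<in> S" "y \<in> S" "x \<in> C i" "y \<in> C j"
  shows "f i x = f j y"
proof -
  \<comment> \<open>The choice of the piece does not affect the value, by
    \<open>agree\<close>.\<close>
  define F where "F x = f (SOME j. j \<in> J \<and> x \<in> C j) x" for x
  have F: "F x = f j x" if "j \<in> J" "x \<in> S" "x \<in> C j" for j x
  proof -
    have "(SOME j. j \<in> J \<and> x \<in> C j) \<in> J \<and> x \<in> C (SOME j. j \<in> J \<and> x \<in> C j)"
      by (rule someI[of _ j]) (use that in auto)
    then show ?thesis unfolding F_def by (intro agree) (use that in auto)
  qed
  have "F x = F y"
  proof (rule connected_locally_constant[OF S])
    fix x assume x: "x \<in> S"
    have "\<forall>\<^sub>F y in nhds x. \<forall>j\<in>J. y \<in> S \<and> y \<in> C j \<longrightarrow> f j y = F x"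
    proof (rule eventually_ball_finite[OF J], intro ballI)
      fix j assume j: "j \<in> J"
      show "\<forall>\<^sub>F y in nhds x. y \<in> S \<and> y \<in> C j \<longrightarrow> f j y = F x"
      proof (cases "x \<in> C j")
        case True
        then show ?thesis using const[OF j, of x] x F[OF j x True] by simp
      next
        case False
        then have "\<forall>\<^sub>F y in nhds x. y \<in> - C j"
          using closed[OF j] by (intro eventually_nhds_in_open) auto
        then show ?thesis by eventually_elim auto
      qed
    qed
    then show "\<forall>\<^sub>F y in nhds x. y \<in> S \<longrightarrow> F y = F x"
    proof eventually_elim
      case (elim y)
      show ?case
      proof
        assume y: "y \<in> S"
        then obtain j where "j \<in> J" "y \<in> C j" using cover by blast
        then show "F y = F x" using elim y F by simp
      qed
    qed
  qed fact+
  then show ?thesis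
    using F[of i x] F[of j y] assms(7-) by simp
qed

section \<open>Moving along the components\<close>

lemma advance_0 [simp]: "advance w 0 = w"
  by (simp add: advance_def)

lemma advance_advance [simp]: "advance (advance w s) t = advance w (s + t)"
  by (simp add: advance_def cis_mult algebra_simps)

lemma advance_2pi [simp]: "advance w (2 * pi) = w"
  by (simp add: advance_def)

lemma advance_in_params [simp]: "advance w t \<in> params D \<longleftrightarrow> w \<in> params D"
  by (simp add: advance_def params_def mem_Times_iff norm_mult)

lemma continuous_on_advance: "continuous_on S (advance w)"
  unfolding advance_def by (intro continuous_intros)

lemma compact_params: "compact (params D)"
  unfolding params_def by (intro compact_Times finite_imp_compact finite_lessThan compact_sphere)

lemma connected_advance_image: "connected I \<Longrightarrow> connected (advance w ` I)"
  by (rule connected_continuous_image[OF continuous_on_advance])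

lemma eventually_advance:
  assumes "\<forall>\<^sub>F v in nhds (advance w s). P v"
  shows "\<forall>\<^sub>F t in nhds s. P (advance w t)"
  using continuous_on_nhdsD[OF continuous_on_advance[of UNIV] _ assms] by simp

text \<open>The argument of \<open>snd v / snd w\<close> is a local inverse of \<open>advance w\<close> at \<open>0\<close>.\<close>

definition displacement :: "param \<Rightarrow> param \<Rightarrow> real" where
  "displacement w v = Arg (snd v / snd w)"

lemma advance_displacement:
  assumes "w \<in> params D" "v \<in> params D" "fst v = fst w"
  shows "advance w (displacement w v) = v"
proof -
  have "norm (snd v / snd w) = 1" "snd w \<noteq> 0" "snd v / snd w \<noteq> 0"
    using assms by (auto simp: params_def norm_divide)
  then have "cis (Arg (snd v / snd w)) = snd v / snd w"
    by (simp add: cis_Arg sgn_div_norm)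
  then show ?thesis
    using assms \<open>snd w \<noteq> 0\<close> by (simp add: advance_def displacement_def prod_eq_iff)
qed

lemma displacement_tendsto:
  assumes "w \<in> params D"
  shows "(displacement w \<longlongrightarrow> 0) (nhds w)"
proof -
  have w: "snd w \<noteq> 0" using assms by (auto simp: params_def)
  have "isCont (\<lambda>v::param. snd v / snd w) w"
    using w by (intro continuous_intros) auto
  moreover have "isCont Arg (snd w / snd w)"
    using w by (intro continuous_at_Arg) auto
  ultimately have "isCont (displacement w) w"
    unfolding displacement_def by (rule isCont_o2)
  from isCont_tendsto_nhds[OF this] show ?thesis
    using w by (simp add: displacement_def)
qed

lemma eventually_advance_displacement:
  assumes "w \<in> params D"
  shows "\<forall>\<^sub>F v in nhds w. v \<in> params D \<longrightarrow> advance w (displacement w v) = v"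
proof -
  \<comment> \<open>\<open>nat\<close> is discrete, so parameters close to \<open>w\<close> lie on
    the same component.\<close>
  have "open (({fst w} :: nat set) \<times> (UNIV :: complex set))"
    by (intro open_Times) (auto intro: open_discrete)
  then have "\<forall>\<^sub>F v in nhds w. v \<in> {fst w} \<times> UNIV"
    by (intro eventually_nhds_in_open) (auto simp: mem_Times_iff)
  then show ?thesis
    by eventually_elim (auto intro: advance_displacement[OF assms])
qed

text \<open>\<open>advance w\<close> is a local homeomorphism from the real line to the circle
  through \<open>w\<close>, with local inverse \<open>displacement w\<close>. Local statements on
  the circles can therefore be proved for a real parameter near 0.\<close>

lemma eventually_params:
  assumes "w \<in> params D" "\<forall>\<^sub>F t in nhds 0. P (advance w t)"
  shows "\<forall>\<^sub>F v in nhds w. v \<in> params D \<longrightarrow> P v"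
proof -
  have "\<forall>\<^sub>F v in nhds w. P (advance w (displacement w v))"
    using filterlim_iff[THEN iffD1, OF displacement_tendsto[OF assms(1)]] assms(2) by blast
  with eventually_advance_displacement[OF assms(1)] show ?thesis
    by eventually_elim metis
qed

lemma eventually_advance_params:
  assumes "w \<in> params D" "\<forall>\<^sub>F t in nhds s. P (advance w t)"
  shows "\<forall>\<^sub>F v in nhds (advance w s). v \<in> params D \<longrightarrow> P v"
proof (rule eventually_params)
  have "((\<lambda>t. s + t) \<longlongrightarrow> s + 0) (nhds 0)"
    by (intro tendsto_intros) (rule filterlim_ident)
  then show "\<forall>\<^sub>F t in nhds 0. P (advance (advance w s) t)"
    using assms(2) by (auto simp: filterlim_iff)
qed (use assms in simp)

lemma continuous_on_params:
  assumes "\<And>w. w \<in> params D \<Longrightarrow> isCont (\<lambda>t. f (advance w t)) 0"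
  shows "continuous_on (params D) f"
  unfolding continuous_on_topological
proof (intro ballI allI impI)
  fix w B assume w: "w \<in> params D" and B: "open B" "f w \<in> B"
  have "((\<lambda>t. f (advance w t)) \<longlongrightarrow> f w) (nhds 0)"
    using isCont_tendsto_nhds[OF assms[OF w]] by simp
  then have "\<forall>\<^sub>F t in nhds 0. f (advance w t) \<in> B"
    using B by (auto simp: tendsto_def)
  from eventually_params[OF w this] show "\<exists>A. open A \<and> w \<in> A \<and> (\<forall>y\<in>params D. y \<in> A \<longrightarrow> f y \<in> B)"
    by (auto simp: eventually_nhds)
qed

section \<open>Generic immersions\<close>

text \<open>\<open>generic_immersion\<close> differentiates with respect to the angle, whereas
  \<open>velocity\<close> is the derivative at time 0 of the motion from a point. The two differ by
  a shift by the angle \<theta> of \<open>w\<close>.\<close>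

lemma has_vector_derivative_curve:
  assumes D: "generic_immersion D" and w: "w \<in> params D"
  shows "((\<lambda>t. curve D (advance w t)) has_vector_derivative velocity D (advance w s)) (at s)"
    and "continuous_on UNIV (\<lambda>s. velocity D (advance w s))"
proof -
  define \<theta> where "\<theta> = Arg (snd w)"
  define i where "i = fst w"
  have "norm (snd w) = 1" "i < ncomp D"
    using w by (auto simp: params_def i_def)
  moreover from this(1) have "cis \<theta> = snd w"
    unfolding \<theta>_def by (subst cis_Arg) (auto simp: sgn_div_norm)
  ultimately have adv: "advance w s = (i, cis (\<theta> + s))" for s
    by (simp add: advance_def i_def cis_mult[symmetric])
  from D \<open>i < ncomp D\<close> have "(\<lambda>t. curve D (i, cis t)) C1_differentiable_on UNIV"
    by (simp add: generic_immersion_def)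
  then obtain c where c: "\<And>t. ((\<lambda>t. curve D (i, cis t)) has_vector_derivative c t) (at t)"
    "continuous_on UNIV c"
    by (auto simp: C1_differentiable_on_def)
  have deriv: "((\<lambda>t. curve D (advance w t)) has_vector_derivative c (\<theta> + s)) (at s)" for s
  proof -
    have "((\<lambda>t. \<theta> + t) has_vector_derivative 1) (at s)"
      by (auto intro!: derivative_eq_intros)
    from vector_diff_chain_at[OF this c(1)] show ?thesis
      by (simp add: adv o_def)
  qed
  have "((\<lambda>t. curve D (advance (advance w s) t)) has_vector_derivative c (\<theta> + s)) (at 0)" for s
  proof -
    have "((\<lambda>t. s + t) has_vector_derivative 1) (at 0)"
      by (auto intro!: derivative_eq_intros)
    from vector_diff_chain_at[OF this, of "\<lambda>t. curve D (advance w t)" "c (\<theta> + s)"] deriv[of s]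
    show ?thesis by (simp add: o_def)
  qed
  then have vel: "velocity D (advance w s) = c (\<theta> + s)" for s
    unfolding velocity_def by (rule vector_derivative_at)
  show "((\<lambda>t. curve D (advance w t)) has_vector_derivative velocity D (advance w s)) (at s)"
    unfolding vel by (rule deriv)
  show "continuous_on UNIV (\<lambda>s. velocity D (advance w s))"
    unfolding vel by (intro continuous_on_compose2[OF c(2)] continuous_intros) auto
qed

lemma velocity_nonzero: "generic_immersion D \<Longrightarrow> w \<in> params D \<Longrightarrow> velocity D w \<noteq> 0"
  by (simp add: generic_immersion_def)

lemma det2_velocity_nonzero:
  assumes "generic_immersion D" "(u, v) \<in> double_pairs D"
  shows "det2 (velocity D u) (velocity D v) \<noteq> 0"
proof -
  from assms(1) have "\<forall>(u, v)\<in>double_pairs D. det2 (velocity D u) (velocity D v) \<noteq> 0"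
    unfolding generic_immersion_def by (elim conjE)
  with assms(2) show ?thesis by auto
qed

lemma continuous_on_lift:
  assumes "generic_immersion D"
  shows "continuous_on (params D) (lift D)"
proof (rule continuous_on_params)
  fix w assume w: "w \<in> params D"
  have "isCont (\<lambda>t. curve D (advance w t)) 0"
    by (rule has_vector_derivative_continuous[OF has_vector_derivative_curve(1)[OF assms w]])
  moreover have "isCont (\<lambda>t. velocity D (advance w t)) 0"
    using has_vector_derivative_curve(2)[OF assms w] by (simp add: continuous_on_eq_continuous_at)
  ultimately show "isCont (\<lambda>t. lift D (advance w t)) 0"
    unfolding lift_def using velocity_nonzero[OF assms w] by (intro continuous_intros) auto
qed

lemma det2_scaleR: "det2 (a *\<^sub>R u) (b *\<^sub>R v) = a * b * det2 u v"
  by (simp add: det2_def algebra_simps)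

lemma inj_on_lift:
  assumes "generic_immersion D"
  shows "inj_on (lift D) (params D)"
proof (rule inj_onI, rule ccontr)
  fix u v assume uv: "u \<in> params D" "v \<in> params D" "lift D u = lift D v" "u \<noteq> v"
  then have "(u, v) \<in> double_pairs D" "sgn (velocity D u) = sgn (velocity D v)"
    by (auto simp: double_pairs_def lift_def)
  moreover from this(2) have "velocity D v = norm (velocity D v) *\<^sub>R sgn (velocity D u)"
    using velocity_nonzero[OF assms uv(2)] by (simp add: sgn_div_norm)
  moreover have "velocity D u = norm (velocity D u) *\<^sub>R sgn (velocity D u)"
    using velocity_nonzero[OF assms uv(1)] by (simp add: sgn_div_norm)
  ultimately have "det2 (velocity D u) (velocity D v) = 0"
    by (metis det2_scaleR det2_def diff_self mult.commute mult_zero_right)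
  with det2_velocity_nonzero[OF assms] \<open>(u, v) \<in> double_pairs D\<close> show False
    by blast
qed

lemma det2_sgn: "sgn (det2 (sgn u) (sgn v)) = sgn (det2 u v)"
proof (cases "u = 0 \<or> v = 0")
  case False
  then have "sgn (inverse (norm u)) = 1" "sgn (inverse (norm v)) = 1" by auto
  then show ?thesis
    unfolding sgn_div_norm[of u] sgn_div_norm[of v] det2_scaleR sgn_mult by simp
qed (auto simp: det2_def)

text \<open>Rescaling velocities to unit length keeps the sign of the determinant, so the sign of a
  crossing can be read off the lifts and is shared by diagrams whose lifts agree there.\<close>

lemma positive_lift: "positive D u v \<longleftrightarrow> det2 (snd (lift D u)) (snd (lift D v)) > 0"
  unfolding positive_def lift_def snd_conv by (metis det2_sgn sgn_greater)

lemma negative_lift: "negative D u v \<longleftrightarrow> det2 (snd (lift D u)) (snd (lift D v)) < 0"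
  unfolding negative_def lift_def snd_conv by (metis det2_sgn sgn_less)

lemma lifted_crossings_iff:
  "p \<in> lifted_crossings D \<longleftrightarrow> (\<exists>u v. (u, v) \<in> crossings D \<and> p = (lift D u, lift D v))"
  by (force simp: lifted_crossings_def)

section \<open>Diffeomorphisms of the plane\<close>

lemma blinfun_linear: "linear (blinfun_apply f)"
  by (rule bounded_linear.linear[OF blinfun.bounded_linear_right])

lemma params_image [simp]: "params (image_diagram f D) = params D"
  by (simp add: params_def image_diagram_def)

lemma double_pairs_image:
  assumes "inj f"
  shows "double_pairs (image_diagram f D) = double_pairs D"
  using assms by (simp add: double_pairs_def image_diagram_def params_def inj_eq)

lemma velocity_image:
  assumes D: "generic_immersion D" "w \<in> params D"
    and f: "\<And>p. (f has_derivative f' p) (at p)"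
  shows "velocity (image_diagram f D) w = f' (curve D w) (velocity D w)"
proof -
  have "((f \<circ> (\<lambda>t. curve D (advance w t))) has_vector_derivative f' (curve D w) (velocity D w)) (at 0)"
    using vector_derivative_diff_chain_within[of "\<lambda>t. curve D (advance w t)" "velocity D w" 0 UNIV f "f' (curve D w)"]
      has_vector_derivative_curve(1)[OF D, of 0] has_derivative_at_withinI[OF f] by simp
  from vector_derivative_at[OF this] show ?thesis
    by (simp add: velocity_def image_diagram_def o_def)
qed

text \<open>The factor \<open>det2 (L (1, 0)) (L (0, 1))\<close> is the determinant of
  \<open>L\<close>.\<close>

lemma det2_linear:
  assumes "linear L"
  shows "det2 (L u) (L v) = det2 (L (1, 0)) (L (0, 1)) * det2 u v"
proof -
  have "L w = fst w *\<^sub>R L (1, 0) + snd w *\<^sub>R L (0, 1)" for w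
  proof -
    have "L w = L (fst w *\<^sub>R (1, 0) + snd w *\<^sub>R (0, 1))" by simp
    then show ?thesis by (simp only: linear_add[OF assms] linear_scale[OF assms])
  qed
  from this[of u] this[of v] show ?thesis
    by (simp add: det2_def algebra_simps)
qed

lemma det2_bij_nonzero:
  fixes L :: "plane \<Rightarrow> plane"
  assumes "linear L" "bij L"
  shows "det2 (L (1, 0)) (L (0, 1)) \<noteq> 0"
proof
  assume 0: "det2 (L (1, 0)) (L (0, 1)) = 0"
  have "det2 p q = 0" for p q
    using det2_linear[OF assms(1), of "inv L p" "inv L q"] 0 assms(2)
    by (simp add: bij_is_surj surj_f_inv_f)
  from this[of "(1, 0)" "(0, 1)"] show False by (simp add: det2_def)
qed

lemma generic_immersion_image:
  fixes f' :: "plane \<Rightarrow> plane \<Rightarrow>\<^sub>L plane"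
  assumes D: "generic_immersion D" and f: "inj f" "\<And>p. (f has_derivative f' p) (at p)"
    and f': "continuous_on UNIV f'" "\<And>p. bij (f' p)"
  shows "generic_immersion (image_diagram f D)"
  unfolding generic_immersion_def params_image double_pairs_image[OF f(1)]
proof (intro conjI ballI allI impI)
  fix i assume i: "i < ncomp (image_diagram f D)"
  then have "(\<lambda>t. curve D (i, cis t)) C1_differentiable_on UNIV"
    using D by (simp add: generic_immersion_def image_diagram_def)
  then obtain c where c: "\<And>t. ((\<lambda>t. curve D (i, cis t)) has_vector_derivative c t) (at t)"
    "continuous_on UNIV c"
    by (auto simp: C1_differentiable_on_def)
  have "((\<lambda>t. f (curve D (i, cis t))) has_vector_derivative f' (curve D (i, cis t)) (c t)) (at t)" for t
    using vector_derivative_diff_chain_within[of "\<lambda>t. curve D (i, cis t)" "c t" t UNIV f "f' (curve D (i, cis t))"]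
      c(1)[of t] has_derivative_at_withinI[OF f(2)] by (simp add: o_def)
  moreover have "continuous_on UNIV (\<lambda>t. curve D (i, cis t))"
    using c(1) by (meson continuous_at_imp_continuous_on has_vector_derivative_continuous)
  then have "continuous_on UNIV (\<lambda>t. f' (curve D (i, cis t)) (c t))"
    by (intro continuous_intros continuous_on_compose2[OF f'(1)] c(2)) auto
  ultimately show "(\<lambda>t. curve (image_diagram f D) (i, cis t)) C1_differentiable_on UNIV"
    unfolding C1_differentiable_on_def
    by (intro exI[of _ "\<lambda>t. f' (curve D (i, cis t)) (c t)"]) (simp add: image_diagram_def)
next
  fix w assume w: "w \<in> params D"
  show "velocity (image_diagram f D) w \<noteq> 0"
    unfolding velocity_image[OF D w f(2)]
    using velocity_nonzero[OF D w] f'(2)[of "curve D w"]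
    by (metis bij_is_inj blinfun.zero_right inj_eq)
next
  show "finite (double_pairs D)" using D by (simp add: generic_immersion_def)
next
  fix p assume "p \<in> double_pairs D"
  then obtain u v where uv: "p = (u, v)" "(u, v) \<in> double_pairs D" by (cases p) auto
  then have "u \<in> params D" "v \<in> params D" "curve D u = curve D v"
    by (auto simp: double_pairs_def)
  then have "det2 (velocity (image_diagram f D) u) (velocity (image_diagram f D) v) \<noteq> 0"
    using det2_velocity_nonzero[OF D uv(2)] det2_bij_nonzero[OF blinfun_linear f'(2)]
      det2_linear[OF blinfun_linear, of "f' (curve D v)" "velocity D u" "velocity D v"]
    by (simp only: velocity_image[OF D _ f(2)] mult_eq_0_iff simp_thms)
  then show "case p of (u, v) \<Rightarrow>
      det2 (velocity (image_diagram f D) u) (velocity (image_diagram f D) v) \<noteq> 0"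
    using uv by simp
next
  fix u v w assume "(u, v) \<in> double_pairs D" "(v, w) \<in> double_pairs D"
  then show "w = u" using D unfolding generic_immersion_def by blast
qed

section \<open>Semi-arcs and the twisted link quandle under diffeomorphisms\<close>

lemma bar_params_image:
  assumes "inj f"
  shows "bar_params (image_diagram f D) = bar_params D"
  using assms by (simp add: bar_params_def image_diagram_def params_def inj_image_mem_iff)

text \<open>A semi-arc consists of parameters, not of points of the plane, so it is literally the
  same set after moving the diagram.\<close>

lemma semi_arcs_image: "inj f \<Longrightarrow> semi_arcs (image_diagram f D) = semi_arcs D"
  by (simp add: semi_arcs_def bar_params_image) (simp add: image_diagram_def)

lemma arrives_image: "inj f \<Longrightarrow> arrives (image_diagram f D) = arrives D"
  by (intro ext) (simp add: arrives_def semi_arcs_image)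

lemma leaves_image: "inj f \<Longrightarrow> leaves (image_diagram f D) = leaves D"
  by (intro ext) (simp add: leaves_def semi_arcs_image)

lemma crossing_at_image: "inj f \<Longrightarrow> crossing_at (image_diagram f D) = crossing_at D"
  by (intro ext) (simp add: crossing_at_def arrives_image leaves_image, simp add: image_diagram_def)

text \<open>The determinant of the derivative is continuous along the isotopy, never zero, and \<open>1\<close> at the start.\<close>

lemma ambient_isotopy_diffeomorphism:
  assumes "ambient_isotopy F"
  obtains f' :: "plane \<Rightarrow> plane \<Rightarrow>\<^sub>L plane"
  where "\<And>p. (F 1 has_derivative f' p) (at p)" "continuous_on UNIV f'" "\<And>p. bij (f' p)" "bij (F 1)"
    "\<And>p. det2 (f' p (1, 0)) (f' p (0, 1)) > 0"
proof -
  obtain F' :: "real \<times> plane \<Rightarrow> plane \<Rightarrow>\<^sub>L plane" where F': "continuous_on ({0..1} \<times> UNIV) F'"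
    "\<And>t p. t \<in> {0..1} \<Longrightarrow> (F t has_derivative blinfun_apply (F' (t, p))) (at p)"
    "\<And>t p. t \<in> {0..1} \<Longrightarrow> bij (blinfun_apply (F' (t, p)))"
    using assms unfolding ambient_isotopy_def by blast
  show ?thesis
  proof
    show "(F 1 has_derivative F' (1, p)) (at p)" "bij (F' (1, p))" for p using F' by auto
    show "continuous_on UNIV (\<lambda>p. F' (1, p))"
      by (intro continuous_on_compose2[OF F'(1)] continuous_intros) auto
    show "bij (F 1)" using assms by (simp add: ambient_isotopy_def)
    fix p
    define d where "d t = det2 (F' (t, p) (1, 0)) (F' (t, p) (0, 1))" for t
    have "continuous_on {0..1} (\<lambda>t. F' (t, p))"
      by (intro continuous_on_compose2[OF F'(1)] continuous_intros) auto
    then have d: "continuous_on {0..1} d"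
      unfolding d_def det2_def by (intro continuous_intros)
    have d0: "d t \<noteq> 0" if "t \<in> {0..1}" for t
      unfolding d_def using F'(3)[OF that] by (intro det2_bij_nonzero) (auto simp: blinfun_linear)
    have "(F 0 has_derivative id) (at p)"
      using assms by (simp add: ambient_isotopy_def has_derivative_id)
    from has_derivative_unique[OF F'(2) this] have "d 0 = 1"
      by (simp add: d_def det2_def)
    show "det2 (F' (1, p) (1, 0)) (F' (1, p) (0, 1)) > 0"
    proof (rule ccontr)
      assume "\<not> ?thesis"
      then obtain t where "t \<in> {0..1}" "d t = 0"
        using IVT2'[of d 1 0 0] d \<open>d 0 = 1\<close> by (auto simp: d_def)
      with d0 show False by blast
    qed
  qed
qed

text \<open>An equality, not just an isomorphism: generators and incidences live on the parameters,
  and the signs survive because the determinant of the derivative is positive.\<close>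

lemma twisted_link_quandle_image:
  assumes D: "generic_immersion D" "crossings D \<subseteq> double_pairs D"
    and f: "inj f" "\<And>p. (f has_derivative f' p) (at p)"
    "\<And>p. det2 (f' p (1, 0)) (f' p (0, 1)) > 0"
  shows "twisted_link_quandle (image_diagram f D) = twisted_link_quandle D"
proof -
  let ?E = "image_diagram f D"
  have det: "sgn (det2 (velocity ?E u) (velocity ?E v)) = sgn (det2 (velocity D u) (velocity D v))"
    if "(u, v) \<in> crossings D" for u v
  proof -
    have "u \<in> params D" "v \<in> params D" "curve D u = curve D v"
      using D(2) that by (auto simp: double_pairs_def)
    then show ?thesis
      using f(3)[of "curve D v"]
        det2_linear[OF has_derivative_linear[OF f(2)], of "curve D v" "velocity D u" "velocity D v"]
      by (simp only: velocity_image[OF D(1) _ f(2)] sgn_mult sgn_pos mult_1)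
  qed
  \<comment> \<open>The sign is known to be preserved only where both strands pass through one
    point, so that one derivative acts on both velocities. Hence \<open>crossing_at\<close> is kept
    in the rewriting.\<close>
  have pos: "crossing_at D u v a a' b b' \<and> positive ?E u v \<longleftrightarrow> crossing_at D u v a a' b b' \<and> positive D u v"
    for u v a a' b b'
    using det[of u v] unfolding crossing_at_def positive_def by (metis sgn_greater)
  have neg: "crossing_at D u v a a' b b' \<and> negative ?E u v \<longleftrightarrow> crossing_at D u v a a' b b' \<and> negative D u v"
    for u v a a' b b'
    using det[of u v] unfolding crossing_at_def negative_def by (metis sgn_less)
  show ?thesis
    unfolding twisted_link_quandle_def upper_relations_def lower_relations_def bar_relations_def
      semi_arcs_image[OF f(1)] arrives_image[OF f(1)] leaves_image[OF f(1)]
      crossing_at_image[OF f(1)] bar_params_image[OF f(1)] pos neg ..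
qed

section \<open>Semi-arcs\<close>

definition cuts :: "diagram \<Rightarrow> param set" where
  "cuts D = Field (crossings D) \<union> bar_params D"

definition semi_arc_at :: "diagram \<Rightarrow> param \<Rightarrow> semi_arc" where
  "semi_arc_at D v = connected_component_set (params D - cuts D) v"

lemma semi_arcs_cuts: "semi_arcs D = components (params D - cuts D)"
  by (simp add: semi_arcs_def cuts_def)

lemma semi_arc_subset: "a \<in> semi_arcs D \<Longrightarrow> a \<subseteq> params D - cuts D"
  by (simp add: semi_arcs_cuts in_components_subset)

lemma semi_arc_connected: "a \<in> semi_arcs D \<Longrightarrow> connected a"
  by (simp add: semi_arcs_cuts in_components_connected)

lemma semi_arc_nonempty: "a \<in> semi_arcs D \<Longrightarrow> a \<noteq> {}"
  by (simp add: semi_arcs_cuts in_components_nonempty)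

lemma semi_arc_unique:
  assumes "a \<in> semi_arcs D" "a' \<in> semi_arcs D" "v \<in> a" "v \<in> a'"
  shows "a = a'"
  using assms components_eq[of a "params D - cuts D" a'] by (auto simp: semi_arcs_cuts)

lemma semi_arc_at_in:
  assumes "v \<in> params D - cuts D"
  shows "semi_arc_at D v \<in> semi_arcs D" "v \<in> semi_arc_at D v"
  using assms unfolding semi_arcs_cuts semi_arc_at_def components_iff
  by (blast, simp)

lemma semi_arc_at_eq: "a \<in> semi_arcs D \<Longrightarrow> v \<in> a \<Longrightarrow> semi_arc_at D v = a"
  by (meson semi_arc_at_in semi_arc_subset semi_arc_unique subsetD)

lemma connected_in_semi_arc:
  assumes "connected T" "T \<subseteq> params D - cuts D" "v \<in> T" "v \<in> a" "a \<in> semi_arcs D"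
  shows "T \<subseteq> a"
proof -
  have "semi_arc_at D v = a"
    using assms(4,5) by (rule semi_arc_at_eq[rotated])
  then show ?thesis
    using connected_component_maximal[OF assms(3,1,2)] by (simp add: semi_arc_at_def)
qed

lemma eventually_advance_not_in_finite:
  assumes w: "w \<in> params D" and C: "finite C"
  shows "\<forall>\<^sub>F t in at 0. advance w t \<notin> C"
proof -
  have "\<forall>\<^sub>F t in at 0. advance w t \<noteq> c" for c
  proof (cases "c = w")
    case True
    \<comment> \<open>\<open>Arg\<close> inverts \<open>cis\<close> on this interval, so the motion
      does not come back to \<open>w\<close> within it.\<close>
    have "\<forall>\<^sub>F t in at (0::real). t \<in> {-pi<..pi} \<and> t \<noteq> 0"
      unfolding eventually_at by (intro exI[of _ pi]) (auto simp: dist_real_def)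
    then show ?thesis
    proof eventually_elim
      case (elim t)
      then have "cis t \<noteq> 1" using Arg_cis[of t] Arg_cis[of 0] by auto
      moreover have "snd w \<noteq> 0" using w by (auto simp: params_def)
      ultimately show ?case using True by (auto simp: advance_def prod_eq_iff)
    qed
  next
    case False
    have "\<forall>\<^sub>F t in nhds 0. advance w t \<in> - {c}"
      by (intro eventually_advance eventually_nhds_in_open) (use False in auto)
    then show ?thesis by (auto simp: eventually_at_filter elim: eventually_mono)
  qed
  with C have "\<forall>\<^sub>F t in at 0. \<forall>c\<in>C. advance w t \<noteq> c"
    by (intro eventually_ball_finite) auto
  then show ?thesis by eventually_elim auto
qed

text \<open>Semi-arcs are relatively open: with finitely many cuts, a short interval around
  \<open>v\<close> avoids them all. So \<open>semi_arc_at D\<close> is locally constant off the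
  cuts.\<close>

lemma eventually_semi_arc_at:
  assumes C: "finite (cuts D)" and v: "v \<in> params D - cuts D"
  shows "\<forall>\<^sub>F y in nhds v. y \<in> params D \<longrightarrow> y \<in> semi_arc_at D v"
proof (rule eventually_params)
  show "v \<in> params D" using v by simp
  have "\<forall>\<^sub>F t in nhds 0. advance v t \<in> - cuts D"
    by (intro eventually_advance eventually_nhds_in_open) (use v C finite_imp_closed in auto)
  then obtain e where e: "e > 0" "\<And>t. dist t 0 < e \<Longrightarrow> advance v t \<notin> cuts D"
    by (auto simp: eventually_nhds_metric)
  have "advance v ` ball 0 e \<subseteq> semi_arc_at D v"
  proof (rule connected_in_semi_arc)
    show "v \<in> advance v ` ball 0 e" using e by (intro image_eqI[of _ _ 0]) auto
    show "advance v ` ball 0 e \<subseteq> params D - cuts D"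
      using e v by (auto simp: dist_commute)
  qed (use semi_arc_at_in[OF v] in \<open>auto intro: connected_advance_image\<close>)
  moreover have "\<forall>\<^sub>F t in nhds 0. t \<in> ball 0 e"
    using e by (intro eventually_nhds_in_open) auto
  ultimately show "\<forall>\<^sub>F t in nhds 0. advance v t \<in> semi_arc_at D v"
    using eventually_mono by (metis (no_types, lifting) image_subset_iff)
qed

text \<open>The common form of \<open>arrives\<close> and \<open>leaves\<close>: the filter selects
  the side, and one argument serves both.\<close>

definition tends_along :: "diagram \<Rightarrow> real filter \<Rightarrow> param \<Rightarrow> semi_arc \<Rightarrow> bool" where
  "tends_along D F w a \<longleftrightarrow> a \<in> semi_arcs D \<and> (\<forall>\<^sub>F t in F. advance w t \<in> a)"

lemma arrives_tends_along: "arrives D = tends_along D (at_left 0)"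
  by (intro ext) (simp add: arrives_def tends_along_def)

lemma leaves_tends_along: "leaves D = tends_along D (at_right 0)"
  by (intro ext) (simp add: leaves_def tends_along_def)

lemma tends_along_unique:
  assumes "F \<noteq> bot" "tends_along D F w a" "tends_along D F w a'"
  shows "a = a'"
proof -
  have "\<forall>\<^sub>F t in F. advance w t \<in> a \<and> advance w t \<in> a'"
    using assms by (auto simp: tends_along_def intro: eventually_conj)
  then obtain t where "advance w t \<in> a" "advance w t \<in> a'"
    using eventually_happens'[OF assms(1)] by blast
  then show ?thesis using assms semi_arc_unique unfolding tends_along_def by blast
qed

text \<open>A short one-sided interval at \<open>w\<close> without its end point is connected and
  meets no cut, so it lies in a single component.\<close>

lemma tends_along_exists:
  assumes w: "w \<in> params D" and C: "finite (cuts D)" and F: "F \<in> {at_left 0, at_right 0}"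
  shows "\<exists>a. tends_along D F w a"
proof -
  have "\<forall>\<^sub>F t in at 0. advance w t \<in> params D - cuts D"
    using eventually_advance_not_in_finite[OF w C] w by simp
  then have "\<forall>\<^sub>F t in F. advance w t \<in> params D - cuts D"
    using F by (auto simp: eventually_at_split)
  then obtain I where I: "connected I" "I \<noteq> {}" "\<forall>\<^sub>F t in F. t \<in> I" "advance w ` I \<subseteq> params D - cuts D"
  proof (cases "F = at_left 0")
    case True
    assume ev: "\<forall>\<^sub>F t in F. advance w t \<in> params D - cuts D"
    then obtain b where "b < 0" "\<And>y. b < y \<Longrightarrow> y < 0 \<Longrightarrow> advance w y \<in> params D - cuts D"
      using True by (auto simp: eventually_at_left_field)
    then show ?thesis
      using True dense[of b 0] by (intro that[of "{b<..<0}"]) (auto simp: eventually_at_left_field)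
  next
    case False
    assume ev: "\<forall>\<^sub>F t in F. advance w t \<in> params D - cuts D"
    from False F have F: "F = at_right 0" by auto
    with ev obtain b where "b > 0" "\<And>y. b > y \<Longrightarrow> y > 0 \<Longrightarrow> advance w y \<in> params D - cuts D"
      by (auto simp: eventually_at_right_field)
    then show ?thesis
      using F dense[of 0 b] by (intro that[of "{0<..<b}"]) (auto simp: eventually_at_right_field)
  qed
  moreover from I obtain a where "a \<in> semi_arcs D" "advance w ` I \<subseteq> a"
    using exists_component_superset[of "advance w ` I" "params D - cuts D"]
    by (auto simp: semi_arcs_cuts connected_advance_image)
  moreover from I(3) this(2) have "\<forall>\<^sub>F t in F. advance w t \<in> a"
    by (auto elim!: eventually_mono)
  ultimately show ?thesis
    unfolding tends_along_def by blast
qed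

section \<open>Transferring germs between diagrams\<close>

text \<open>If the lifts of two diagrams agree near a point, then the transition between the two
  parametrizations preserves the direction of travel, because both curves move in the direction
  of their common unit tangent vector \<open>n\<close>.\<close>

lemma directional_derivative:
  assumes D: "generic_immersion D" "w \<in> params D"
  shows "\<exists>d>0. \<forall>h. 0 < h \<longrightarrow> h < d \<longrightarrow>
    curve D w \<bullet> sgn (velocity D w) < curve D (advance w h) \<bullet> sgn (velocity D w) \<and>
    curve D (advance w (- h)) \<bullet> sgn (velocity D w) < curve D w \<bullet> sgn (velocity D w)"
proof -
  let ?f = "\<lambda>t. curve D (advance w t) \<bullet> sgn (velocity D w)"
  have "(?f has_vector_derivative velocity D w \<bullet> sgn (velocity D w)) (at 0)"
    using bounded_linear.has_vector_derivative[OF bounded_linear_inner_left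
        has_vector_derivative_curve(1)[OF D, of 0]] by simp
  then have deriv: "DERIV ?f 0 :> velocity D w \<bullet> sgn (velocity D w)"
    by (simp add: has_real_derivative_iff_has_vector_derivative)
  moreover have pos: "velocity D w \<bullet> sgn (velocity D w) > 0"
    using velocity_nonzero[OF D] by (simp add: sgn_div_norm)
  ultimately obtain d1 d2 where "d1 > 0" "d2 > 0" "\<And>h. 0 < h \<Longrightarrow> h < d1 \<Longrightarrow> ?f 0 < ?f (0 + h)"
    "\<And>h. 0 < h \<Longrightarrow> h < d2 \<Longrightarrow> ?f (0 - h) < ?f 0"
    using DERIV_pos_inc_right[OF deriv pos] DERIV_pos_inc_left[OF deriv pos] by blast
  then show ?thesis by (intro exI[of _ "min d1 d2"]) auto
qed

text \<open>A continuous injection of a compact space into a Hausdorff space is an embedding. This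
  makes transitions between diagrams continuous without any inverse function theorem.\<close>

lemma continuous_on_inv_lift:
  assumes "generic_immersion D"
  shows "continuous_on (lift D ` params D) (inv_into (params D) (lift D))"
  using continuous_on_lift[OF assms] compact_params inj_on_lift[OF assms]
  by (intro continuous_on_inv) auto

lemma inv_lift:
  assumes "p \<in> lift D ` params D"
  shows "inv_into (params D) (lift D) p \<in> params D" "lift D (inv_into (params D) (lift D) p) = p"
  by (rule inv_into_into[OF assms], rule f_inv_into_f[OF assms])

text \<open>The transition is only known to be continuous, so its direction cannot be read off a
  derivative. Instead the coordinate along \<open>n\<close> is compared: near the base points it is
  larger after them and smaller before them on both curves, and corresponding points have the same
  coordinate.\<close>

lemma eventually_transfer:
  assumes E: "generic_immersion E" "v \<in> params E" and D: "generic_immersion D" "u \<in> params D"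
    and uv: "lift D u = lift E v"
    and near: "\<forall>\<^sub>F x in nhds v. x \<in> params E \<longrightarrow> lift E x \<in> lift D ` params D"
    and F: "F \<in> {at_left 0, at_right 0}" and P: "\<forall>\<^sub>F s in F. P (advance u s)"
  shows "\<forall>\<^sub>F t in F. P (inv_into (params D) (lift D) (lift E (advance v t)))"
proof -
  define N where "N = {x \<in> params E. lift E x \<in> lift D ` params D}"
  define \<kappa> where "\<kappa> x = inv_into (params D) (lift D) (lift E x)" for x
  define n where "n = sgn (velocity D u)"
  \<comment> \<open>The transition written in the real parameters, with 0 corresponding to
    \<open>v\<close> and to \<open>u\<close>.\<close>
  define \<tau> where "\<tau> t = displacement u (\<kappa> (advance v t))" for t
  have n: "sgn (velocity E v) = n" "curve E v = curve D u"
    using uv by (auto simp: n_def lift_def)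
  have \<kappa>v: "\<kappa> v = u"
    unfolding \<kappa>_def uv[symmetric] by (rule inv_into_f_f[OF inj_on_lift[OF D(1)] D(2)])
  have v: "v \<in> N" using E D imageI[of u "params D" "lift D"] unfolding uv by (simp add: N_def)
  have "continuous_on N \<kappa>"
    unfolding \<kappa>_def
    by (rule continuous_on_compose2[OF continuous_on_inv_lift[OF D(1)]])
      (auto simp: N_def intro: continuous_on_subset[OF continuous_on_lift[OF E(1)]])
  then have near\<kappa>: "\<forall>\<^sub>F t in nhds 0. Q (\<kappa> (advance v t))" if "\<forall>\<^sub>F y in nhds u. Q y" for Q
  proof -
    have "\<forall>\<^sub>F x in nhds v. x \<in> N \<longrightarrow> Q (\<kappa> x)"
      using continuous_on_nhdsD[OF \<open>continuous_on N \<kappa>\<close> v] that \<kappa>v by simp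
    with near have "\<forall>\<^sub>F x in nhds (advance v 0). x \<in> params E \<longrightarrow> Q (\<kappa> x)"
      by (auto simp: N_def elim: eventually_elim2)
    from eventually_advance[OF this] show ?thesis using E(2) by simp
  qed
  have nearN: "\<forall>\<^sub>F t in nhds 0. advance v t \<in> N"
    using eventually_advance[of _ v 0, simplified, OF near] E(2) by (simp add: N_def)
  have \<kappa>D: "\<kappa> x \<in> params D" "curve D (\<kappa> x) = curve E x" if "x \<in> N" for x
    using inv_lift[of "lift E x" D] that by (auto simp: N_def \<kappa>_def lift_def)
  have adv: "\<forall>\<^sub>F t in nhds 0. advance u (\<tau> t) = \<kappa> (advance v t)"
    using near\<kappa>[OF eventually_advance_displacement[OF D(2)]] nearN
    by eventually_elim (simp add: \<tau>_def \<kappa>D)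
  have \<tau>: "(\<tau> \<longlongrightarrow> 0) (nhds 0)"
    unfolding filterlim_iff \<tau>_def
    using near\<kappa> displacement_tendsto[OF D(2), unfolded filterlim_iff] by blast
  obtain d where d: "d > 0"
    "\<And>h. 0 < h \<Longrightarrow> h < d \<Longrightarrow> curve D u \<bullet> n < curve D (advance u h) \<bullet> n"
    "\<And>h. 0 < h \<Longrightarrow> h < d \<Longrightarrow> curve D (advance u (- h)) \<bullet> n < curve D u \<bullet> n"
    using directional_derivative[OF D] unfolding n_def by blast
  obtain e where e: "e > 0"
    "\<And>h. 0 < h \<Longrightarrow> h < e \<Longrightarrow> curve D u \<bullet> n < curve E (advance v h) \<bullet> n"
    "\<And>h. 0 < h \<Longrightarrow> h < e \<Longrightarrow> curve E (advance v (- h)) \<bullet> n < curve D u \<bullet> n"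
    using directional_derivative[OF E] unfolding n by blast
  have small: "\<forall>\<^sub>F t in nhds 0. \<bar>t\<bar> < e \<and> \<bar>\<tau> t\<bar> < d \<and> curve D (advance u (\<tau> t)) = curve E (advance v t)"
  proof -
    have ball: "\<forall>\<^sub>F t in nhds (0::real). t \<in> ball 0 r" if "r > 0" for r
      using that by (intro eventually_nhds_in_open) auto
    have "\<forall>\<^sub>F t in nhds 0. \<tau> t \<in> ball 0 d"
      using \<tau> ball[OF d(1)] unfolding filterlim_iff by blast
    from adv nearN this ball[OF e(1)] show ?thesis
      by eventually_elim (simp add: \<kappa>D)
  qed
  \<comment> \<open>If \<tau> had the wrong sign at \<open>t\<close>, the common point of the two
    curves would lie on both sides of \<open>u\<close> along \<open>n\<close>.\<close>
  have dir: "\<forall>\<^sub>F t in nhds 0. (0 < t \<longrightarrow> 0 < \<tau> t) \<and> (t < 0 \<longrightarrow> \<tau> t < 0)"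
    using small
  proof eventually_elim
    case (elim t)
    have "curve D (advance u (\<tau> t)) \<bullet> n \<le> curve D u \<bullet> n" if "\<tau> t \<le> 0"
      using d(3)[of "- \<tau> t"] that elim by (cases "\<tau> t = 0") auto
    moreover have "curve D (advance u (\<tau> t)) \<bullet> n \<ge> curve D u \<bullet> n" if "\<tau> t \<ge> 0"
      using d(2)[of "\<tau> t"] that elim by (cases "\<tau> t = 0") auto
    ultimately show ?case
      using e(2)[of t] e(3)[of "- t"] elim by force
  qed
  have "\<forall>\<^sub>F t in F. P (advance u (\<tau> t))"
  proof (cases "F = at_right 0")
    case True
    with P have "\<forall>\<^sub>F s in nhds 0. s > 0 \<longrightarrow> P (advance u s)"
      by (auto simp: eventually_at_filter elim: eventually_mono)
    with \<tau> have "\<forall>\<^sub>F t in nhds 0. \<tau> t > 0 \<longrightarrow> P (advance u (\<tau> t))"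
      unfolding filterlim_iff by (elim allE impE)
    with dir show ?thesis
      unfolding True eventually_at_filter by eventually_elim auto
  next
    case False
    with F have F: "F = at_left 0" by simp
    with P have "\<forall>\<^sub>F s in nhds 0. s < 0 \<longrightarrow> P (advance u s)"
      by (auto simp: eventually_at_filter elim: eventually_mono)
    with \<tau> have "\<forall>\<^sub>F t in nhds 0. \<tau> t < 0 \<longrightarrow> P (advance u (\<tau> t))"
      unfolding filterlim_iff by (elim allE impE)
    with dir show ?thesis
      unfolding F eventually_at_filter by eventually_elim auto
  qed
  moreover have "\<forall>\<^sub>F t in F. advance u (\<tau> t) = \<kappa> (advance v t)"
  proof -
    have "F \<le> nhds 0" using F by (auto simp: at_within_def)
    with adv show ?thesis by (rule filter_leD[rotated])
  qed
  ultimately show ?thesis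
    unfolding \<kappa>_def by eventually_elim simp
qed

section \<open>The mirror image\<close>

lemma mirror_bounded_linear: "bounded_linear mirror"
  unfolding mirror_def
  by (intro bounded_linear_Pair bounded_linear_minus bounded_linear_fst bounded_linear_snd)

lemma mirror_mirror [simp]: "mirror (mirror p) = p"
  by (simp add: mirror_def)

lemma height_mirror [simp]: "height (mirror p) = height p"
  by (simp add: mirror_def height_def)

lemma fst_mirror [simp]: "fst (mirror p) = - fst p"
  by (simp add: mirror_def)

lemma bij_mirror: "bij mirror"
  by (rule o_bij[of mirror]) auto

lemma mirror_has_derivative: "(mirror has_derivative mirror) (at p)"
  by (rule bounded_linear_imp_has_derivative[OF mirror_bounded_linear])

lemma params_s [simp]: "params (s_diagram D) = params D"
  by (simp add: s_diagram_def switch_crossings_def image_diagram_def params_def)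

lemma curve_s [simp]: "curve (s_diagram D) w = mirror (curve D w)"
  by (simp add: s_diagram_def switch_crossings_def image_diagram_def)

lemma crossings_s [simp]: "crossings (s_diagram D) = converse (crossings D)"
  by (simp add: s_diagram_def switch_crossings_def image_diagram_def)

lemma bar_params_s [simp]: "bar_params (s_diagram D) = bar_params D"
  using bar_params_image[OF bij_is_inj[OF bij_mirror], of D]
  by (simp add: s_diagram_def switch_crossings_def bar_params_def params_def)

lemma double_pairs_s [simp]: "double_pairs (s_diagram D) = double_pairs D"
  using double_pairs_image[OF bij_is_inj[OF bij_mirror], of D]
  by (simp add: s_diagram_def switch_crossings_def double_pairs_def params_def)

lemma semi_arcs_s [simp]: "semi_arcs (s_diagram D) = semi_arcs D"
  by (simp add: semi_arcs_def)

lemma tends_along_s [simp]: "tends_along (s_diagram D) = tends_along D"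
  by (intro ext) (simp add: tends_along_def)

lemma velocity_s:
  assumes "generic_immersion D" "w \<in> params D"
  shows "velocity (s_diagram D) w = mirror (velocity D w)"
  using velocity_image[OF assms mirror_has_derivative]
  by (simp add: s_diagram_def switch_crossings_def velocity_def)

lemma generic_immersion_s:
  assumes "generic_immersion D"
  shows "generic_immersion (s_diagram D)"
proof -
  have "blinfun_apply (Blinfun mirror) = mirror"
    by (rule bounded_linear_Blinfun_apply[OF mirror_bounded_linear])
  then have "generic_immersion (image_diagram mirror D)"
    using generic_immersion_image[OF assms bij_is_inj[OF bij_mirror], of "\<lambda>p. Blinfun mirror"]
    by (simp add: mirror_has_derivative bij_mirror)
  moreover have "generic_immersion (switch_crossings E) = generic_immersion E" for E
  proof -
    have "ncomp (switch_crossings E) = ncomp E" "curve (switch_crossings E) = curve E"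
      by (simp_all add: switch_crossings_def)
    moreover from this have "params (switch_crossings E) = params E"
        "velocity (switch_crossings E) = velocity E" "double_pairs (switch_crossings E) = double_pairs E"
      by (simp_all add: params_def velocity_def[abs_def] double_pairs_def)
    ultimately show ?thesis
      unfolding generic_immersion_def by simp
  qed
  ultimately show ?thesis
    by (simp add: s_diagram_def)
qed

lemma upper_relationsI:
  assumes "crossing_at D u v a a' b b'"
  shows "(x a', x a) \<in> upper_relations x D"
    "positive D u v \<Longrightarrow> (x b', x b \<triangleright> x a) \<in> upper_relations x D"
    "negative D u v \<Longrightarrow> (x b', x b \<triangleright>\<^sup>- x a) \<in> upper_relations x D"
  using assms unfolding upper_relations_def by blast+

lemma upper_relationsE:
  assumes "(s, t) \<in> upper_relations x D"
  obtains (over) u v a a' b b' where "crossing_at D u v a a' b b'" "s = x a'" "t = x a"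
    | (pos) u v a a' b b' where "crossing_at D u v a a' b b'" "positive D u v" "s = x b'" "t = x b \<triangleright> x a"
    | (neg) u v a a' b b' where "crossing_at D u v a a' b b'" "negative D u v" "s = x b'" "t = x b \<triangleright>\<^sup>- x a"
  using assms unfolding upper_relations_def by blast

text \<open>The reflection reverses the sign of the determinant, and so does exchanging the two
  strands; the two changes cancel.\<close>

lemma sign_s:
  assumes "generic_immersion D" "u \<in> params D" "v \<in> params D"
  shows "positive (s_diagram D) u v = positive D v u" "negative (s_diagram D) u v = negative D v u"
  by (simp_all add: positive_def negative_def velocity_s assms mirror_def det2_def algebra_simps)

lemma upper_relations_s:
  assumes D: "generic_immersion D" "crossings D \<subseteq> double_pairs D"
  shows "upper_relations y (s_diagram D) = lower_relations y D"
proof -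
  have cr: "crossing_at (s_diagram D) u v a a' b b' \<longleftrightarrow> crossing_at D v u b b' a a'" for u v a a' b b'
    by (auto simp: crossing_at_def arrives_tends_along leaves_tends_along)
  have par: "u \<in> params D \<and> v \<in> params D" if "crossing_at D u v a a' b b'" for u v a a' b b'
    using that D(2) by (auto simp: crossing_at_def double_pairs_def)
  have pos: "crossing_at D v u b b' a a' \<and> positive (s_diagram D) u v \<longleftrightarrow>
      crossing_at D v u b b' a a' \<and> positive D v u" for u v a a' b b'
    using par[of v u] sign_s(1)[OF D(1), of u v] by blast
  have neg: "crossing_at D v u b b' a a' \<and> negative (s_diagram D) u v \<longleftrightarrow>
      crossing_at D v u b b' a a' \<and> negative D v u" for u v a a' b b'
    using par[of v u] sign_s(2)[OF D(1), of u v] by blast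
  show ?thesis
    unfolding upper_relations_def lower_relations_def cr pos neg by blast
qed

section \<open>Barred arcs\<close>

text \<open>\<open>H\<close> will be the height along a closed component and \<open>p\<close> a full
  turn. By Rolle's theorem a curve that never left the strip would have a critical point in it. At
  the first exit the derivative is non-zero and points outwards, so the curve is outside just
  afterwards.\<close>

lemma first_exit:
  fixes H H' :: "real \<Rightarrow> real"
  assumes deriv: "\<And>t. (H has_real_derivative H' t) (at t)"
    and H0: "lo < H 0" "H 0 < hi" and p: "0 < p" "H p = H 0"
    and regular: "\<And>t. H t \<in> {lo..hi} \<Longrightarrow> H' t \<noteq> 0"
  obtains \<beta> where "0 < \<beta>" "\<And>t. 0 \<le> t \<Longrightarrow> t < \<beta> \<Longrightarrow> lo < H t \<and> H t < hi" "H \<beta> \<in> {lo, hi}"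
    "\<forall>\<^sub>F t in at_right \<beta>. H t \<notin> {lo..hi}"
proof -
  have cont: "continuous_on S H" for S
    using deriv by (meson DERIV_isCont continuous_at_imp_continuous_on)
  \<comment> \<open>The times at which the open strip has been left; \<beta> will be the first of
    them.\<close>
  define Z where "Z = {t \<in> {0..p}. H t \<le> lo \<or> hi \<le> H t}"
  have "Z = ({0..p} \<inter> H -` {..lo}) \<union> ({0..p} \<inter> H -` {hi..})"
    by (auto simp: Z_def)
  moreover have "closed ({0..p} \<inter> H -` {..lo})" "closed ({0..p} \<inter> H -` {hi..})"
    by (intro continuous_closed_preimage cont closed_atLeastAtMost closed_atMost closed_atLeast)+
  ultimately have compact: "compact Z"
    by (intro compact_eq_bounded_closed[THEN iffD2] conjI)
      (auto intro: bounded_subset[OF bounded_closed_interval[of 0 p]])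
  have "Z \<noteq> {}"
  proof
    assume "Z = {}"
    moreover obtain z where "0 < z" "z < p" "H p - H 0 = (p - 0) * H' z"
      using MVT2[OF p(1), of H H'] deriv by blast
    moreover from \<open>Z = {}\<close> this have "\<not> (H z \<le> lo \<or> hi \<le> H z)" by (auto simp: Z_def)
    ultimately show False using p regular[of z] by auto
  qed
  from compact_attains_inf[OF compact this]
  obtain \<beta> where \<beta>: "\<beta> \<in> Z" "\<And>t. t \<in> Z \<Longrightarrow> \<beta> \<le> t"
    by blast
  have "\<beta> \<noteq> 0" using \<beta>(1) H0 by (auto simp: Z_def)
  then have "0 < \<beta>" "\<beta> \<le> p" using \<beta>(1) by (auto simp: Z_def)
  have before: "lo < H t \<and> H t < hi" if "0 \<le> t" "t < \<beta>" for t
    using \<beta>(2)[of t] that \<open>\<beta> \<le> p\<close> by (force simp: Z_def)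
  have "lo \<le> H \<beta>"
  proof (rule ccontr)
    assume "\<not> lo \<le> H \<beta>"
    then obtain t where t: "0 \<le> t" "t \<le> \<beta>" "H t = lo"
      using IVT2'[of H \<beta> lo 0] H0 \<open>0 < \<beta>\<close> cont by auto
    with before[of t] \<open>\<not> lo \<le> H \<beta>\<close> show False by (cases "t = \<beta>") auto
  qed
  moreover have "H \<beta> \<le> hi"
  proof (rule ccontr)
    assume "\<not> H \<beta> \<le> hi"
    then obtain t where t: "0 \<le> t" "t \<le> \<beta>" "H t = hi"
      using IVT'[of H 0 hi \<beta>] H0 \<open>0 < \<beta>\<close> cont by auto
    with before[of t] \<open>\<not> H \<beta> \<le> hi\<close> show False by (cases "t = \<beta>") auto
  qed
  ultimately have end_in: "H \<beta> \<in> {lo, hi}" and "H' \<beta> \<noteq> 0"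
    using \<beta>(1) regular[of \<beta>] by (auto simp: Z_def)
  have "\<forall>\<^sub>F t in at_right \<beta>. H t \<notin> {lo..hi}"
  proof (cases "H \<beta> = lo")
    case True
    \<comment> \<open>A positive derivative would put the curve below \<open>lo\<close> already just
      before \<beta>.\<close>
    have "\<not> H' \<beta> > 0"
    proof
      assume "H' \<beta> > 0"
      then obtain d where d: "d > 0" "\<And>h. h > 0 \<Longrightarrow> h < d \<Longrightarrow> H (\<beta> - h) < H \<beta>"
        using DERIV_pos_inc_left[OF deriv] by blast
      define h where "h = min (d / 2) \<beta>"
      have "h > 0" "h < d" "h \<le> \<beta>" using d(1) \<open>0 < \<beta>\<close> by (auto simp: h_def)
      with d(2)[of h] before[of "\<beta> - h"] True show False by auto
    qed
    with \<open>H' \<beta> \<noteq> 0\<close> have "H' \<beta> < 0" by simp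
    then obtain d where d: "d > 0" "\<And>h. h > 0 \<Longrightarrow> h < d \<Longrightarrow> H (\<beta> + h) < H \<beta>"
      using DERIV_neg_dec_right[OF deriv] by blast
    show ?thesis
      unfolding eventually_at_right_field
    proof (intro exI[of _ "\<beta> + d"] conjI allI impI)
      fix y assume "\<beta> < y" "y < \<beta> + d"
      then show "H y \<notin> {lo..hi}" using d(2)[of "y - \<beta>"] True by simp
    qed (use d(1) in simp)
  next
    case False
    then have hi: "H \<beta> = hi" using end_in by simp
    have "\<not> H' \<beta> < 0"
    proof
      assume "H' \<beta> < 0"
      then obtain d where d: "d > 0" "\<And>h. h > 0 \<Longrightarrow> h < d \<Longrightarrow> H (\<beta> - h) > H \<beta>"
        using DERIV_neg_dec_left[OF deriv] by blast
      define h where "h = min (d / 2) \<beta>"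
      have "h > 0" "h < d" "h \<le> \<beta>" using d(1) \<open>0 < \<beta>\<close> by (auto simp: h_def)
      with d(2)[of h] before[of "\<beta> - h"] hi show False by auto
    qed
    with \<open>H' \<beta> \<noteq> 0\<close> have "H' \<beta> > 0" by simp
    then obtain d where d: "d > 0" "\<And>h. h > 0 \<Longrightarrow> h < d \<Longrightarrow> H (\<beta> + h) > H \<beta>"
      using DERIV_pos_inc_right[OF deriv] by blast
    show ?thesis
      unfolding eventually_at_right_field
    proof (intro exI[of _ "\<beta> + d"] conjI allI impI)
      fix y assume "\<beta> < y" "y < \<beta> + d"
      then show "H y \<notin> {lo..hi}" using d(2)[of "y - \<beta>"] hi by simp
    qed (use d(1) in simp)
  qed
  with that[OF \<open>0 < \<beta>\<close> before end_in] show thesis by blast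
qed

text \<open>The exit lemma, used forwards and backwards from \<open>w\<close>, yields an interval
  around 0. Without critical points the height is injective on it, which is how the two ends will be
  told apart.\<close>

lemma barred_arc_parametrization:
  assumes D: "generic_immersion D" and w: "w \<in> params D"
    and strip: "lo < height (curve D w)" "height (curve D w) < hi"
    and regular: "over_strip D lo hi \<inter> critical_params D = {}"
  obtains \<alpha> \<beta> where "\<alpha> < 0" "0 < \<beta>" "barred_arc D w lo hi = advance w ` {\<alpha>..\<beta>}"
    "inj_on (\<lambda>t. height (curve D (advance w t))) {\<alpha>..\<beta>}"
    "\<And>t. \<alpha> < t \<Longrightarrow> t < \<beta> \<Longrightarrow> lo < height (curve D (advance w t)) \<and> height (curve D (advance w t)) < hi"
    "height (curve D (advance w \<alpha>)) \<in> {lo, hi}" "height (curve D (advance w \<beta>)) \<in> {lo, hi}"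
    "\<forall>\<^sub>F t in at_left \<alpha>. height (curve D (advance w t)) \<notin> {lo..hi}"
    "\<forall>\<^sub>F t in at_right \<beta>. height (curve D (advance w t)) \<notin> {lo..hi}"
proof -
  define H where "H t = height (curve D (advance w t))" for t
  define H' where "H' t = height (velocity D (advance w t))" for t
  have deriv: "(H has_real_derivative H' t) (at t)" for t
    using bounded_linear.has_vector_derivative[OF bounded_linear_snd
        has_vector_derivative_curve(1)[OF D w, of t]]
    by (simp add: H_def[abs_def] H'_def height_def has_real_derivative_iff_has_vector_derivative)
  have strip_iff: "advance w t \<in> over_strip D lo hi \<longleftrightarrow> H t \<in> {lo..hi}" for t
    using w by (simp add: over_strip_def H_def)
  have reg: "H' t \<noteq> 0" if "H t \<in> {lo..hi}" for t
    using regular w that strip_iff[of t] by (auto simp: critical_params_def H'_def)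
  have H0: "lo < H 0" "H 0 < hi" using strip by (simp_all add: H_def)
  obtain \<beta> where \<beta>: "0 < \<beta>" "\<And>t. 0 \<le> t \<Longrightarrow> t < \<beta> \<Longrightarrow> lo < H t \<and> H t < hi" "H \<beta> \<in> {lo, hi}"
    "\<forall>\<^sub>F t in at_right \<beta>. H t \<notin> {lo..hi}"
    by (rule first_exit[OF deriv H0, of "2 * pi"]) (simp_all add: H_def reg[unfolded H_def])
  have minus: "((\<lambda>t. H (- t)) has_real_derivative - H' (- t)) (at t)" for t
    using DERIV_mirror[of H "H' (- t)" t] deriv[of "- t"] by simp
  \<comment> \<open>A full turn backwards also returns to \<open>w\<close>, so the exit lemma
    applies to the reversed curve.\<close>
  have "advance w (- (2 * pi)) = w"
    using advance_advance[of w "- (2 * pi)" "2 * pi"] advance_2pi[of "advance w (- (2 * pi))"] by simp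
  then obtain \<alpha> where \<alpha>: "0 < - \<alpha>" "\<And>t. 0 \<le> t \<Longrightarrow> t < - \<alpha> \<Longrightarrow> lo < H (- t) \<and> H (- t) < hi"
    "H \<alpha> \<in> {lo, hi}" "\<forall>\<^sub>F t in at_right (- \<alpha>). H (- t) \<notin> {lo..hi}"
    using first_exit[OF minus, of lo hi "2 * pi"] H0 reg
    by (metis (no_types, lifting) H_def advance_0 minus_minus minus_zero neg_equal_0_iff_equal
        pi_gt_zero zero_less_mult_iff zero_less_numeral)
  have inside: "lo < H t \<and> H t < hi" if "\<alpha> < t" "t < \<beta>" for t
    using \<alpha>(2)[of "- t"] \<beta>(2)[of t] that by (cases "0 \<le> t") auto
  have within: "H t \<in> {lo..hi}" if "t \<in> {\<alpha>..\<beta>}" for t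
  proof -
    consider "t = \<alpha>" | "t = \<beta>" | "\<alpha> < t" "t < \<beta>" using \<open>t \<in> {\<alpha>..\<beta>}\<close> by fastforce
    then show ?thesis
      using \<alpha>(3) \<beta>(3) H0 inside[of t] by cases auto
  qed
  have left: "\<forall>\<^sub>F t in at_left \<alpha>. H t \<notin> {lo..hi}"
    using \<alpha>(4) by (simp add: eventually_at_left_to_right at_left_minus eventually_filtermap)
  have inj: "inj_on H {\<alpha>..\<beta>}"
  proof (rule linorder_inj_onI')
    fix s t assume st: "s \<in> {\<alpha>..\<beta>}" "t \<in> {\<alpha>..\<beta>}" "s < t"
    obtain z where "s < z" "z < t" "H t - H s = (t - s) * H' z"
      using MVT2[OF st(3), of H H'] deriv by blast
    then show "H s \<noteq> H t" using reg[OF within, of z] st by auto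
  qed
  let ?B = "barred_arc D w lo hi" and ?I = "advance w ` {\<alpha>..\<beta>}"
  have w_in: "w \<in> over_strip D lo hi" using strip_iff[of 0] H0 by simp
  have "?I \<subseteq> ?B"
    unfolding barred_arc_def
  proof (rule connected_component_maximal)
    show "w \<in> ?I" using \<alpha>(1) \<beta>(1) by (intro image_eqI[of _ _ 0]) auto
  qed (use within strip_iff in \<open>auto intro: connected_advance_image\<close>)
  moreover have "?B \<subseteq> ?I"
  proof
    fix x assume x: "x \<in> ?B"
    have BS: "?B \<subseteq> over_strip D lo hi" unfolding barred_arc_def by (rule connected_component_subset)
    \<comment> \<open>Just beyond either end of the interval the curve is outside the strip. So the
      image of the interval is open as well as closed in the component, and membership in it is
      locally constant.\<close>
    have "(x \<in> ?I) = (w \<in> ?I)"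
    proof (rule connected_locally_constant[of ?B "\<lambda>x. x \<in> ?I"])
      fix x assume "x \<in> ?B"
      show "\<forall>\<^sub>F y in nhds x. y \<in> ?B \<longrightarrow> (y \<in> ?I) = (x \<in> ?I)"
      proof (cases "x \<in> ?I")
        case True
        then obtain s where s: "s \<in> {\<alpha>..\<beta>}" "x = advance w s" by blast
        have "\<forall>\<^sub>F t in nhds s. advance w t \<in> over_strip D lo hi \<longrightarrow> t \<in> {\<alpha>..\<beta>}"
        proof -
          have "\<forall>\<^sub>F t in nhds s. s < \<beta> \<longrightarrow> t < \<beta>" "\<forall>\<^sub>F t in nhds s. \<alpha> < s \<longrightarrow> \<alpha> < t"
            using eventually_nhds_in_open[of "{..<\<beta>}" s] eventually_nhds_in_open[of "{\<alpha><..}" s]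
            by (auto elim: eventually_mono)
          moreover have "\<forall>\<^sub>F t in nhds s. s = \<beta> \<longrightarrow> t > \<beta> \<longrightarrow> H t \<notin> {lo..hi}"
            using \<beta>(4) by (cases "s = \<beta>") (auto simp: eventually_at_filter elim: eventually_mono)
          moreover have "\<forall>\<^sub>F t in nhds s. s = \<alpha> \<longrightarrow> t < \<alpha> \<longrightarrow> H t \<notin> {lo..hi}"
            using left by (cases "s = \<alpha>") (auto simp: eventually_at_filter elim: eventually_mono)
          ultimately show ?thesis
          proof eventually_elim
            case (elim t)
            with s(1) show ?case unfolding strip_iff by (simp, linarith)
          qed
        qed
        then have "\<forall>\<^sub>F t in nhds s. advance w t \<in> over_strip D lo hi \<longrightarrow> advance w t \<in> ?I"
          by (auto elim: eventually_mono)
        from eventually_advance_params[OF w this] True BS show ?thesis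
          unfolding s(2) by (auto simp: over_strip_def elim!: eventually_mono)
      next
        case False
        have "closed ?I"
          by (intro compact_imp_closed compact_continuous_image continuous_on_advance) simp
        then have "\<forall>\<^sub>F y in nhds x. y \<in> - ?I"
          using False by (intro eventually_nhds_in_open) auto
        then show ?thesis by (rule eventually_mono) (use False in simp)
      qed
    next
      show "connected ?B" by (simp add: barred_arc_def)
      show "w \<in> ?B" using w_in by (simp add: barred_arc_def connected_component_refl_eq)
    qed (fact x)
    moreover have "w \<in> ?I" using \<alpha>(1) \<beta>(1) by (intro image_eqI[of _ _ 0]) auto
    ultimately show "x \<in> ?I" by simp
  qed
  ultimately have "?B = ?I" by simp
  show thesis
    by (rule that[of \<alpha> \<beta>])
      (use \<alpha>(1,3) \<beta>(1,3,4) inside left inj \<open>?B = ?I\<close> in \<open>simp_all add: H_def[abs_def]\<close>)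
qed

section \<open>Doubled diagrams\<close>

text \<open>The booleans index the two sheets \<open>D\<close> (False) and \<open>s(D)\<close> (True) of the double covering, and
  also the bottom (False) and the top (True) of a strip.  The arc \<open>new \<epsilon> w\<close> starts at the bottom
  on the sheet \<open>\<epsilon>\<close> and ends at the top on the other sheet; so its end \<open>s\<close> is on the sheet
  \<open>\<epsilon> \<noteq> s\<close>.  The orientations of the new arcs play no role, because the bar relations are
  symmetric in the two semi-arcs at a bar.\<close>

locale doubled_diagram =
  fixes D Dt :: diagram and level :: "bool \<Rightarrow> param \<Rightarrow> real"
    and new :: "bool \<Rightarrow> param \<Rightarrow> param set" and fin :: "bool \<Rightarrow> param \<Rightarrow> param"
  assumes immersion: "generic_immersion D" "generic_immersion Dt"
    and crossings: "crossings D \<subseteq> double_pairs D" "crossings Dt \<subseteq> double_pairs Dt"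
    and finite_bars: "finite (bar_params D)" and no_bars: "bars Dt = {}"
    and right: "\<And>v. v \<in> params D \<Longrightarrow> fst (curve D v) > 0"
    and between: "\<And>w. w \<in> bar_params D \<Longrightarrow>
        level False w < height (curve D w) \<and> height (curve D w) < level True w"
    and thin: "\<And>w. w \<in> bar_params D \<Longrightarrow> over_strip D (level False w) (level True w) \<inter>
        (critical_params D \<union> Field (double_pairs D)) = {}"
    and disjoint_strips: "disjoint_family_on (\<lambda>w. {level False w..level True w}) (bar_params D)"
    and fin: "\<And>w s. w \<in> bar_params D \<Longrightarrow>
        fin s w \<in> barred_arc D w (level False w) (level True w) \<and>
        height (curve D (fin s w)) = level s w"
    and new: "\<And>w \<epsilon>. w \<in> bar_params D \<Longrightarrow>
        new \<epsilon> w \<subseteq> params Dt \<and> closed (new \<epsilon> w) \<and> connected (new \<epsilon> w)"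
    and new_height: "\<And>w \<epsilon> u. w \<in> bar_params D \<Longrightarrow> u \<in> new \<epsilon> w \<Longrightarrow>
        height (curve Dt u) \<in> {level False w..level True w}"
    and new_end: "\<And>w \<epsilon> s u. w \<in> bar_params D \<Longrightarrow> u \<in> new \<epsilon> w \<Longrightarrow>
        height (curve Dt u) = level s w \<Longrightarrow> (fst (curve Dt u) < 0) = (\<epsilon> \<noteq> s)"
    and new_disjoint: "\<And>w. w \<in> bar_params D \<Longrightarrow> new False w \<inter> new True w = {}"
    and lift_kept: "\<And>kept. kept = params D -
          (\<Union>w\<in>bar_params D. barred_arc D w (level False w) (level True w)) \<Longrightarrow>
        lift Dt ` (params Dt - (\<Union>w\<in>bar_params D. new False w \<union> new True w)) =
          lift D ` kept \<union> lift (s_diagram D) ` kept"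
    and lifted: "lifted_crossings Dt = lifted_crossings D \<union> lifted_crossings (s_diagram D)"
begin

abbreviation "W \<equiv> bar_params D"

definition sheet :: "bool \<Rightarrow> diagram" where
  "sheet \<epsilon> = (if \<epsilon> then s_diagram D else D)"

definition arc :: "param \<Rightarrow> param set" where
  "arc w = barred_arc D w (level False w) (level True w)"

definition kept :: "param set" where
  "kept = params D - (\<Union>w\<in>W. arc w)"

text \<open>The closure of \<open>kept\<close>: the ends of the barred arcs are added to make it
  compact. At these points the copies of the kept part meet the new arcs, so that closed pieces with
  common points arise.\<close>

definition K :: "param set" where
  "K = kept \<union> {fin s w | s w. w \<in> W}"

text \<open>The parameter of \<open>Dt\<close> at the copy of \<open>v\<close> on the sheet
  \<epsilon>, found by its lift because the parametrizations are unrelated. It is meaningful for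
  \<open>v\<close> in \<open>K\<close>.\<close>

definition \<kappa> :: "bool \<Rightarrow> param \<Rightarrow> param" where
  "\<kappa> \<epsilon> v = inv_into (params Dt) (lift Dt) (lift (sheet \<epsilon>) v)"

section \<open>Barred arcs, their ends, and the kept part\<close>

lemma sheet_simps [simp]:
  "params (sheet \<epsilon>) = params D" "double_pairs (sheet \<epsilon>) = double_pairs D"
  "height (curve (sheet \<epsilon>) v) = height (curve D v)"
  by (simp_all add: sheet_def)

lemma immersion_sheet: "generic_immersion (sheet \<epsilon>)"
  using immersion generic_immersion_s by (simp add: sheet_def)

lemma side_sheet: "v \<in> params D \<Longrightarrow> fst (curve (sheet \<epsilon>) v) < 0 \<longleftrightarrow> \<epsilon>"
  using right[of v] by (auto simp: sheet_def)

lemma W_params: "w \<in> W \<Longrightarrow> w \<in> params D"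
  by (simp add: bar_params_def)

lemma arc_parametrization:
  assumes "w \<in> W"
  obtains \<alpha> \<beta> where "\<alpha> < 0" "0 < \<beta>" "arc w = advance w ` {\<alpha>..\<beta>}"
    "inj_on (\<lambda>t. height (curve D (advance w t))) {\<alpha>..\<beta>}"
    "\<And>t. \<alpha> < t \<Longrightarrow> t < \<beta> \<Longrightarrow>
      level False w < height (curve D (advance w t)) \<and> height (curve D (advance w t)) < level True w"
    "height (curve D (advance w \<alpha>)) \<in> {level False w, level True w}"
    "height (curve D (advance w \<beta>)) \<in> {level False w, level True w}"
    "\<forall>\<^sub>F t in at_left \<alpha>. height (curve D (advance w t)) \<notin> {level False w..level True w}"
    "\<forall>\<^sub>F t in at_right \<beta>. height (curve D (advance w t)) \<notin> {level False w..level True w}"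
proof (rule barred_arc_parametrization[OF immersion(1) W_params[OF assms], of "level False w" "level True w"])
  show "level False w < height (curve D w)" "height (curve D w) < level True w"
    using between[OF assms] by simp_all
  show "over_strip D (level False w) (level True w) \<inter> critical_params D = {}"
    using thin[OF assms] by blast
qed (rule that[unfolded arc_def])

lemma arc_subset_strip: "arc w \<subseteq> over_strip D (level False w) (level True w)"
  unfolding arc_def barred_arc_def by (rule connected_component_subset)

lemma arc_params: "arc w \<subseteq> params D"
  using arc_subset_strip[of w] unfolding over_strip_def by blast

lemma arc_height: "v \<in> arc w \<Longrightarrow> height (curve D v) \<in> {level False w..level True w}"
  using arc_subset_strip[of w] unfolding over_strip_def by blast

lemma fin_arc: "w \<in> W \<Longrightarrow> fin s w \<in> arc w"
  and fin_height: "w \<in> W \<Longrightarrow> height (curve D (fin s w)) = level s w"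
  using fin by (auto simp: arc_def)

lemma fin_params: "w \<in> W \<Longrightarrow> fin s w \<in> params D"
  using fin_arc arc_params by blast

lemma level_less: "w \<in> W \<Longrightarrow> level False w < level True w"
  using between order_less_trans by blast

lemma same_strip:
  assumes "w \<in> W" "w' \<in> W" "h \<in> {level False w..level True w}" "h \<in> {level False w'..level True w'}"
  shows "w = w'"
  using disjoint_strips assms unfolding disjoint_family_on_def by (meson disjoint_iff)

lemma level_in_strip: "w \<in> W \<Longrightarrow> level s w \<in> {level False w..level True w}"
  using level_less[of w] by (cases s) simp_all

lemma same_arc: "w \<in> W \<Longrightarrow> w' \<in> W \<Longrightarrow> v \<in> arc w \<Longrightarrow> v \<in> arc w' \<Longrightarrow> w = w'"
  by (meson same_strip arc_height)

lemma arc_height_inj: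
  assumes "w \<in> W" "u \<in> arc w" "v \<in> arc w" "height (curve D u) = height (curve D v)"
  shows "u = v"
proof -
  obtain \<alpha> \<beta> where "arc w = advance w ` {\<alpha>..\<beta>}"
    "inj_on (\<lambda>t. height (curve D (advance w t))) {\<alpha>..\<beta>}"
    by (rule arc_parametrization[OF assms(1)])
  with assms(2-) show ?thesis by (auto dest: inj_onD)
qed

lemma arc_closed: "w \<in> W \<Longrightarrow> closed (arc w)"
  by (rule arc_parametrization)
    (auto intro!: compact_imp_closed compact_continuous_image continuous_on_advance)

lemma W_in_arc: "w \<in> W \<Longrightarrow> w \<in> arc w"
  by (rule arc_parametrization) (auto intro!: image_eqI[of _ _ 0])

lemma crossing_params: "v \<in> Field (crossings D) \<Longrightarrow> v \<in> params D"
  using crossings(1) by (auto simp: Field_def double_pairs_def)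

lemma crossing_not_in_strip:
  assumes "v \<in> Field (crossings D)" "w \<in> W"
  shows "height (curve D v) \<notin> {level False w..level True w}"
proof
  assume "height (curve D v) \<in> {level False w..level True w}"
  moreover have "v \<in> Field (double_pairs D)" "v \<in> params D"
    using assms(1) mono_Field[OF crossings(1)] crossing_params by auto
  ultimately show False
    using thin[OF assms(2)] unfolding over_strip_def by blast
qed

text \<open>Thin strips contain no crossings, and the disjointness of the strips keeps the other
  bars away.\<close>

lemma arc_cuts: "w \<in> W \<Longrightarrow> arc w \<inter> cuts D = {w}"
proof -
  assume w: "w \<in> W"
  have "v = w" if "v \<in> arc w" "v \<in> cuts D" for v
    using that crossing_not_in_strip[OF _ w, of v] arc_height[of v w] same_arc[OF w _ that(1) W_in_arc]
    unfolding cuts_def by blast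
  then show ?thesis using W_in_arc[OF w] w by (auto simp: cuts_def)
qed

lemma finite_cuts: "finite (cuts D)" "finite (cuts Dt)"
proof -
  have fin: "finite (Field (crossings E))"
    if "generic_immersion E" "crossings E \<subseteq> double_pairs E" for E
    using that finite_subset by (intro finite_Field) (auto simp: generic_immersion_def)
  show "finite (cuts D)" "finite (cuts Dt)"
    using fin immersion crossings finite_bars no_bars by (auto simp: cuts_def bar_params_def)
qed

lemma cuts_Dt: "cuts Dt = Field (crossings Dt)"
  using no_bars by (simp add: cuts_def bar_params_def)

lemma crossing_kept: "v \<in> Field (crossings D) \<Longrightarrow> v \<in> kept"
  unfolding kept_def by (meson DiffI UN_E arc_height crossing_not_in_strip crossing_params)

lemma K_subset: "K \<subseteq> params D - W"
proof
  fix v assume "v \<in> K"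
  moreover have "fin s w \<notin> W" if "w \<in> W" for s w
  proof
    assume "fin s w \<in> W"
    then have "fin s w = w" using arc_cuts[OF that] fin_arc[OF that] by (auto simp: cuts_def)
    then show False using fin_height[OF that, of s] between[OF that] by (cases s) auto
  qed
  ultimately show "v \<in> params D - W"
    using W_in_arc fin_params unfolding K_def kept_def by blast
qed

lemma K_arc:
  assumes "w \<in> W" "v \<in> K" "v \<in> arc w"
  shows "\<exists>s. v = fin s w"
proof -
  obtain s w' where "v = fin s w'" "w' \<in> W"
    using assms unfolding K_def kept_def by blast
  then show ?thesis using same_arc[OF assms(1) _ assms(3)] fin_arc by blast
qed

lemma eventually_kept:
  assumes "v \<in> kept"
  shows "\<forall>\<^sub>F y in nhds v. y \<in> params D \<longrightarrow> y \<in> kept"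
proof -
  have "closed (\<Union>w\<in>W. arc w)"
    using finite_bars arc_closed by blast
  then have "\<forall>\<^sub>F y in nhds v. y \<in> - (\<Union>w\<in>W. arc w)"
    using assms by (intro eventually_nhds_in_open open_Compl) (auto simp: kept_def)
  then show ?thesis
    by (rule eventually_mono) (simp add: kept_def)
qed

text \<open>A point strictly inside a barred arc has a neighbourhood inside this arc.\<close>

lemma K_closed: "closed K"
proof -
  have "\<forall>\<^sub>F y in nhds x. y \<in> - K" if "x \<notin> K" for x
  proof (cases "x \<in> params D")
    case False
    then have "\<forall>\<^sub>F y in nhds x. y \<in> - params D"
      using compact_imp_closed[OF compact_params] by (intro eventually_nhds_in_open) auto
    then show ?thesis by (rule eventually_mono) (use K_subset in auto)
  next
    case True
    with that obtain w where w: "w \<in> W" "x \<in> arc w" by (auto simp: K_def kept_def)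
    obtain \<alpha> \<beta> where I: "arc w = advance w ` {\<alpha>..\<beta>}"
      "\<And>t. \<alpha> < t \<Longrightarrow> t < \<beta> \<Longrightarrow>
        level False w < height (curve D (advance w t)) \<and> height (curve D (advance w t)) < level True w"
      "height (curve D (advance w \<alpha>)) \<in> {level False w, level True w}"
      "height (curve D (advance w \<beta>)) \<in> {level False w, level True w}"
      using arc_parametrization[OF w(1)] by metis
    then obtain r where r: "r \<in> {\<alpha>..\<beta>}" "x = advance w r" using w(2) by blast
    \<comment> \<open>The height is injective on the barred arc, so only \<open>fin s w\<close>
      attains \<open>level s w\<close>, and that point belongs to \<open>K\<close>.\<close>
    have "height (curve D x) \<noteq> level s w" for s
      using arc_height_inj[OF w(1) w(2) fin_arc[OF w(1)], of s] fin_height[OF w(1)] that w(1)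
      unfolding K_def by fastforce
    then have "r \<noteq> \<alpha>" "r \<noteq> \<beta>" using I(3,4) r(2) by auto
    with r have "\<forall>\<^sub>F t in nhds r. t \<in> {\<alpha><..<\<beta>}"
      by (intro eventually_nhds_in_open) auto
    then have "\<forall>\<^sub>F t in nhds r. advance w t \<notin> K"
    proof (rule eventually_mono)
      fix t assume t: "t \<in> {\<alpha><..<\<beta>}"
      then have "advance w t \<in> arc w" using I(1) by auto
      moreover have "advance w t \<noteq> fin s w" for s
        using fin_height[OF w(1), of s] I(2)[of t] t by (cases s) auto
      ultimately show "advance w t \<notin> K" using K_arc[OF w(1)] by blast
    qed
    from eventually_advance_params[OF W_params[OF w(1)] this]
    show ?thesis
      unfolding r(2)[symmetric] by (rule eventually_mono) (use K_subset in auto)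
  qed
  then have "open (- K)"
    unfolding open_subopen[of "- K"] eventually_nhds by (metis ComplD ComplI subsetI)
  then show ?thesis by (simp add: closed_def)
qed

text \<open>Just outside an end of a barred arc, \<open>D\<close> has left the strip.\<close>

lemma fin_approached:
  assumes w: "w \<in> W"
  obtains r F where "fin s w = advance w r" "F \<le> nhds r" "F \<noteq> bot" "\<forall>\<^sub>F t in F. advance w t \<in> kept"
proof -
  obtain \<alpha> \<beta> where I: "arc w = advance w ` {\<alpha>..\<beta>}"
    "\<And>t. \<alpha> < t \<Longrightarrow> t < \<beta> \<Longrightarrow>
      level False w < height (curve D (advance w t)) \<and> height (curve D (advance w t)) < level True w"
    "\<forall>\<^sub>F t in at_left \<alpha>. height (curve D (advance w t)) \<notin> {level False w..level True w}"
    "\<forall>\<^sub>F t in at_right \<beta>. height (curve D (advance w t)) \<notin> {level False w..level True w}"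
    using arc_parametrization[OF w] by metis
  obtain r where r: "r \<in> {\<alpha>..\<beta>}" "fin s w = advance w r"
    using fin_arc[OF w] I(1) by blast
  have "r = \<alpha> \<or> r = \<beta>"
    using I(2)[of r] r fin_height[OF w, of s] by (cases s) force+
  \<comment> \<open>The filter on the outer side of the end, pointing away from the barred
    arc.\<close>
  define F where "F = (if r = \<alpha> then at_left r else at_right r)"
  have F: "F \<le> nhds r" "F \<noteq> bot"
    unfolding F_def using at_within_le_nhds by auto
  have "\<forall>\<^sub>F t in F. height (curve D (advance w t)) \<notin> {level False w..level True w}"
    using I(3,4) \<open>r = \<alpha> \<or> r = \<beta>\<close> by (auto simp: F_def)
  moreover have "\<forall>\<^sub>F t in F. advance w t \<in> - (\<Union>w'\<in>W - {w}. arc w')"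
  proof -
    have "closed (\<Union>w'\<in>W - {w}. arc w')"
      using finite_bars arc_closed by blast
    moreover have "fin s w \<notin> (\<Union>w'\<in>W - {w}. arc w')"
      using same_arc[OF w _ fin_arc[OF w]] by blast
    ultimately have "\<forall>\<^sub>F t in nhds r. advance w t \<in> - (\<Union>w'\<in>W - {w}. arc w')"
      unfolding r(2) by (intro eventually_advance eventually_nhds_in_open open_Compl) simp_all
    then show ?thesis using F(1) by (rule filter_leD[rotated])
  qed
  ultimately have "\<forall>\<^sub>F t in F. advance w t \<in> kept"
  proof eventually_elim
    case (elim t)
    then show ?case using arc_height[of "advance w t" w] W_params[OF w] by (auto simp: kept_def)
  qed
  with that r(2) F show thesis by blast
qed

section \<open>The copies of the kept part in the covering\<close>

lemma lift_kept_sheets: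
  "lift Dt ` (params Dt - (\<Union>w\<in>W. new False w \<union> new True w)) =
    lift (sheet False) ` kept \<union> lift (sheet True) ` kept"
  using lift_kept[OF refl] by (simp add: kept_def arc_def sheet_def)

text \<open>An end of a barred arc is a limit of kept points, and the lifted image of
  \<open>Dt\<close> is compact, hence closed. So the covering passes through the end with the
  tangent direction of the sheet.\<close>

lemma lift_sheet_in: "v \<in> K \<Longrightarrow> lift (sheet \<epsilon>) v \<in> lift Dt ` params Dt"
proof -
  have kept: "lift (sheet \<epsilon>) v \<in> lift Dt ` params Dt" if "v \<in> kept" for v
  proof -
    have "lift (sheet \<epsilon>) v \<in> lift (sheet False) ` kept \<union> lift (sheet True) ` kept"
      using that by (cases \<epsilon>) auto
    then show ?thesis unfolding lift_kept_sheets[symmetric] by blast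
  qed
  assume "v \<in> K"
  then consider "v \<in> kept" | s w where "v = fin s w" "w \<in> W"
    unfolding K_def by blast
  then show ?thesis
  proof cases
    case 2
    obtain r F where r: "v = advance w r" "F \<le> nhds r" "F \<noteq> bot" "\<forall>\<^sub>F t in F. advance w t \<in> kept"
      using fin_approached[OF 2(2), of s] unfolding 2(1) by blast
    show ?thesis
    proof (rule ccontr)
      assume "lift (sheet \<epsilon>) v \<notin> lift Dt ` params Dt"
      moreover have "closed (lift Dt ` params Dt)"
        by (intro compact_imp_closed compact_continuous_image continuous_on_lift immersion compact_params)
      ultimately have "\<forall>\<^sub>F p in nhds (lift (sheet \<epsilon>) v). p \<in> - lift Dt ` params Dt"
        by (intro eventually_nhds_in_open) auto
      from continuous_on_nhdsD[OF continuous_on_lift[OF immersion_sheet] _ this]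
      have "\<forall>\<^sub>F y in nhds v. y \<in> params D \<longrightarrow> lift (sheet \<epsilon>) y \<in> - lift Dt ` params Dt"
        using fin_params[OF 2(2)] 2(1) by simp
      then have "\<forall>\<^sub>F t in F. advance w t \<in> params D \<longrightarrow> lift (sheet \<epsilon>) (advance w t) \<in> - lift Dt ` params Dt"
        unfolding r(1) by (intro filter_leD[OF r(2)] eventually_advance)
      with r(4) have "\<forall>\<^sub>F t in F. False"
      proof eventually_elim
        case (elim t)
        then show ?case using kept[of "advance w t"] by (simp add: kept_def)
      qed
      with r(3) show False by simp
    qed
  qed (rule kept)
qed

lemma \<kappa>:
  assumes "v \<in> K"
  shows "\<kappa> \<epsilon> v \<in> params Dt" "lift Dt (\<kappa> \<epsilon> v) = lift (sheet \<epsilon>) v"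
    "curve Dt (\<kappa> \<epsilon> v) = curve (sheet \<epsilon>) v"
  using inv_lift[OF lift_sheet_in[OF assms, of \<epsilon>]] unfolding \<kappa>_def by (simp_all add: lift_def)

lemma \<kappa>_height: "v \<in> K \<Longrightarrow> height (curve Dt (\<kappa> \<epsilon> v)) = height (curve D v)"
  by (simp add: \<kappa>)

lemma \<kappa>_side: "v \<in> K \<Longrightarrow> fst (curve Dt (\<kappa> \<epsilon> v)) < 0 \<longleftrightarrow> \<epsilon>"
  using subsetD[OF K_subset] side_sheet[of v \<epsilon>] by (simp add: \<kappa>)

lemma \<kappa>_unique:
  assumes "u \<in> params Dt" "lift Dt u = lift (sheet \<epsilon>) v"
  shows "u = \<kappa> \<epsilon> v"
  unfolding \<kappa>_def assms(2)[symmetric] by (rule inv_into_f_f[OF inj_on_lift[OF immersion(2)] assms(1), symmetric])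

text \<open>The two sheets lie on opposite sides of the vertical axis, which recovers \<epsilon>;
  the injectivity of \<open>lift\<close> then recovers \<open>v\<close>.\<close>

lemma \<kappa>_inj:
  assumes "\<kappa> \<epsilon> v = \<kappa> \<epsilon>' v'" "v \<in> K" "v' \<in> K"
  shows "\<epsilon> = \<epsilon>' \<and> v = v'"
proof -
  have "\<epsilon> = \<epsilon>'" using \<kappa>_side[of v \<epsilon>] \<kappa>_side[of v' \<epsilon>'] assms by simp
  moreover from this have "lift (sheet \<epsilon>) v = lift (sheet \<epsilon>) v'"
    using \<kappa>(2)[of v \<epsilon>] \<kappa>(2)[of v' \<epsilon>'] assms by simp
  then have "v = v'"
    using inj_on_lift[OF immersion_sheet[of \<epsilon>]] K_subset assms by (auto dest: inj_onD)
  ultimately show ?thesis by simp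
qed

lemma kept_K: "kept \<subseteq> K"
  unfolding K_def by blast

lemma fin_K: "w \<in> W \<Longrightarrow> fin s w \<in> K"
  unfolding K_def by blast

lemma \<kappa>_kept_not_new:
  assumes "v \<in> kept" "w \<in> W"
  shows "\<kappa> \<epsilon> v \<notin> new \<epsilon>' w"
proof
  assume new: "\<kappa> \<epsilon> v \<in> new \<epsilon>' w"
  have "lift (sheet \<epsilon>) v \<in> lift (sheet False) ` kept \<union> lift (sheet True) ` kept"
    using assms(1) by (cases \<epsilon>) auto
  then obtain u where u: "u \<in> params Dt" "u \<notin> (\<Union>w\<in>W. new False w \<union> new True w)"
    "lift (sheet \<epsilon>) v = lift Dt u"
    unfolding lift_kept_sheets[symmetric] by blast
  then have "u = \<kappa> \<epsilon> v" using \<kappa>_unique by metis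
  with u(2) new assms(2) show False by (cases \<epsilon>') auto
qed

lemma not_new:
  assumes "u \<in> params Dt" "\<And>\<epsilon> w. w \<in> W \<Longrightarrow> u \<notin> new \<epsilon> w"
  shows "\<exists>\<epsilon>. \<exists>v\<in>kept. u = \<kappa> \<epsilon> v"
proof -
  have "lift Dt u \<in> lift (sheet False) ` kept \<union> lift (sheet True) ` kept"
    unfolding lift_kept_sheets[symmetric] using assms by blast
  then show ?thesis using \<kappa>_unique[OF assms(1)] by blast
qed

text \<open>An end of a barred arc is not kept, so by injectivity its copy is not a copy of a kept
  point and must lie on some new arc. Its height determines the strip, and its side of the axis
  determines which of the two arcs it is.\<close>

lemma \<kappa>_fin:
  assumes w: "w \<in> W"
  shows "\<kappa> (\<epsilon> \<noteq> s) (fin s w) \<in> new \<epsilon> w"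
proof -
  let ?u = "\<kappa> (\<epsilon> \<noteq> s) (fin s w)"
  have "\<exists>\<epsilon>' w'. w' \<in> W \<and> ?u \<in> new \<epsilon>' w'"
  proof (rule ccontr)
    assume "\<not> ?thesis"
    then obtain \<epsilon>' v where "v \<in> kept" "?u = \<kappa> \<epsilon>' v"
      using not_new[OF \<kappa>(1)[OF fin_K[OF w]]] by blast
    then have "fin s w \<in> kept" using \<kappa>_inj[of "\<epsilon> \<noteq> s" "fin s w" \<epsilon>' v] fin_K[OF w] kept_K by blast
    then show False using fin_arc[OF w] w by (auto simp: kept_def)
  qed
  then obtain \<epsilon>' w' where new': "w' \<in> W" "?u \<in> new \<epsilon>' w'" by blast
  have h: "height (curve Dt ?u) = level s w"
    using \<kappa>_height[OF fin_K[OF w]] fin_height[OF w] by simp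
  have "w' = w"
    using same_strip[OF new'(1) w new_height[OF new']] level_in_strip[OF w] h by simp
  moreover have "\<epsilon>' = \<epsilon>"
    using new_end[OF new', of s] h \<kappa>_side[OF fin_K[OF w], of "\<epsilon> \<noteq> s" s] \<open>w' = w\<close> by auto
  ultimately show ?thesis using new'(2) by simp
qed

text \<open>With \<open>\<kappa>_fin\<close>: a new arc meets the copies of \<open>K\<close> exactly
  in its two ends.\<close>

lemma \<kappa>_new:
  assumes "v \<in> K" "w \<in> W" "\<kappa> \<epsilon> v \<in> new \<epsilon>' w"
  shows "\<exists>s. v = fin s w \<and> \<epsilon> = (\<epsilon>' \<noteq> s)"
proof -
  obtain s w' where v: "v = fin s w'" "w' \<in> W"
    using assms \<kappa>_kept_not_new unfolding K_def by blast
  have h: "height (curve Dt (\<kappa> \<epsilon> v)) = level s w'"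
    using \<kappa>_height[OF assms(1)] fin_height[OF v(2)] v(1) by simp
  have "w' = w"
    using same_strip[OF v(2) assms(2) _ new_height[OF assms(2,3)]] level_in_strip[OF v(2)] h by simp
  moreover have "\<epsilon> = (\<epsilon>' \<noteq> s)"
    using new_end[OF assms(2,3), of s] h \<kappa>_side[OF assms(1), of \<epsilon>] \<open>w' = w\<close> by simp
  ultimately show ?thesis using v(1) by blast
qed

lemma \<kappa>_continuous: "continuous_on K (\<kappa> \<epsilon>)"
  unfolding \<kappa>_def
proof (rule continuous_on_compose2[OF continuous_on_inv_lift[OF immersion(2)]])
  show "continuous_on K (lift (sheet \<epsilon>))"
    using continuous_on_subset[OF continuous_on_lift[OF immersion_sheet[of \<epsilon>]]] K_subset by auto
qed (use lift_sheet_in in blast)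

lemma K_compact: "compact K"
proof -
  have "params D \<inter> K = K" using K_subset by blast
  then show ?thesis using compact_Int_closed[OF compact_params K_closed, of D] by simp
qed

lemma \<kappa>_image_closed: "closed (\<kappa> \<epsilon> ` K)"
  by (intro compact_imp_closed compact_continuous_image \<kappa>_continuous K_compact)

lemma inv_\<kappa>: "v \<in> K \<Longrightarrow> inv_into K (\<kappa> \<epsilon>) (\<kappa> \<epsilon> v) = v"
  by (rule inv_into_f_f[OF inj_onI]) (simp_all add: \<kappa>_inj)

lemma \<kappa>_inv_continuous: "continuous_on (\<kappa> \<epsilon> ` K) (inv_into K (\<kappa> \<epsilon>))"
  by (rule continuous_on_inv[OF \<kappa>_continuous K_compact]) (simp add: inv_\<kappa>)

lemma crossings_sheet: "(v, v') \<in> crossings (sheet \<epsilon>) \<Longrightarrow> v \<in> Field (crossings D) \<and> v' \<in> Field (crossings D)"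
  by (auto simp: sheet_def Field_def split: if_splits)

lemma crossings_Dt:
  "(u, u') \<in> crossings Dt \<longleftrightarrow> (\<exists>\<epsilon> v v'. (v, v') \<in> crossings (sheet \<epsilon>) \<and> u = \<kappa> \<epsilon> v \<and> u' = \<kappa> \<epsilon> v')"
proof
  assume uu': "(u, u') \<in> crossings Dt"
  then have "(lift Dt u, lift Dt u') \<in> lifted_crossings Dt"
    unfolding lifted_crossings_iff by blast
  then have "(lift Dt u, lift Dt u') \<in> lifted_crossings (sheet False) \<union> lifted_crossings (sheet True)"
    unfolding lifted by (simp add: sheet_def)
  then obtain \<epsilon> where "(lift Dt u, lift Dt u') \<in> lifted_crossings (sheet \<epsilon>)" by blast
  then obtain v v' where "(v, v') \<in> crossings (sheet \<epsilon>)" "lift Dt u = lift (sheet \<epsilon>) v"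
    "lift Dt u' = lift (sheet \<epsilon>) v'"
    unfolding lifted_crossings_iff Pair_inject by blast
  moreover have "u \<in> params Dt" "u' \<in> params Dt"
    using uu' crossings(2) by (auto simp: double_pairs_def)
  ultimately show "\<exists>\<epsilon> v v'. (v, v') \<in> crossings (sheet \<epsilon>) \<and> u = \<kappa> \<epsilon> v \<and> u' = \<kappa> \<epsilon> v'"
    using \<kappa>_unique by blast
next
  assume "\<exists>\<epsilon> v v'. (v, v') \<in> crossings (sheet \<epsilon>) \<and> u = \<kappa> \<epsilon> v \<and> u' = \<kappa> \<epsilon> v'"
  then obtain \<epsilon> v v' where v: "(v, v') \<in> crossings (sheet \<epsilon>)" "u = \<kappa> \<epsilon> v" "u' = \<kappa> \<epsilon> v'" by blast
  have "lifted_crossings (sheet \<epsilon>) \<subseteq> lifted_crossings Dt"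
    using lifted by (auto simp: sheet_def)
  moreover have "(lift (sheet \<epsilon>) v, lift (sheet \<epsilon>) v') \<in> lifted_crossings (sheet \<epsilon>)"
    unfolding lifted_crossings_iff using v(1) by blast
  ultimately have "(lift (sheet \<epsilon>) v, lift (sheet \<epsilon>) v') \<in> lifted_crossings Dt" by blast
  then obtain x x' where x: "(x, x') \<in> crossings Dt" "lift (sheet \<epsilon>) v = lift Dt x"
    "lift (sheet \<epsilon>) v' = lift Dt x'"
    unfolding lifted_crossings_iff Pair_inject by blast
  moreover have "x \<in> params Dt" "x' \<in> params Dt"
    using x(1) crossings(2) by (auto simp: double_pairs_def)
  ultimately show "(u, u') \<in> crossings Dt" using \<kappa>_unique v by metis
qed

lemma Field_crossings_Dt:
  "u \<in> Field (crossings Dt) \<longleftrightarrow> (\<exists>\<epsilon>. \<exists>x\<in>Field (crossings D). u = \<kappa> \<epsilon> x)"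
proof
  assume "u \<in> Field (crossings Dt)"
  then obtain y where "(u, y) \<in> crossings Dt \<or> (y, u) \<in> crossings Dt"
    unfolding Field_def by blast
  then show "\<exists>\<epsilon>. \<exists>x\<in>Field (crossings D). u = \<kappa> \<epsilon> x"
    unfolding crossings_Dt using crossings_sheet by metis
next
  assume "\<exists>\<epsilon>. \<exists>x\<in>Field (crossings D). u = \<kappa> \<epsilon> x"
  then obtain \<epsilon> x where x: "x \<in> Field (crossings D)" "u = \<kappa> \<epsilon> x" by blast
  then have "x \<in> Field (crossings (sheet \<epsilon>))" by (simp add: sheet_def)
  then obtain y where "(x, y) \<in> crossings (sheet \<epsilon>) \<or> (y, x) \<in> crossings (sheet \<epsilon>)"
    unfolding Field_def by blast
  then have "(u, \<kappa> \<epsilon> y) \<in> crossings Dt \<or> (\<kappa> \<epsilon> y, u) \<in> crossings Dt"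
    unfolding x(2) crossings_Dt by blast
  then show "u \<in> Field (crossings Dt)" unfolding Field_def by blast
qed

text \<open>Only the bars of \<open>D\<close> cease to be cuts in \<open>Dt\<close>, and
  \<open>K\<close> contains none of them.\<close>

lemma \<kappa>_cuts:
  assumes "v \<in> K"
  shows "\<kappa> \<epsilon> v \<in> cuts Dt \<longleftrightarrow> v \<in> cuts D"
proof
  assume "\<kappa> \<epsilon> v \<in> cuts Dt"
  then obtain \<epsilon>' x where x: "x \<in> Field (crossings D)" "\<kappa> \<epsilon> v = \<kappa> \<epsilon>' x"
    unfolding cuts_Dt Field_crossings_Dt by blast
  then have "v = x"
    using \<kappa>_inj[of \<epsilon> v \<epsilon>' x] assms crossing_kept[of x] kept_K by blast
  with x show "v \<in> cuts D" by (simp add: cuts_def)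
next
  assume "v \<in> cuts D"
  then have "v \<in> Field (crossings D)" using K_subset assms unfolding cuts_def by blast
  then show "\<kappa> \<epsilon> v \<in> cuts Dt"
    unfolding cuts_Dt Field_crossings_Dt by blast
qed

text \<open>Every real crossing of \<open>Dt\<close> comes from a crossing of \<open>D\<close>,
  whose parameters are kept, and copies of kept points are off the new arcs.\<close>

lemma new_cuts:
  assumes "w \<in> W"
  shows "new \<epsilon> w \<inter> cuts Dt = {}"
proof -
  have "u \<notin> cuts Dt" if "u \<in> new \<epsilon> w" for u
  proof
    assume "u \<in> cuts Dt"
    then obtain \<epsilon>' x where "x \<in> Field (crossings D)" "u = \<kappa> \<epsilon>' x"
      unfolding cuts_Dt Field_crossings_Dt by blast
    with that \<kappa>_kept_not_new[OF crossing_kept assms, of x \<epsilon>' \<epsilon>] show False by simp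
  qed
  then show ?thesis by blast
qed

lemma \<kappa>_off_cuts: "v \<in> K \<Longrightarrow> v \<notin> cuts D \<Longrightarrow> \<kappa> \<epsilon> v \<in> params Dt - cuts Dt"
  using \<kappa>(1) \<kappa>_cuts by blast

section \<open>The halves of a barred arc\<close>

text \<open>The bar separates the barred arc into two pieces, each connected to one end without
  passing a cut. They are indexed by the level of that end. The existential \<open>s\<close> at the
  end of the statement leaves open whether \<open>D\<close> runs upwards or downwards through the
  strip.\<close>

lemma halves_exist:
  assumes w: "w \<in> W"
  shows "\<exists>C. (\<forall>s. closed (C s) \<and> connected (C s - {w}) \<and> fin s w \<in> C s) \<and>
    C False \<union> C True = arc w \<and> C False \<inter> C True = {w} \<and>
    (\<exists>s. (\<forall>\<^sub>F t in at_left 0. advance w t \<in> C s) \<and> (\<forall>\<^sub>F t in at_right 0. advance w t \<in> C (\<not> s)))"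
proof -
  obtain \<alpha> \<beta> where I: "\<alpha> < 0" "0 < \<beta>" "arc w = advance w ` {\<alpha>..\<beta>}"
    and inj: "inj_on (\<lambda>t. height (curve D (advance w t))) {\<alpha>..\<beta>}"
    and ends: "height (curve D (advance w \<alpha>)) \<in> {level False w, level True w}"
      "height (curve D (advance w \<beta>)) \<in> {level False w, level True w}"
    by (rule arc_parametrization[OF w])
  have fin: "advance w t = fin s w" if "t \<in> {\<alpha>..\<beta>}" "height (curve D (advance w t)) = level s w" for s t
    using that I(3) by (intro arc_height_inj[OF w _ fin_arc[OF w]]) (auto simp: fin_height[OF w])
  obtain s where s: "height (curve D (advance w \<alpha>)) = level s w" using ends(1) by blast
  obtain s' where s': "height (curve D (advance w \<beta>)) = level s' w" using ends(2) by blast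
  have "s' = (\<not> s)" using inj_onD[OF inj, of \<alpha> \<beta>] s s' I(1,2) by (cases "s' = s") auto
  then have fins: "fin s w = advance w \<alpha>" "fin (\<not> s) w = advance w \<beta>"
    using fin[OF _ s] fin[OF _ s'] I(1,2) by auto
  have zero: "t = r" if "advance w t = advance w r" "t \<in> {\<alpha>..\<beta>}" "r \<in> {\<alpha>..\<beta>}" for t r
    using inj_onD[OF inj, of t r] that by simp
  \<comment> \<open>Here \<open>s\<close> is the level reached at \<alpha>, so the half with index
    \<open>s\<close> is the one before \<open>w\<close>.\<close>
  define C where "C x = advance w ` (if x = s then {\<alpha>..0} else {0..\<beta>})" for x
  have moved: "advance w t \<noteq> w" if "t \<in> {\<alpha>..\<beta>}" "t \<noteq> 0" for t
    using zero[of t 0] that I(1,2) by auto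
  have punctured: "w \<notin> advance w ` {\<alpha>..<0}" "w \<notin> advance w ` {0<..\<beta>}"
  proof -
    have "advance w t \<noteq> w" if "t \<in> {\<alpha>..<0} \<union> {0<..\<beta>}" for t
      using that I(1,2) by (intro moved) auto
    then show "w \<notin> advance w ` {\<alpha>..<0}" "w \<notin> advance w ` {0<..\<beta>}" by force+
  qed
  have "{\<alpha>..0} = insert 0 {\<alpha>..<0}" "{0..\<beta>} = insert 0 {0<..\<beta>}"
    using I(1,2) by auto
  then have "advance w ` {\<alpha>..0} - {w} = advance w ` {\<alpha>..<0}"
    "advance w ` {0..\<beta>} - {w} = advance w ` {0<..\<beta>}"
    using punctured by simp_all
  then have "connected (C x - {w})" for x
    by (simp add: C_def connected_advance_image)
  moreover
  have "closed (C x)" for x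
    unfolding C_def by (intro compact_imp_closed compact_continuous_image continuous_on_advance) simp
  moreover have "fin x w \<in> C x" for x
    using fins I(1,2) by (cases "x = s") (auto simp: C_def)
  moreover have "C False \<union> C True = arc w"
    unfolding I(3) C_def image_Un[symmetric] using I(1,2) by (cases s) (auto simp: ivl_disj_un)
  moreover have "C s \<inter> C (\<not> s) = {w}"
  proof -
    have C: "C s = advance w ` {\<alpha>..0}" "C (\<not> s) = advance w ` {0..\<beta>}"
      by (simp_all add: C_def)
    have "C s \<inter> C (\<not> s) \<subseteq> {w}"
    proof
      fix x assume "x \<in> C s \<inter> C (\<not> s)"
      then have x: "x \<in> C s" "x \<in> C (\<not> s)" by simp_all
      obtain t r where tr: "t \<in> {\<alpha>..0}" "r \<in> {0..\<beta>}" "x = advance w t" "x = advance w r"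
        using x unfolding C by (elim imageE)
      have "t = r" using tr I(1,2) by (intro zero) auto
      then have "t = 0" using tr by simp
      then show "x \<in> {w}" using tr by simp
    qed
    moreover have "w \<in> C s" "w \<in> C (\<not> s)"
      unfolding C using I(1,2) by (auto intro!: image_eqI[of _ _ 0])
    ultimately show ?thesis by (intro equalityI) simp_all
  qed
  then have "C False \<inter> C True = {w}" by (cases s) auto
  moreover have "\<forall>\<^sub>F t in at_left 0. advance w t \<in> C s"
    unfolding eventually_at_left_field C_def using I(1) by (intro exI[of _ \<alpha>]) auto
  moreover have "\<forall>\<^sub>F t in at_right 0. advance w t \<in> C (\<not> s)"
    unfolding eventually_at_right_field C_def using I(2) by (intro exI[of _ \<beta>]) auto
  ultimately show ?thesis by blast
qed

definition half :: "param \<Rightarrow> bool \<Rightarrow> param set" where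
  "half w = (SOME C. (\<forall>s. closed (C s) \<and> connected (C s - {w}) \<and> fin s w \<in> C s) \<and>
    C False \<union> C True = arc w \<and> C False \<inter> C True = {w} \<and>
    (\<exists>s. (\<forall>\<^sub>F t in at_left 0. advance w t \<in> C s) \<and> (\<forall>\<^sub>F t in at_right 0. advance w t \<in> C (\<not> s))))"

lemma half:
  assumes "w \<in> W"
  shows "closed (half w s)" "connected (half w s - {w})" "fin s w \<in> half w s"
    "half w False \<union> half w True = arc w" "half w False \<inter> half w True = {w}"
    "\<exists>s. (\<forall>\<^sub>F t in at_left 0. advance w t \<in> half w s) \<and> (\<forall>\<^sub>F t in at_right 0. advance w t \<in> half w (\<not> s))"
proof -
  note half = someI_ex[OF halves_exist[OF assms], folded half_def]
  show "half w False \<union> half w True = arc w" "half w False \<inter> half w True = {w}"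
    using half by simp_all
  show "closed (half w s)" "connected (half w s - {w})" "fin s w \<in> half w s"
    using half[THEN conjunct1, rule_format, of s] by simp_all
  show "\<exists>s. (\<forall>\<^sub>F t in at_left 0. advance w t \<in> half w s) \<and> (\<forall>\<^sub>F t in at_right 0. advance w t \<in> half w (\<not> s))"
    using half by (elim conjE)
qed

lemma half_subset_arc: "w \<in> W \<Longrightarrow> half w s \<subseteq> arc w"
  unfolding half(4)[symmetric] by (cases s) simp_all

lemma half_off_cuts: "w \<in> W \<Longrightarrow> half w s - {w} \<subseteq> params D - cuts D"
  using half_subset_arc[of w s] arc_cuts[of w] arc_params[of w] by blast

lemma fin_not_bar: "w \<in> W \<Longrightarrow> fin s w \<noteq> w"
  using fin_K[of w s] subsetD[OF K_subset, of "fin s w"] by auto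

lemma fin_off_cuts: "w \<in> W \<Longrightarrow> fin s w \<in> params D - cuts D"
  using half_off_cuts[of w s] half(3)[of w s] fin_not_bar[of w s] by blast

lemma half_in_semi_arc:
  assumes "w \<in> W" "v \<in> half w s - {w}" "v \<in> a" "a \<in> semi_arcs D"
  shows "fin s w \<in> a"
proof -
  have "fin s w \<in> half w s - {w}" using half(3)[OF assms(1)] fin_not_bar[OF assms(1)] by simp
  then show ?thesis
    using connected_in_semi_arc[OF half(2)[OF assms(1)] half_off_cuts[OF assms(1)] assms(2-4)] by blast
qed

lemma K_or_half:
  assumes "v \<in> params D - cuts D"
  shows "v \<in> K \<or> (\<exists>s. \<exists>w\<in>W. v \<in> half w s - {w})"
proof (cases "v \<in> kept")
  case False
  then obtain w where w: "w \<in> W" "v \<in> arc w" using assms unfolding kept_def by blast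
  then have "v \<noteq> w" using assms unfolding cuts_def by blast
  then show ?thesis using half(4)[OF w(1)] w by blast
qed (use kept_K in blast)

text \<open>A point inside a barred arc is joined to an end by its half, without leaving the
  semi-arc. This justifies the choice made in \<phi>.\<close>

lemma semi_arc_meets_K:
  assumes "a \<in> semi_arcs D"
  shows "a \<inter> K \<noteq> {}"
proof -
  obtain v where v: "v \<in> a" using semi_arc_nonempty[OF assms] by blast
  then have "v \<in> params D - cuts D" using semi_arc_subset[OF assms] by blast
  with K_or_half consider "v \<in> K" | s w where "w \<in> W" "v \<in> half w s - {w}" by blast
  then show ?thesis
  proof cases
    case 2
    then show ?thesis using half_in_semi_arc[OF 2 v assms] fin_K[OF 2(1)] by blast
  qed (use v in blast)
qed

text \<open>The semi-arcs at a bar are named by the ends of the barred arc: \<open>s\<close> is the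
  level from which \<open>D\<close> enters the strip.\<close>

lemma bar_ends:
  assumes w: "w \<in> W"
  shows "\<exists>s. tends_along D (at_left 0) w (semi_arc_at D (fin s w)) \<and>
    tends_along D (at_right 0) w (semi_arc_at D (fin (\<not> s) w))"
proof -
  obtain s where s: "\<forall>\<^sub>F t in at_left 0. advance w t \<in> half w s" "\<forall>\<^sub>F t in at_right 0. advance w t \<in> half w (\<not> s)"
    using half(6)[OF w] by blast
  have sub: "half w s - {w} \<subseteq> semi_arc_at D (fin s w)" for s
    using connected_in_semi_arc[OF half(2)[OF w] half_off_cuts[OF w]]
      half(3)[OF w] fin_not_bar[OF w] semi_arc_at_in[OF fin_off_cuts[OF w]] by blast
  have "\<forall>\<^sub>F t in at 0. advance w t \<notin> {w}"
    by (rule eventually_advance_not_in_finite[OF W_params[OF w]]) simp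
  then have ne: "\<forall>\<^sub>F t in at_left 0. advance w t \<noteq> w" "\<forall>\<^sub>F t in at_right 0. advance w t \<noteq> w"
    by (simp_all add: eventually_at_split)
  from s(1) ne(1) have "\<forall>\<^sub>F t in at_left 0. advance w t \<in> semi_arc_at D (fin s w)"
    by eventually_elim (use sub in blast)
  moreover from s(2) ne(2) have "\<forall>\<^sub>F t in at_right 0. advance w t \<in> semi_arc_at D (fin (\<not> s) w)"
    by eventually_elim (use sub in blast)
  ultimately show ?thesis
    using semi_arc_at_in(1)[OF fin_off_cuts[OF w]] unfolding tends_along_def by blast
qed

section \<open>The correspondence of semi-arcs\<close>

definition \<phi> :: "bool \<Rightarrow> semi_arc \<Rightarrow> semi_arc" where
  "\<phi> \<epsilon> a = semi_arc_at Dt (\<kappa> \<epsilon> (SOME v. v \<in> a \<inter> K))"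

text \<open>On the two halves of a barred arc, which \<open>\<kappa>\<close> does not reach, the locally constant function
  is continued by its value at the end.\<close>

lemma semi_arc_at_\<kappa>:
  assumes a: "a \<in> semi_arcs D" and uv: "u \<in> a \<inter> K" "v \<in> a \<inter> K"
  shows "semi_arc_at Dt (\<kappa> \<epsilon> u) = semi_arc_at Dt (\<kappa> \<epsilon> v)"
proof -
  \<comment> \<open>\<open>None\<close> stands for \<open>K\<close>, where the function of interest
    is defined; \<open>Some (s, w)\<close> stands for the half of the barred arc at \<open>w\<close>
    with end \<open>fin s w\<close>.\<close>
  define J where "J = insert None (Some ` ((UNIV :: bool set) \<times> W))"
  define C where "C = case_option K (\<lambda>(s, w). half w s)"
  define f where "f = case_option (\<lambda>v. semi_arc_at Dt (\<kappa> \<epsilon> v)) (\<lambda>(s, w) _. semi_arc_at Dt (\<kappa> \<epsilon> (fin s w)))"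
  have simps: "C None = K" "C (Some (s, w)) = half w s" "f None x = semi_arc_at Dt (\<kappa> \<epsilon> x)"
    "f (Some (s, w)) x = semi_arc_at Dt (\<kappa> \<epsilon> (fin s w))" for s w x
    by (simp_all add: C_def f_def)
  have J: "j = None \<or> (\<exists>s w. w \<in> W \<and> j = Some (s, w))" if "j \<in> J" for j
    using that unfolding J_def by blast
  have in_J: "None \<in> J" "w \<in> W \<Longrightarrow> Some (s, w) \<in> J" for s w
    unfolding J_def by simp_all
  have off: "x \<in> params D - cuts D" "x \<notin> W" if "x \<in> a" for x
    using semi_arc_subset[OF a] that unfolding cuts_def by blast+
  \<comment> \<open>The bar point is not in \<open>a\<close>, so within \<open>a\<close> a half
    meets \<open>K\<close> only in its own end. There the constant continuation agrees with the
    given function.\<close>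
  have fin_half: "x = fin s w" if x: "x \<in> a" "x \<in> K" "w \<in> W" "x \<in> half w s" for x s w
  proof -
    obtain s' where s': "x = fin s' w"
      using K_arc[OF x(3,2)] half_subset_arc[OF x(3)] x(4) by blast
    have "x \<noteq> w" using off(2)[OF x(1)] x(3) by blast
    then have "x \<notin> half w (\<not> s)" using half(5)[OF x(3)] x(4) by (cases s) auto
    then have "s' = s" using half(3)[OF x(3), of s'] s' by (cases "s' = s") auto
    then show ?thesis using s' by simp
  qed
  have same_half: "s = s' \<and> w = w'"
    if x: "x \<in> a" "w \<in> W" "w' \<in> W" "x \<in> half w s" "x \<in> half w' s'" for x s s' w w'
  proof -
    have "w = w'" using same_arc[OF x(2,3)] half_subset_arc x by blast
    moreover have "x \<noteq> w" using off(2)[OF x(1)] x(2) by blast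
    then have "s = s'" using half(5)[OF x(2)] x(4,5) \<open>w = w'\<close> by (cases s; cases s') auto
    ultimately show ?thesis by simp
  qed
  have "f None u = f None v"
  proof (rule connected_pasted_constant[of a J C f])
    show "connected a" by (rule semi_arc_connected[OF a])
    show "finite J" using finite_bars by (simp add: J_def)
    show "a \<subseteq> (\<Union>j\<in>J. C j)"
    proof
      fix x assume "x \<in> a"
      then have "x \<in> K \<or> (\<exists>s. \<exists>w\<in>W. x \<in> half w s - {w})"
        using K_or_half[OF off(1)] by blast
      then have "\<exists>j\<in>J. x \<in> C j"
      proof (elim disjE exE bexE)
        fix s w assume "w \<in> W" "x \<in> half w s - {w}"
        then show ?thesis by (intro bexI[of _ "Some (s, w)"]) (simp_all add: simps in_J)
      qed (use simps in_J in blast)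
      then show "x \<in> (\<Union>j\<in>J. C j)" by blast
    qed
    show "closed (C j)" if "j \<in> J" for j
      using J[OF that] K_closed half(1) by (elim disjE exE conjE) (simp_all add: simps)
    show "\<forall>\<^sub>F y in nhds x. y \<in> a \<inter> C j \<longrightarrow> f j y = f j x" if "j \<in> J" "x \<in> a \<inter> C j" for j x
      using J[OF that(1)]
    proof (elim disjE exE conjE)
      assume j: "j = None"
      then have x: "x \<in> K" "x \<in> params D - cuts D" using that(2) off(1) by (simp_all add: simps)
      then have \<kappa>x: "\<kappa> \<epsilon> x \<in> params Dt - cuts Dt" using \<kappa>_off_cuts by blast
      from continuous_on_nhdsD[OF \<kappa>_continuous x(1) eventually_semi_arc_at[OF finite_cuts(2) \<kappa>x]]
      show ?thesis
      proof eventually_elim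
        case (elim y)
        show ?case
        proof
          assume "y \<in> a \<inter> C j"
          then have "\<kappa> \<epsilon> y \<in> semi_arc_at Dt (\<kappa> \<epsilon> x)"
            using elim \<kappa>(1)[of y \<epsilon>] j by (simp add: simps)
          then show "f j y = f j x"
            using semi_arc_at_eq[OF semi_arc_at_in(1)[OF \<kappa>x]] j by (simp add: simps)
        qed
      qed
    qed (simp add: simps)
    show "f i x = f j x" if ij: "i \<in> J" "j \<in> J" and x: "x \<in> a" "x \<in> C i" "x \<in> C j" for i j x
      using J[OF ij(1)] J[OF ij(2)]
    proof (elim disjE exE conjE)
      fix s w assume "i = None" "w \<in> W" "j = Some (s, w)"
      then show ?thesis using fin_half[OF x(1), of w s] x(2,3) by (simp add: simps)
    next
      fix s w assume "j = None" "w \<in> W" "i = Some (s, w)"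
      then show ?thesis using fin_half[OF x(1), of w s] x(2,3) by (simp add: simps)
    next
      fix s w s' w' assume "w \<in> W" "i = Some (s, w)" "w' \<in> W" "j = Some (s', w')"
      then show ?thesis using same_half[OF x(1), of w w' s s'] x(2,3) by (simp add: simps)
    qed simp
  qed (use uv in_J in \<open>simp_all add: simps\<close>)
  then show ?thesis by (simp add: simps)
qed

lemma \<phi>_eq:
  assumes "a \<in> semi_arcs D" "v \<in> a" "v \<in> K"
  shows "\<phi> \<epsilon> a = semi_arc_at Dt (\<kappa> \<epsilon> v)"
  unfolding \<phi>_def
proof (rule semi_arc_at_\<kappa>[OF assms(1)])
  show "(SOME v. v \<in> a \<inter> K) \<in> a \<inter> K" by (rule someI[of _ v]) (use assms in blast)
qed (use assms in blast)

lemma \<phi>_in: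
  assumes "a \<in> semi_arcs D"
  shows "\<phi> \<epsilon> a \<in> semi_arcs Dt"
proof -
  obtain v where v: "v \<in> a" "v \<in> K" using semi_arc_meets_K[OF assms] by blast
  then have "\<kappa> \<epsilon> v \<in> params Dt - cuts Dt"
    using semi_arc_subset[OF assms] by (intro \<kappa>_off_cuts) blast+
  then show ?thesis unfolding \<phi>_eq[OF assms v] by (rule semi_arc_at_in(1))
qed

lemma \<kappa>_in_\<phi>:
  assumes "a \<in> semi_arcs D" "v \<in> a" "v \<in> K"
  shows "\<kappa> \<epsilon> v \<in> \<phi> \<epsilon> a"
  unfolding \<phi>_eq[OF assms]
  using semi_arc_subset[OF assms(1)] assms by (intro semi_arc_at_in(2) \<kappa>_off_cuts) blast+

text \<open>A new arc is connected and free of real crossings, so one semi-arc of \<open>Dt\<close>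
  contains it together with the copy of either end.\<close>

lemma new_in_semi_arc:
  assumes w: "w \<in> W"
  shows "new \<epsilon> w \<subseteq> \<phi> (\<epsilon> \<noteq> s) (semi_arc_at D (fin s w))"
proof (rule connected_in_semi_arc)
  show "connected (new \<epsilon> w)" using new[OF w] by blast
  show "new \<epsilon> w \<subseteq> params Dt - cuts Dt" using new[OF w] new_cuts[OF w] by blast
  show "\<kappa> (\<epsilon> \<noteq> s) (fin s w) \<in> new \<epsilon> w" by (rule \<kappa>_fin[OF w])
  show "\<kappa> (\<epsilon> \<noteq> s) (fin s w) \<in> \<phi> (\<epsilon> \<noteq> s) (semi_arc_at D (fin s w))"
    using semi_arc_at_in[OF fin_off_cuts[OF w]] by (intro \<kappa>_in_\<phi> fin_K[OF w]) blast+
  show "\<phi> (\<epsilon> \<noteq> s) (semi_arc_at D (fin s w)) \<in> semi_arcs Dt"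
    using semi_arc_at_in[OF fin_off_cuts[OF w]] by (intro \<phi>_in) blast
qed

text \<open>The arc \<open>new (\<epsilon> \<noteq> s) w\<close> has its end at level
  \<open>s\<close> on the sheet \<epsilon> and its other end on the other sheet, and lies in both
  semi-arcs.\<close>

lemma \<phi>_bar:
  assumes w: "w \<in> W"
  shows "\<phi> \<epsilon> (semi_arc_at D (fin s w)) = \<phi> (\<not> \<epsilon>) (semi_arc_at D (fin (\<not> s) w))"
proof (rule semi_arc_unique)
  let ?u = "\<kappa> \<epsilon> (fin s w)"
  have "?u \<in> new (\<epsilon> \<noteq> s) w" using \<kappa>_fin[OF w, of "\<epsilon> \<noteq> s" s] by (cases s) simp_all
  then show "?u \<in> \<phi> \<epsilon> (semi_arc_at D (fin s w))" "?u \<in> \<phi> (\<not> \<epsilon>) (semi_arc_at D (fin (\<not> s) w))"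
    using subsetD[OF new_in_semi_arc[OF w, of "\<epsilon> \<noteq> s" s], of ?u]
      subsetD[OF new_in_semi_arc[OF w, of "\<epsilon> \<noteq> s" "\<not> s"], of ?u]
    by (cases s; simp)+
qed (use semi_arc_at_in[OF fin_off_cuts[OF w]] in \<open>auto intro: \<phi>_in\<close>)

lemma \<phi>_surj:
  assumes c: "c \<in> semi_arcs Dt"
  shows "\<exists>\<epsilon>. \<exists>a\<in>semi_arcs D. c = \<phi> \<epsilon> a"
proof -
  obtain u where u: "u \<in> c" using semi_arc_nonempty[OF c] by blast
  then have "u \<in> params Dt - cuts Dt" using semi_arc_subset[OF c] by blast
  show ?thesis
  proof (cases "\<exists>\<epsilon> w. w \<in> W \<and> u \<in> new \<epsilon> w")
    case True
    then obtain \<epsilon> w where w: "w \<in> W" "u \<in> new \<epsilon> w" by blast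
    have a: "semi_arc_at D (fin False w) \<in> semi_arcs D"
      using semi_arc_at_in[OF fin_off_cuts[OF w(1)]] by blast
    have "u \<in> \<phi> (\<epsilon> \<noteq> False) (semi_arc_at D (fin False w))"
      using new_in_semi_arc[OF w(1)] w(2) by blast
    then have "c = \<phi> (\<epsilon> \<noteq> False) (semi_arc_at D (fin False w))"
      using semi_arc_unique[OF c \<phi>_in[OF a] u] by blast
    then show ?thesis using a by blast
  next
    case False
    then obtain \<epsilon> v where v: "v \<in> kept" "u = \<kappa> \<epsilon> v"
      using not_new[of u] \<open>u \<in> params Dt - cuts Dt\<close> by blast
    then have "v \<in> K" "v \<in> params D - cuts D"
      using kept_K \<kappa>_cuts[of v \<epsilon>] \<open>u \<in> params Dt - cuts Dt\<close> unfolding kept_def by blast+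
    note a = semi_arc_at_in[OF this(2)]
    have "c = \<phi> \<epsilon> (semi_arc_at D v)"
      using semi_arc_unique[OF c \<phi>_in[OF a(1)] u] \<kappa>_in_\<phi>[OF a \<open>v \<in> K\<close>] v(2) by blast
    then show ?thesis using a(1) by blast
  qed
qed

text \<open>Two generators with the same semi-arc of \<open>Dt\<close> are identified by the bar relations: a
  function on the generators that respects them descends to a locally constant function on \<open>Dt\<close>.\<close>

lemma \<phi>_kernel:
  fixes cls :: "bool \<Rightarrow> semi_arc \<Rightarrow> 'c"
  assumes bar: "\<And>w \<epsilon>. w \<in> W \<Longrightarrow>
      cls \<epsilon> (semi_arc_at D (fin False w)) = cls (\<not> \<epsilon>) (semi_arc_at D (fin True w))"
    and a: "a \<in> semi_arcs D" and a': "a' \<in> semi_arcs D" and eq: "\<phi> \<epsilon> a = \<phi> \<epsilon>' a'"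
  shows "cls \<epsilon> a = cls \<epsilon>' a'"
proof -
  define c where "c = \<phi> \<epsilon> a"
  have c: "c \<in> semi_arcs Dt" unfolding c_def by (rule \<phi>_in[OF a])
  obtain v where v: "v \<in> a" "v \<in> K" using semi_arc_meets_K[OF a] by blast
  obtain v' where v': "v' \<in> a'" "v' \<in> K" using semi_arc_meets_K[OF a'] by blast
  \<comment> \<open>\<open>Inl \<epsilon>\<close> stands for the copy of \<open>K\<close> on the
    sheet \<epsilon>, and \<open>Inr (\<epsilon>, w)\<close> for a new arc.\<close>
  define J where "J = Inl ` (UNIV :: bool set) \<union> Inr ` ((UNIV :: bool set) \<times> W)"
  define C where "C = case_sum (\<lambda>\<epsilon>. \<kappa> \<epsilon> ` K) (\<lambda>(\<epsilon>, w). new \<epsilon> w)"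
  \<comment> \<open>On a new arc the value is taken from its bottom end, which lies on the sheet
    \<epsilon> itself. At the top end it agrees with the other sheet by \<open>bar\<close>.\<close>
  define f where "f = case_sum (\<lambda>\<epsilon> u. cls \<epsilon> (semi_arc_at D (inv_into K (\<kappa> \<epsilon>) u)))
    (\<lambda>(\<epsilon>, w) _. cls \<epsilon> (semi_arc_at D (fin False w)))"
  have simps: "C (Inl \<epsilon>) = \<kappa> \<epsilon> ` K" "C (Inr (\<epsilon>, w)) = new \<epsilon> w"
    "x \<in> K \<Longrightarrow> f (Inl \<epsilon>) (\<kappa> \<epsilon> x) = cls \<epsilon> (semi_arc_at D x)"
    "f (Inr (\<epsilon>, w)) u = cls \<epsilon> (semi_arc_at D (fin False w))" for \<epsilon> w x u
    by (simp_all add: C_def f_def inv_\<kappa>)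
  have J: "(\<exists>\<epsilon>. j = Inl \<epsilon>) \<or> (\<exists>\<epsilon> w. w \<in> W \<and> j = Inr (\<epsilon>, w))" if "j \<in> J" for j
    using that unfolding J_def by blast
  have in_J: "Inl \<epsilon> \<in> J" "w \<in> W \<Longrightarrow> Inr (\<epsilon>, w) \<in> J" for \<epsilon> w
    unfolding J_def by simp_all
  have at_end: "f (Inl \<epsilon>) u = f (Inr (\<epsilon>', w)) u"
    if u: "u \<in> \<kappa> \<epsilon> ` K" "w \<in> W" "u \<in> new \<epsilon>' w" for u \<epsilon> \<epsilon>' w
  proof -
    obtain x where x: "x \<in> K" "u = \<kappa> \<epsilon> x" using u(1) by blast
    obtain s where s: "x = fin s w" "\<epsilon> = (\<epsilon>' \<noteq> s)"
      using \<kappa>_new[OF x(1) u(2)] u(3) x(2) by blast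
    show ?thesis
      using bar[OF u(2), of \<epsilon>'] x s by (cases s) (simp_all add: simps)
  qed
  have "f (Inl \<epsilon>) (\<kappa> \<epsilon> v) = f (Inl \<epsilon>') (\<kappa> \<epsilon>' v')"
  proof (rule connected_pasted_constant[of c J C f])
    show "connected c" by (rule semi_arc_connected[OF c])
    show "finite J" using finite_bars by (simp add: J_def)
    show "c \<subseteq> (\<Union>j\<in>J. C j)"
    proof
      fix u assume "u \<in> c"
      then have u: "u \<in> params Dt" using semi_arc_subset[OF c] by blast
      have "\<exists>j\<in>J. u \<in> C j"
      proof (cases "\<exists>\<epsilon> w. w \<in> W \<and> u \<in> new \<epsilon> w")
        case True
        then obtain \<epsilon> w where "w \<in> W" "u \<in> new \<epsilon> w" by blast
        then show ?thesis by (intro bexI[of _ "Inr (\<epsilon>, w)"]) (simp_all add: simps in_J)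
      next
        case False
        then obtain \<epsilon> x where "x \<in> kept" "u = \<kappa> \<epsilon> x" using not_new[OF u] by blast
        then have "u \<in> \<kappa> \<epsilon> ` K" using kept_K by blast
        then show ?thesis by (intro bexI[of _ "Inl \<epsilon>"]) (simp_all add: simps in_J)
      qed
      then show "u \<in> (\<Union>j\<in>J. C j)" by blast
    qed
    show "closed (C j)" if "j \<in> J" for j
      using J[OF that] \<kappa>_image_closed new by (elim disjE exE conjE) (simp_all add: simps)
    show "\<forall>\<^sub>F y in nhds x. y \<in> c \<inter> C j \<longrightarrow> f j y = f j x" if jJ: "j \<in> J" and xC: "x \<in> c \<inter> C j" for j x
      using J[OF jJ]
    proof (elim disjE exE conjE)
      fix \<epsilon> assume j: "j = Inl \<epsilon>"
      then obtain z where z: "z \<in> K" "x = \<kappa> \<epsilon> z" using xC by (auto simp: simps)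
      have "x \<in> params Dt - cuts Dt" using semi_arc_subset[OF c] xC by blast
      then have "z \<in> params D - cuts D"
        using z \<kappa>_cuts[OF z(1), of \<epsilon>] K_subset by blast
      note near = eventually_semi_arc_at[OF finite_cuts(1) this]
      have "\<forall>\<^sub>F y in nhds x. y \<in> \<kappa> \<epsilon> ` K \<longrightarrow> inv_into K (\<kappa> \<epsilon>) y \<in> params D \<longrightarrow>
          inv_into K (\<kappa> \<epsilon>) y \<in> semi_arc_at D z"
        using z near by (intro continuous_on_nhdsD[OF \<kappa>_inv_continuous]) (simp_all add: inv_\<kappa>)
      then show ?thesis
      proof eventually_elim
        case (elim y)
        show ?case
        proof
          assume "y \<in> c \<inter> C j"
          then obtain q where q: "q \<in> K" "y = \<kappa> \<epsilon> q" using j by (auto simp: simps)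
          then have "q \<in> semi_arc_at D z" using elim subsetD[OF K_subset q(1)] by (simp add: inv_\<kappa>)
          then have "semi_arc_at D q = semi_arc_at D z"
            using semi_arc_at_eq semi_arc_at_in(1)[OF \<open>z \<in> params D - cuts D\<close>] by blast
          then show "f j y = f j x" using j q z by (simp add: simps)
        qed
      qed
    qed (simp add: simps)
    show "f i x = f j x" if ij: "i \<in> J" "j \<in> J" and x: "x \<in> c" "x \<in> C i" "x \<in> C j" for i j x
      using J[OF ij(1)] J[OF ij(2)]
    proof (elim disjE exE conjE)
      fix \<delta> \<delta>' assume i: "i = Inl \<delta>" and j: "j = Inl \<delta>'"
      then obtain z z' where "z \<in> K" "x = \<kappa> \<delta> z" "z' \<in> K" "x = \<kappa> \<delta>' z'"
        using x(2,3) by (auto simp: simps)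
      then have "\<delta> = \<delta>'" using \<kappa>_inj[of \<delta> z \<delta>' z'] by simp
      then show ?thesis using i j by simp
    next
      fix \<delta> \<delta>' w assume "i = Inl \<delta>" "w \<in> W" "j = Inr (\<delta>', w)"
      then show ?thesis using at_end[of x \<delta> w \<delta>'] x(2,3) by (simp add: simps)
    next
      fix \<delta> \<delta>' w assume "j = Inl \<delta>" "w \<in> W" "i = Inr (\<delta>', w)"
      then show ?thesis using at_end[of x \<delta> w \<delta>'] x(2,3) by (simp add: simps)
    next
      fix \<delta> \<delta>' w w' assume *: "w \<in> W" "i = Inr (\<delta>, w)" "w' \<in> W" "j = Inr (\<delta>', w')"
      then have "x \<in> new \<delta> w" "x \<in> new \<delta>' w'" using x(2,3) by (simp_all add: simps)
      moreover from this have "w = w'" using same_strip[OF *(1,3)] new_height * by blast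
      ultimately have "\<delta> = \<delta>'" using new_disjoint[OF *(1)] by (cases \<delta>; cases \<delta>') auto
      then show ?thesis using * \<open>w = w'\<close> by simp
    qed
  qed (use v v' in_J \<kappa>_in_\<phi>[OF a v, of \<epsilon>] \<kappa>_in_\<phi>[OF a' v', of \<epsilon>'] eq in \<open>simp_all add: simps c_def\<close>)
  then show ?thesis
    using v v' semi_arc_at_eq[OF a v(1)] semi_arc_at_eq[OF a' v'(1)] by (simp add: simps)
qed

section \<open>The correspondence of crossings\<close>

text \<open>Crossings are kept, so near them the lift of the sheet stays inside the lift of
  \<open>Dt\<close> and germs can be transferred with their direction. The semi-arc \<open>c\<close>
  at the copy exists anyway; a common point identifies it with
  \<open>\<phi> \<epsilon> a\<close>.\<close>

lemma tends_along_\<phi>: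
  assumes v: "v \<in> Field (crossings D)" and F: "F \<in> {at_left 0, at_right 0}"
    and a: "tends_along D F v a"
  shows "tends_along Dt F (\<kappa> \<epsilon> v) (\<phi> \<epsilon> a)"
proof -
  have aS: "a \<in> semi_arcs D" and ev: "\<forall>\<^sub>F t in F. advance v t \<in> a"
    using a by (simp_all add: tends_along_def)
  have vK: "v \<in> kept" "v \<in> K" using crossing_kept[OF v] kept_K by blast+
  have vD: "v \<in> params D" using crossing_params[OF v] .
  obtain c where c: "tends_along Dt F (\<kappa> \<epsilon> v) c"
    using tends_along_exists[OF \<kappa>(1)[OF vK(2)] finite_cuts(2) F] by blast
  have near: "\<forall>\<^sub>F x in nhds v. x \<in> params (sheet \<epsilon>) \<longrightarrow> lift (sheet \<epsilon>) x \<in> lift Dt ` params Dt"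
    using eventually_kept[OF vK(1)] by (rule eventually_mono) (use lift_sheet_in kept_K in auto)
  have "\<forall>\<^sub>F t in F. \<kappa> \<epsilon> (advance v t) \<in> c"
    unfolding \<kappa>_def
    by (rule eventually_transfer[OF immersion_sheet _ immersion(2) \<kappa>(1)[OF vK(2)] \<kappa>(2)[OF vK(2)] near F])
      (use c vD in \<open>simp_all add: tends_along_def\<close>)
  moreover have "\<forall>\<^sub>F t in F. advance v t \<in> kept"
  proof -
    have "\<forall>\<^sub>F t in nhds 0. advance v t \<in> params D \<longrightarrow> advance v t \<in> kept"
      using eventually_kept[OF vK(1)] by (intro eventually_advance) simp
    moreover have "F \<le> nhds 0" using F at_within_le_nhds by auto
    ultimately show ?thesis using vD by (auto intro: filter_leD)
  qed
  ultimately have "\<forall>\<^sub>F t in F. \<kappa> \<epsilon> (advance v t) \<in> c \<and> advance v t \<in> kept \<and> advance v t \<in> a"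
    using ev by eventually_elim simp
  moreover have "F \<noteq> bot" using F by (elim insertE) simp_all
  ultimately obtain t where t: "\<kappa> \<epsilon> (advance v t) \<in> c" "advance v t \<in> K" "advance v t \<in> a"
    using eventually_happens'[of F] kept_K by blast
  have "\<phi> \<epsilon> a = c"
    using \<phi>_eq[OF aS t(3,2)] semi_arc_at_eq[OF _ t(1)] c by (simp add: tends_along_def)
  with c show ?thesis by simp
qed

lemma tends_along_sheet [simp]: "tends_along (sheet \<epsilon>) = tends_along D"
  by (simp add: sheet_def)

lemma crossing_at_\<phi>:
  assumes "crossing_at (sheet \<epsilon>) u v a a' b b'"
  shows "crossing_at Dt (\<kappa> \<epsilon> u) (\<kappa> \<epsilon> v) (\<phi> \<epsilon> a) (\<phi> \<epsilon> a') (\<phi> \<epsilon> b) (\<phi> \<epsilon> b')"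
proof -
  have uv: "(u, v) \<in> crossings (sheet \<epsilon>)" using assms by (simp add: crossing_at_def)
  then have "(\<kappa> \<epsilon> u, \<kappa> \<epsilon> v) \<in> crossings Dt" unfolding crossings_Dt by blast
  moreover have "u \<in> Field (crossings D)" "v \<in> Field (crossings D)" using crossings_sheet[OF uv] by simp_all
  ultimately show ?thesis
    using assms by (simp add: crossing_at_def arrives_tends_along leaves_tends_along tends_along_\<phi>)
qed

text \<open>No inverse of \<phi> is needed: the semi-arcs at the crossing of the sheet exist, their
  images are incident to the crossing of \<open>Dt\<close>, and incident semi-arcs are
  unique.\<close>

lemma crossing_at_sheet:
  assumes "crossing_at Dt p q c c' d d'"
  obtains \<epsilon> u v a a' b b' where "crossing_at (sheet \<epsilon>) u v a a' b b'" "p = \<kappa> \<epsilon> u" "q = \<kappa> \<epsilon> v"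
    "c = \<phi> \<epsilon> a" "c' = \<phi> \<epsilon> a'" "d = \<phi> \<epsilon> b" "d' = \<phi> \<epsilon> b'"
proof -
  have "(p, q) \<in> crossings Dt" using assms by (simp add: crossing_at_def)
  then obtain \<epsilon> u v where uv: "(u, v) \<in> crossings (sheet \<epsilon>)" "p = \<kappa> \<epsilon> u" "q = \<kappa> \<epsilon> v"
    unfolding crossings_Dt by blast
  have "u \<in> params D" "v \<in> params D"
    using crossings_sheet[OF uv(1)] crossing_params by blast+
  then obtain a a' b b' where "tends_along D (at_left 0) u a" "tends_along D (at_right 0) u a'"
    "tends_along D (at_left 0) v b" "tends_along D (at_right 0) v b'"
    using tends_along_exists[OF _ finite_cuts(1)] by (metis insertI1 insertI2)
  then have *: "crossing_at (sheet \<epsilon>) u v a a' b b'"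
    using uv(1) by (simp add: crossing_at_def arrives_tends_along leaves_tends_along)
  have "x = y" if "tends_along Dt (at_left 0) r x" "tends_along Dt (at_left 0) r y" for r x y
    by (rule tends_along_unique[OF _ that]) simp
  moreover have "x = y" if "tends_along Dt (at_right 0) r x" "tends_along Dt (at_right 0) r y" for r x y
    by (rule tends_along_unique[OF _ that]) simp
  ultimately have "c = \<phi> \<epsilon> a" "c' = \<phi> \<epsilon> a'" "d = \<phi> \<epsilon> b" "d' = \<phi> \<epsilon> b'"
    using assms crossing_at_\<phi>[OF *] uv(2,3)
    unfolding crossing_at_def arrives_tends_along leaves_tends_along by blast+
  with * uv show thesis by (intro that)
qed

lemma sign_\<kappa>:
  assumes "crossing_at (sheet \<epsilon>) u v a a' b b'"
  shows "positive Dt (\<kappa> \<epsilon> u) (\<kappa> \<epsilon> v) = positive (sheet \<epsilon>) u v"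
    "negative Dt (\<kappa> \<epsilon> u) (\<kappa> \<epsilon> v) = negative (sheet \<epsilon>) u v"
proof -
  have "u \<in> Field (crossings D)" "v \<in> Field (crossings D)"
    using assms crossings_sheet[of u v \<epsilon>] by (simp_all add: crossing_at_def)
  then have "u \<in> K" "v \<in> K" using crossing_kept kept_K by blast+
  then show "positive Dt (\<kappa> \<epsilon> u) (\<kappa> \<epsilon> v) = positive (sheet \<epsilon>) u v"
    "negative Dt (\<kappa> \<epsilon> u) (\<kappa> \<epsilon> v) = negative (sheet \<epsilon>) u v"
    by (simp_all add: positive_lift negative_lift \<kappa>(2))
qed

section \<open>Generators and relations\<close>

definition label :: "bool \<Rightarrow> semi_arc \<Rightarrow> twisted_generator" where
  "label \<epsilon> a = (if \<epsilon> then Y a else X a)"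

definition \<Phi> :: "twisted_generator \<Rightarrow> semi_arc" where
  "\<Phi> g = (case g of X a \<Rightarrow> \<phi> False a | Y a \<Rightarrow> \<phi> True a)"

definition gens :: "twisted_generator set" where
  "gens = X ` semi_arcs D \<union> Y ` semi_arcs D"

lemma \<Phi>_label [simp]: "\<Phi> (label \<epsilon> a) = \<phi> \<epsilon> a"
  by (simp add: \<Phi>_def label_def)

lemma label_gens [simp]: "label \<epsilon> a \<in> gens \<longleftrightarrow> a \<in> semi_arcs D"
  by (auto simp: label_def gens_def)

lemma gens_label:
  assumes "g \<in> gens"
  obtains \<epsilon> a where "g = label \<epsilon> a" "a \<in> semi_arcs D"
  using assms that[of False] that[of True] by (auto simp: gens_def label_def)

lemma upper_relations_\<Phi>:
  assumes "(s, t) \<in> upper_relations (\<lambda>a. Gen (label \<epsilon> a)) (sheet \<epsilon>)"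
  shows "(map_qterm \<Phi> s, map_qterm \<Phi> t) \<in> upper_relations Gen Dt"
  using assms
proof (cases rule: upper_relationsE)
  case over
  then show ?thesis by (simp add: upper_relationsI(1)[OF crossing_at_\<phi>[OF over(1)]])
next
  case pos
  then show ?thesis by (simp add: upper_relationsI(2)[OF crossing_at_\<phi>[OF pos(1)]] sign_\<kappa>[OF pos(1)])
next
  case neg
  then show ?thesis by (simp add: upper_relationsI(3)[OF crossing_at_\<phi>[OF neg(1)]] sign_\<kappa>[OF neg(1)])
qed

lemma upper_relations_sheet:
  assumes "(s, t) \<in> upper_relations Gen Dt"
  obtains \<epsilon> s0 t0 where "(s0, t0) \<in> upper_relations (\<lambda>a. Gen (label \<epsilon> a)) (sheet \<epsilon>)"
    "s0 \<in> qterms gens" "t0 \<in> qterms gens" "s = map_qterm \<Phi> s0" "t = map_qterm \<Phi> t0"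
proof -
  have gens: "label \<epsilon> a \<in> gens \<and> label \<epsilon> a' \<in> gens \<and> label \<epsilon> b \<in> gens \<and> label \<epsilon> b' \<in> gens"
    if "crossing_at (sheet \<epsilon>) u v a a' b b'" for \<epsilon> u v a a' b b'
    using that by (simp add: crossing_at_def arrives_tends_along leaves_tends_along) (simp add: tends_along_def)
  show thesis
    using assms
  proof (cases rule: upper_relationsE)
    case (over p q c c' d d')
    obtain \<epsilon> u v a a' b b' where *: "crossing_at (sheet \<epsilon>) u v a a' b b'" "p = \<kappa> \<epsilon> u" "q = \<kappa> \<epsilon> v"
      "c = \<phi> \<epsilon> a" "c' = \<phi> \<epsilon> a'" "d = \<phi> \<epsilon> b" "d' = \<phi> \<epsilon> b'"
      by (rule crossing_at_sheet[OF over(1)])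
    show thesis
      by (rule that[OF upper_relationsI(1)[OF *(1)]]) (use over * gens[OF *(1)] in simp_all)
  next
    case (pos p q c c' d d')
    obtain \<epsilon> u v a a' b b' where *: "crossing_at (sheet \<epsilon>) u v a a' b b'" "p = \<kappa> \<epsilon> u" "q = \<kappa> \<epsilon> v"
      "c = \<phi> \<epsilon> a" "c' = \<phi> \<epsilon> a'" "d = \<phi> \<epsilon> b" "d' = \<phi> \<epsilon> b'"
      by (rule crossing_at_sheet[OF pos(1)])
    have "positive (sheet \<epsilon>) u v" using pos(2) * sign_\<kappa>[OF *(1)] by simp
    then show thesis
      by (intro that[OF upper_relationsI(2)[OF *(1)]]) (use pos * gens[OF *(1)] in simp_all)
  next
    case (neg p q c c' d d')
    obtain \<epsilon> u v a a' b b' where *: "crossing_at (sheet \<epsilon>) u v a a' b b'" "p = \<kappa> \<epsilon> u" "q = \<kappa> \<epsilon> v"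
      "c = \<phi> \<epsilon> a" "c' = \<phi> \<epsilon> a'" "d = \<phi> \<epsilon> b" "d' = \<phi> \<epsilon> b'"
      by (rule crossing_at_sheet[OF neg(1)])
    have "negative (sheet \<epsilon>) u v" using neg(2) * sign_\<kappa>[OF *(1)] by simp
    then show thesis
      by (intro that[OF upper_relationsI(3)[OF *(1)]]) (use neg * gens[OF *(1)] in simp_all)
  qed
qed

definition rels :: "(twisted_generator qterm \<times> twisted_generator qterm) set" where
  "rels = (\<Union>\<epsilon>. upper_relations (\<lambda>a. Gen (label \<epsilon> a)) (sheet \<epsilon>)) \<union>
    bar_relations (\<lambda>a. Gen (X a)) (\<lambda>a. Gen (Y a)) D"

lemma twisted_link_quandle_rels: "twisted_link_quandle D = presented_quandle gens rels"
proof -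
  have "(\<lambda>a. Gen (label False a)) = (\<lambda>a. Gen (X a))" "(\<lambda>a. Gen (label True a)) = (\<lambda>a. Gen (Y a))"
    by (simp_all add: label_def)
  then have "(\<Union>\<epsilon>. upper_relations (\<lambda>a. Gen (label \<epsilon> a)) (sheet \<epsilon>)) =
      upper_relations (\<lambda>a. Gen (X a)) D \<union> lower_relations (\<lambda>a. Gen (Y a)) D"
    by (simp add: UNIV_bool sheet_def upper_relations_s[OF immersion(1) crossings(1)] Un_commute)
  then show ?thesis
    by (simp add: twisted_link_quandle_def rels_def gens_def)
qed

lemma bar_semi_arcs:
  assumes w: "w \<in> W" and "arrives D w a" "leaves D w a'"
  shows "\<exists>s. a = semi_arc_at D (fin s w) \<and> a' = semi_arc_at D (fin (\<not> s) w)"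
proof -
  obtain s where s: "tends_along D (at_left 0) w (semi_arc_at D (fin s w))"
    "tends_along D (at_right 0) w (semi_arc_at D (fin (\<not> s) w))"
    using bar_ends[OF w] by blast
  have "a = semi_arc_at D (fin s w)"
    by (rule tends_along_unique[OF _ _ s(1)]) (use assms in \<open>simp_all add: arrives_tends_along\<close>)
  moreover have "a' = semi_arc_at D (fin (\<not> s) w)"
    by (rule tends_along_unique[OF _ _ s(2)]) (use assms in \<open>simp_all add: leaves_tends_along\<close>)
  ultimately show ?thesis by blast
qed

lemma qcong_bar:
  assumes w: "w \<in> W"
  shows "qcong gens rels (Gen (label \<epsilon> (semi_arc_at D (fin False w))))
    (Gen (label (\<not> \<epsilon>) (semi_arc_at D (fin True w))))"
proof -
  obtain s where "arrives D w (semi_arc_at D (fin s w))" "leaves D w (semi_arc_at D (fin (\<not> s) w))"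
    using bar_ends[OF w] unfolding arrives_tends_along leaves_tends_along by blast
  then have "(Gen (label \<delta> (semi_arc_at D (fin (\<not> s) w))), Gen (label (\<not> \<delta>) (semi_arc_at D (fin s w)))) \<in> rels" for \<delta>
    unfolding rels_def bar_relations_def label_def using w by (cases \<delta>) auto
  moreover have "semi_arc_at D (fin s w) \<in> semi_arcs D" for s
    using semi_arc_at_in[OF fin_off_cuts[OF w]] by blast
  ultimately have "qcong gens rels (Gen (label \<delta> (semi_arc_at D (fin (\<not> s) w))))
      (Gen (label (\<not> \<delta>) (semi_arc_at D (fin s w))))" for \<delta>
    by (intro qcong_rel) simp_all
  \<comment> \<open>The first instance serves the case that \<open>D\<close> leaves the strip at the
    bottom, the reversed one the case that it leaves at the top.\<close>
  from this[of \<epsilon>] qcong_sym[OF this[of "\<not> \<epsilon>"]] show ?thesis by (cases s) simp_all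
qed

lemma qcong_label:
  assumes "g \<in> gens" "g' \<in> gens" "\<Phi> g = \<Phi> g'"
  shows "qcong gens rels (Gen g) (Gen g')"
proof -
  obtain \<epsilon> a where g: "g = label \<epsilon> a" "a \<in> semi_arcs D" by (rule gens_label[OF assms(1)])
  obtain \<epsilon>' a' where g': "g' = label \<epsilon>' a'" "a' \<in> semi_arcs D" by (rule gens_label[OF assms(2)])
  \<comment> \<open>Congruence becomes equality of classes, so that the kernel lemma applies with
    the class of a generator as the function \<open>cls\<close>.\<close>
  have "{t. qcong gens rels (Gen (label \<epsilon> a)) t} = {t. qcong gens rels (Gen (label \<epsilon>' a')) t}"
  proof (rule \<phi>_kernel[OF _ g(2) g'(2)])
    fix w \<epsilon> assume "w \<in> W"
    from qcong_bar[OF this, of \<epsilon>]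
    show "{t. qcong gens rels (Gen (label \<epsilon> (semi_arc_at D (fin False w)))) t} =
        {t. qcong gens rels (Gen (label (\<not> \<epsilon>) (semi_arc_at D (fin True w)))) t}"
      by (meson Collect_cong qcong_sym qcong_trans)
  qed (use assms(3) g g' in simp)
  moreover have "qcong gens rels (Gen g') (Gen g')"
    by (rule qcong_refl) (simp add: assms(2))
  ultimately show ?thesis unfolding g(1) g'(1) by blast
qed

lemma twisted_link_quandle_isomorphic:
  "quandle_isomorphic (twisted_link_quandle D) (virtual_link_quandle Dt)"
  unfolding twisted_link_quandle_rels virtual_link_quandle_def
proof -
  have surj: "\<exists>g. g \<in> gens \<and> \<Phi> g = c" if c: "c \<in> semi_arcs Dt" for c
  proof -
    obtain \<epsilon> a where "a \<in> semi_arcs D" "c = \<phi> \<epsilon> a" using \<phi>_surj[OF c] by blast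
    then have "label \<epsilon> a \<in> gens" "\<Phi> (label \<epsilon> a) = c" by simp_all
    then show ?thesis by blast
  qed
  \<comment> \<open>An arbitrary section: any two generators over one semi-arc are congruent by
    \<open>qcong_label\<close>.\<close>
  then obtain \<sigma> where \<sigma>: "\<And>c. c \<in> semi_arcs Dt \<Longrightarrow> \<sigma> c \<in> gens \<and> \<Phi> (\<sigma> c) = c" by metis
  have \<Phi>_in: "\<Phi> g \<in> semi_arcs Dt" if "g \<in> gens" for g
    using gens_label[OF that] \<phi>_in by (metis \<Phi>_label)
  have \<sigma>\<Phi>: "qcong gens rels (Gen (\<sigma> (\<Phi> g))) (Gen g)" if "g \<in> gens" for g
    using \<sigma>[OF \<Phi>_in[OF that]] by (intro qcong_label that) simp_all
  show "quandle_isomorphic (presented_quandle gens rels)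
      (presented_quandle (semi_arcs Dt) (upper_relations Gen Dt))"
  proof (rule presented_quandle_isomorphic[of \<Phi> _ _ \<sigma>])
    show "\<Phi> ` gens \<subseteq> semi_arcs Dt" using \<Phi>_in by blast
    show "\<sigma> ` semi_arcs Dt \<subseteq> gens" using \<sigma> by blast
    show "\<Phi> (\<sigma> c) = c" if "c \<in> semi_arcs Dt" for c using \<sigma>[OF that] by simp
    show "qcong gens rels (Gen (\<sigma> (\<Phi> g))) (Gen g)" if "g \<in> gens" for g by (rule \<sigma>\<Phi>[OF that])
  next
    fix s t assume st: "(s, t) \<in> rels" "s \<in> qterms gens" "t \<in> qterms gens"
    then have st': "map_qterm \<Phi> s \<in> qterms (semi_arcs Dt)" "map_qterm \<Phi> t \<in> qterms (semi_arcs Dt)"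
      using qterms_map[of _ gens \<Phi>] \<Phi>_in by blast+
    consider \<epsilon> where "(s, t) \<in> upper_relations (\<lambda>a. Gen (label \<epsilon> a)) (sheet \<epsilon>)"
      | "(s, t) \<in> bar_relations (\<lambda>a. Gen (X a)) (\<lambda>a. Gen (Y a)) D"
      using st(1) unfolding rels_def by blast
    then show "qcong (semi_arcs Dt) (upper_relations Gen Dt) (map_qterm \<Phi> s) (map_qterm \<Phi> t)"
    proof cases
      case 1
      then show ?thesis by (intro qcong_rel upper_relations_\<Phi> st')
    next
      case 2
      then obtain w a a' where w': "w \<in> W" "arrives D w a" "leaves D w a'"
        "s = Gen (X a') \<and> t = Gen (Y a) \<or> s = Gen (Y a') \<and> t = Gen (X a)"
        unfolding bar_relations_def by blast
      then obtain \<epsilon> where w: "w \<in> W" "arrives D w a" "leaves D w a'"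
        "s = Gen (label \<epsilon> a')" "t = Gen (label (\<not> \<epsilon>) a)"
        using that[of False] that[of True] unfolding label_def by auto
      obtain r where "a = semi_arc_at D (fin r w)" "a' = semi_arc_at D (fin (\<not> r) w)"
        using bar_semi_arcs[OF w(1-3)] by blast
      then have "map_qterm \<Phi> s = map_qterm \<Phi> t"
        using \<phi>_bar[OF w(1), of "\<not> \<epsilon>" r] w by simp
      then show ?thesis using st' by (simp add: qcong_refl)
    qed
  next
    fix s t assume "(s, t) \<in> upper_relations Gen Dt"
    then obtain \<epsilon> s0 t0 where st0: "(s0, t0) \<in> upper_relations (\<lambda>a. Gen (label \<epsilon> a)) (sheet \<epsilon>)"
      "s0 \<in> qterms gens" "t0 \<in> qterms gens" "s = map_qterm \<Phi> s0" "t = map_qterm \<Phi> t0"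
      by (rule upper_relations_sheet)
    \<comment> \<open>\<sigma> need not turn a relation of \<open>Dt\<close> into a relation in
      \<open>rels\<close>, as it may pick different sheets for the semi-arcs at one crossing. The
      relation is therefore lifted to \<open>s0\<close> and \<open>t0\<close>, and \<sigma> after
      \<Phi> moves each of them only within its class.\<close>
    have retract: "qcong gens rels (map_qterm \<sigma> (map_qterm \<Phi> r)) r" if "r \<in> qterms gens" for r
      using qcong_map_self[OF that, of rels "\<sigma> \<circ> \<Phi>"] \<sigma>\<Phi> by (simp add: qterm.map_comp)
    have "qcong gens rels s0 t0"
      by (rule qcong_rel) (use st0 in \<open>auto simp: rels_def\<close>)
    then show "qcong gens rels (map_qterm \<sigma> s) (map_qterm \<sigma> t)"
      unfolding st0(4,5) using retract[OF st0(2)] retract[OF st0(3)] by (meson qcong_sym qcong_trans)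
  qed
qed

end

section \<open>From a doubling to the indexed data, and the isotopy\<close>

lemma doubling_quandle_isomorphic:
  assumes D: "generic_immersion D" "crossings D \<subseteq> double_pairs D" "finite (bar_params D)"
    "in_right_half_plane D" and Dt: "virtual_link_diagram Dt" and "doubling D Dt"
  shows "quandle_isomorphic (twisted_link_quandle D) (virtual_link_quandle Dt)"
proof -
  let ?W = "bar_params D"
  obtain lo hi g g' where
    thin: "\<forall>w\<in>?W. thin_strip D w (lo w) (hi w)" and
    disjoint: "disjoint_family_on (\<lambda>w. {lo w..hi w}) ?W" and
    arcs: "\<forall>w\<in>?W. replaces_barred_arcs D Dt w (lo w) (hi w) (g w) (g' w)" and
    kept: "lift Dt ` (params Dt - (\<Union>w\<in>?W. path_image (g w) \<union> path_image (g' w))) =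
      lift D ` (params D - (\<Union>w\<in>?W. barred_arc D w (lo w) (hi w))) \<union>
      lift (s_diagram D) ` (params D - (\<Union>w\<in>?W. barred_arc D w (lo w) (hi w)))" and
    lifted: "lifted_crossings Dt = lifted_crossings D \<union> lifted_crossings (s_diagram D)"
    using \<open>doubling D Dt\<close> unfolding doubling_def Let_def
    by (elim exE conjE) (rule that; assumption)
  have "\<forall>w. \<exists>b t. w \<in> ?W \<longrightarrow> b \<in> barred_arc D w (lo w) (hi w) \<and> t \<in> barred_arc D w (lo w) (hi w) \<and>
      height (curve D b) = lo w \<and> height (curve D t) = hi w \<and>
      monotone_arc Dt (g w) (curve D b) (mirror (curve D t)) \<and>
      monotone_arc Dt (g' w) (mirror (curve D b)) (curve D t)"
    using arcs unfolding replaces_barred_arcs_def by meson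
  then obtain b t where bt: "\<And>w. w \<in> ?W \<Longrightarrow> b w \<in> barred_arc D w (lo w) (hi w) \<and>
      t w \<in> barred_arc D w (lo w) (hi w) \<and>
      height (curve D (b w)) = lo w \<and> height (curve D (t w)) = hi w \<and>
      monotone_arc Dt (g w) (curve D (b w)) (mirror (curve D (t w))) \<and>
      monotone_arc Dt (g' w) (mirror (curve D (b w))) (curve D (t w))"
    by metis
  define level where "level s w = (if s then hi w else lo w)" for s w
  define fin where "fin s w = (if s then t w else b w)" for s w
  define G where "G \<epsilon> w = (if \<epsilon> then g' w else g w)" for \<epsilon> w
  have right: "fst (curve D v) > 0" if "v \<in> params D" for v
    using assms(4) that unfolding in_right_half_plane_def by blast
  have arc_params: "barred_arc D w (lo w) (hi w) \<subseteq> params D" for w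
    unfolding barred_arc_def using connected_component_subset[of "over_strip D (lo w) (hi w)" w]
    unfolding over_strip_def by blast
  have fin_right: "fst (curve D (fin s w)) > 0" if "w \<in> ?W" for s w
  proof -
    have "b w \<in> params D" "t w \<in> params D" using bt[OF that] arc_params by blast+
    then show ?thesis using right by (cases s) (simp_all add: fin_def)
  qed
  \<comment> \<open>The end at level \<open>s\<close> of the new arc \<epsilon>: the new arcs change
    sides between bottom and top, so it is mirrored exactly if \<epsilon> and \<open>s\<close>
    differ.\<close>
  define P where "P \<epsilon> s w = (if \<epsilon> \<noteq> s then mirror (curve D (fin s w)) else curve D (fin s w))" for \<epsilon> s w
  have P: "(fst (P \<epsilon> s w) < 0) = (\<epsilon> \<noteq> s)" "height (P \<epsilon> s w) = level s w" if "w \<in> ?W" for \<epsilon> s w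
    using fin_right[OF that, of s] bt[OF that] by (auto simp: P_def fin_def level_def)
  have G: "monotone_arc Dt (G \<epsilon> w) (P \<epsilon> False w) (P \<epsilon> True w)" if "w \<in> ?W" for \<epsilon> w
    using bt[OF that] by (cases \<epsilon>) (simp_all add: G_def P_def fin_def)
  \<comment> \<open>By strict monotonicity a new arc stays in the strip and reaches the two levels
    only in its end points, whose sides are known.\<close>
  have heights: "height (curve Dt (G \<epsilon> w r)) \<in> {level False w..level True w} \<and>
      (height (curve Dt (G \<epsilon> w r)) = level s w \<longrightarrow> curve Dt (G \<epsilon> w r) = P \<epsilon> s w)"
    if w: "w \<in> ?W" and r: "r \<in> {0..1}" for \<epsilon> w r s
  proof -
    let ?h = "\<lambda>r. height (curve Dt (G \<epsilon> w r))"
    have mono: "strict_mono_on {0..1} ?h" and start: "curve Dt (G \<epsilon> w 0) = P \<epsilon> False w"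
      and finish: "curve Dt (G \<epsilon> w 1) = P \<epsilon> True w"
      using G[OF w, of \<epsilon>] by (simp_all add: monotone_arc_def pathstart_def pathfinish_def)
    have less: "?h x < ?h y" if "x \<in> {0..1}" "y \<in> {0..1}" "x < y" for x y
      using strict_mono_onD[OF mono that] .
    have "?h 0 = level False w" "?h 1 = level True w" using start finish P(2)[OF w] by simp_all
    then show ?thesis
      using less[of 0 r] less[of r 1] less[of 0 1] r start finish
      by (cases "r = 0"; cases "r = 1"; cases s) auto
  qed
  interpret doubled_diagram D Dt level "\<lambda>\<epsilon> w. path_image (G \<epsilon> w)" fin
  proof
    have Dt': "twisted_link_diagram Dt" using Dt by (simp add: virtual_link_diagram_def)
    then show "generic_immersion Dt" "crossings Dt \<subseteq> double_pairs Dt"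
      by (simp_all add: twisted_link_diagram_def)
    show "bars Dt = {}" using Dt by (simp add: virtual_link_diagram_def)
    show "lift Dt ` (params Dt - (\<Union>w\<in>?W. path_image (G False w) \<union> path_image (G True w))) =
        lift D ` kept \<union> lift (s_diagram D) ` kept"
      if "kept = params D - (\<Union>w\<in>?W. barred_arc D w (level False w) (level True w))" for kept
      using kept unfolding that by (simp add: G_def level_def)
    show "disjoint_family_on (\<lambda>w. {level False w..level True w}) ?W"
      using disjoint by (simp add: level_def)
    fix w assume w: "w \<in> ?W"
    show "level False w < height (curve D w) \<and> height (curve D w) < level True w"
      "over_strip D (level False w) (level True w) \<inter> (critical_params D \<union> Field (double_pairs D)) = {}"
      using thin w by (simp_all add: thin_strip_def level_def)
    show "fin s w \<in> barred_arc D w (level False w) (level True w) \<and>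
        height (curve D (fin s w)) = level s w" for s
      using bt[OF w] by (simp add: fin_def level_def)
    show "path_image (G \<epsilon> w) \<subseteq> params Dt \<and> closed (path_image (G \<epsilon> w)) \<and> connected (path_image (G \<epsilon> w))" for \<epsilon>
      using G[OF w, of \<epsilon>] by (simp add: monotone_arc_def closed_path_image connected_path_image)
    show "path_image (G False w) \<inter> path_image (G True w) = {}"
      using arcs w by (auto simp: replaces_barred_arcs_def G_def)
    fix \<epsilon> u assume "u \<in> path_image (G \<epsilon> w)"
    then obtain r where r: "r \<in> {0..1}" "u = G \<epsilon> w r" unfolding path_image_def by blast
    show "height (curve Dt u) \<in> {level False w..level True w}"
      using heights[OF w r(1), of \<epsilon>] r(2) by simp
    show "(fst (curve Dt u) < 0) = (\<epsilon> \<noteq> s)" if "height (curve Dt u) = level s w" for s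
      using heights[OF w r(1), of \<epsilon> s] that r(2) P(1)[OF w, of \<epsilon> s] by simp
  qed (use D right lifted in simp_all)
  show ?thesis by (rule twisted_link_quandle_isomorphic)
qed

text \<open>There are finitely many bars, and each meets the diagram at a single parameter.\<close>

lemma finite_bar_params:
  assumes "twisted_link_diagram D"
  shows "finite (bar_params D)"
proof -
  have "finite {v \<in> params D. curve D v \<in> b}" if "b \<in> bars D" for b
  proof -
    have "is_bar D b" using assms that by (simp add: twisted_link_diagram_def)
    then obtain w where "{v \<in> params D. curve D v \<in> b} = {w}"
      unfolding is_bar_def by (elim exE conjE)
    then show ?thesis by simp
  qed
  moreover have "bar_params D = (\<Union>b\<in>bars D. {v \<in> params D. curve D v \<in> b})"
    by (auto simp: bar_params_def)
  ultimately show ?thesis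
    using assms by (simp add: twisted_link_diagram_def)
qed

theorem theorem6p5:
  fixes D Dt :: diagram
  assumes "twisted_link_diagram D"
    and "double_covering_diagram D Dt"
  shows "quandle_isomorphic (twisted_link_quandle D) (virtual_link_quandle Dt)"
proof -
  obtain F where F: "ambient_isotopy F" "in_right_half_plane (image_diagram (F 1) D)"
    "doubling (image_diagram (F 1) D) Dt" and Dt: "virtual_link_diagram Dt"
    using assms(2) by (auto simp: double_covering_diagram_def Let_def)
  obtain f' :: "plane \<Rightarrow> plane \<Rightarrow>\<^sub>L plane" where f': "\<And>p. (F 1 has_derivative f' p) (at p)"
    "continuous_on UNIV f'" "\<And>p. bij (f' p)" "bij (F 1)"
    "\<And>p. det2 (f' p (1, 0)) (f' p (0, 1)) > 0"
    using ambient_isotopy_diffeomorphism[OF F(1)] by blast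
  have D: "generic_immersion D" "crossings D \<subseteq> double_pairs D"
    using assms(1) by (simp_all add: twisted_link_diagram_def)
  let ?D' = "image_diagram (F 1) D"
  have inj: "inj (F 1)" using f'(4) by (rule bij_is_inj)
  have "quandle_isomorphic (twisted_link_quandle ?D') (virtual_link_quandle Dt)"
  proof (rule doubling_quandle_isomorphic)
    show "generic_immersion ?D'"
      by (rule generic_immersion_image[OF D(1) inj f'(1-3)])
    show "crossings ?D' \<subseteq> double_pairs ?D'"
      using D(2) unfolding double_pairs_image[OF inj] by (simp add: image_diagram_def)
    show "finite (bar_params ?D')"
      unfolding bar_params_image[OF inj] by (rule finite_bar_params[OF assms(1)])
  qed (fact F Dt)+
  \<comment> \<open>The twisted link quandle of the moved diagram is equal to that of
    \<open>D\<close>, so rewriting suffices.\<close>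
  then show ?thesis
    by (simp add: twisted_link_quandle_image[OF D inj f'(1,5)])
qed

end
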